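(* For $T>0$ let $\mathcal{B}_T$ be the set of triples $(c,d,k)$ with $c,d\in\mathbb{Z}[i]$ and $k\in\{0,1,i,1+i\}$ for which there exists $b\in\mathbb{Z}[i]$ such that the matrix $M(c,d,k)=\begin{pmatrix} d+ck & b\\ c& d\end{pmatrix}$ has determinant $1$, and such that its trace $2d+ck$ satisfies $4<|2d+ck|^2\le T$. Then, as $T\to\infty$, $$|\mathcal{B}_T|=\frac{\pi^{3}}{4\,\zeta_K(2)}\,T(\log T)^2+O\bigl(T\log T(\log\log T)^2\bigr)=\frac{3\pi}{2G}\,T(\log T)^2+O\bigl(T\log T(\log\log T)^2\bigr),$$ where $\zeta_K$ is the Dedekind zeta function of $K=\mathbb{Q}(i)$ and $G=L(2,\chi_{-4})=\sum_{n\ge 0}\frac{(-1)^n}{(2n+1)^2}$ is Catalan's constant.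
   Context: $\mathbb{Z}[i]$ is the ring of Gaussian integers. The conditions force $c\neq 0$ (if $c=0$ then $d=\pm1$ and the trace is $\pm2$), so $b$ is uniquely determined by $(c,d,k)$; equivalently $\mathcal{B}_T$ may be regarded as the set of matrices $\begin{pmatrix} d+ck & b\\ c& d\end{pmatrix}\in \mathrm{SL}(2,\mathbb{Z}[i])$ with $k\in\{0,1,i,1+i\}$ and $4<|2d+ck|^2\le T$. *)

theory Defs
  imports
    "HOL-Analysis.Analysis"
    "HOL-Algebra.QuotRing"
    "HOL-Library.Landau_Symbols"
begin

definition gaussian_integers :: "complex set"
  where "gaussian_integers = {z. Re z \<in> \<int> \<and> Im z \<in> \<int>}"

definition M_mat :: "complex \<Rightarrow> complex \<Rightarrow> complex \<Rightarrow> complex \<Rightarrow> complex ^ 2 ^ 2"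
  where "M_mat c d k b = vector [vector [d + c * k, b], vector [c, d]]"

lemma trace_M_mat: "trace (M_mat c d k b) = 2 * d + c * k"
  by (simp add: M_mat_def trace_def UNIV_2)

lemma det_M_mat: "det (M_mat c d k b) = (d + c * k) * d - b * c"
  by (simp add: M_mat_def det_2)

definition B_set :: "real \<Rightarrow> (complex \<times> complex \<times> complex) set"
  where "B_set T = {(c, d, k). c \<in> gaussian_integers \<and> d \<in> gaussian_integers \<and>
     k \<in> {0, 1, \<i>, 1 + \<i>} \<and>
     (\<exists>b\<in>gaussian_integers. det (M_mat c d k b) = 1 \<and>
        4 < (cmod (trace (M_mat c d k b)))\<^sup>2 \<and> (cmod (trace (M_mat c d k b)))\<^sup>2 \<le> T)}"

definition rationals_adjoin_i :: "complex set"
  where "rationals_adjoin_i = {of_rat a + of_rat b * \<i> | a b. True}"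

definition ring_of_integers :: "complex set \<Rightarrow> complex ring"
  where "ring_of_integers K =
    \<lparr>carrier = {x \<in> K. algebraic_int x}, mult = (*), one = 1, zero = 0, add = (+)\<rparr>"

definition ideal_norm :: "complex ring \<Rightarrow> complex set \<Rightarrow> nat"
  where "ideal_norm R I = card (carrier (R Quot I))"

text \<open>The Dedekind zeta function of a number field \<open>K\<close>, as the sum over the nonzero ideals
  of its ring of integers; meaningful for real \<open>s > 1\<close>, where the sum converges.\<close>

definition dedekind_zeta :: "complex set \<Rightarrow> real \<Rightarrow> real"
  where "dedekind_zeta K s =
    (\<Sum>\<^sub>\<infinity>I\<in>{I. ideal I (ring_of_integers K) \<and> I \<noteq> {0}}.
       real (ideal_norm (ring_of_integers K) I) powr (-s))"

text \<open>Catalan's constant is \<open>L(2, \<chi>)\<close> for the nonprincipal character \<open>\<chi>\<close> modulo 4, which vanishes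
  at even numbers and is \<open>(-1) ^ n\<close> at \<open>2 * n + 1\<close>.\<close>

definition catalan :: real
  where "catalan = (\<Sum>n. (-1) ^ n / (2 * real n + 1)\<^sup>2)"

end

theory Submission
  imports Defs "HOL-Number_Theory.Number_Theory"
begin

text \<open>
  The upper right entry \<open>b\<close> of a matrix exists precisely when \<open>c\<close> divides \<open>d\<^sup>2 - 1\<close>, so
  that for each shift \<open>k\<close> the pairs \<open>(c, d)\<close> with \<open>c \<noteq> 0\<close>, \<open>c dvd d\<^sup>2 - 1\<close> and trace
  \<open>t = 2d + ck\<close> in the annulus \<open>4 < |t|\<^sup>2 \<le> T\<close> have to be counted
  (\<open>B_set_eq_trace_solutions\<close>). For fixed \<open>c\<close> the admissible \<open>d\<close> fill \<open>\<rho>(c)\<close> residue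
  classes modulo \<open>c\<close>, where \<open>\<rho>(c)\<close> is the number of square roots of 1 modulo \<open>c\<close>, and
  counting lattice points in a disc of radius \<open>\<surd>T / (2|c|)\<close> gives \<open>\<rho>(c) \<pi> T / (4 N(c))\<close> of
  them, with an error that is acceptable as long as \<open>N(c)\<close> is not much larger than \<open>T\<close>.

  Larger \<open>c\<close> are reached by Dirichlet's hyperbola method. If \<open>d\<^sup>2 - 1 = c e\<close>, then \<open>c\<close>
  divides \<open>t\<^sup>2 - 4\<close> up to a bounded factor, and exchanging \<open>c\<close> for the complementary
  divisor \<open>c'\<close> is an explicit involution on the pairs with given trace (\<open>dual_map\<close>,
  \<open>trace_duality_exists\<close>). As \<open>|c c'|\<close> is at most \<open>T + 4\<close>, one of \<open>c\<close> and \<open>c'\<close> has norm at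
  most \<open>T + 4\<close>, and the pairs for which both have are few. Summing over the four shifts,
  the cardinality is \<open>2 \<pi> T\<close> times the sum of \<open>\<rho>(c) / N(c)\<close> over \<open>N(c) \<le> T + 4\<close>, up to
  \<open>O(T log T)\<close> (\<open>card_trace_solutions\<close>).

  It remains to show that this sum is \<open>3 / (4 G) (log T)\<^sup>2 + O(log T)\<close>
  (\<open>rho_sum_asymptotic\<close>). For \<open>c\<close> prime to \<open>1 + i\<close>, \<open>4 \<rho>(c)\<close> is the number of
  factorizations of \<open>c\<close> into two coprime elements (\<open>card_coprime_factorizations\<close>). Without
  coprimality the corresponding sum over pairs is an elementary hyperbola sum. Sorting
  pairs by their greatest common divisor \<open>g\<close> expresses it by the coprime sum at
  \<open>x / N(g)\<^sup>2\<close> with weights \<open>1 / (4 N(g)\<^sup>2)\<close>; the weights of the nonunits have sum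
  \<open>\<pi>\<^sup>2 G / 8 - 1 < 1\<close>, so this renewal equation can be solved by induction on \<open>x\<close>
  (\<open>log_square_renewal\<close>). The powers of \<open>1 + i\<close> contribute the factor 3, the sum of the
  densities of the square roots of 1 modulo these powers (\<open>rho_glam_power\<close>,
  \<open>lam_weight_sums\<close>).

  The lattice sums involved come from Jacobi's formula: the number of elements of norm
  \<open>n\<close> is \<open>4\<close> times the sum of the character \<open>\<chi>\<close> modulo 4 over the divisors of \<open>n\<close>
  (\<open>card_norm_fiber\<close>), proved by comparing the recursions that both sides satisfy at a
  prime. It yields the sum of \<open>1 / N(z)\<close> over \<open>N(z) \<le> x\<close>, and the sum of \<open>1 / N(z)\<^sup>2\<close> over
  all \<open>z\<close>. Since all nonzero ideals of the ring of integers are principal with four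
  generators, the latter also identifies the Dedekind zeta value as \<open>\<zeta>(2) G = \<pi>\<^sup>2 G / 6\<close>
  (\<open>dedekind_zeta_gauss_2\<close>), and the two forms of the main term agree.
\<close>

section \<open>The ring of Gaussian integers\<close>

text \<open>
  Gaussian integers are given a type of their own, so that divisibility and units come
  from the type class \<open>idom\<close>; inside the complex numbers every nonzero element would
  divide every other.
\<close>

datatype gauss = Gauss (gre: int) (gim: int)

instantiation gauss :: comm_ring_1
begin

definition "0 = Gauss 0 0"
definition "1 = Gauss 1 0"
definition "x + y = Gauss (gre x + gre y) (gim x + gim y)"
definition "x - y = Gauss (gre x - gre y) (gim x - gim y)"
definition "- x = Gauss (- gre x) (- gim x)"
definition "x * y = Gauss (gre x * gre y - gim x * gim y) (gre x * gim y + gim x * gre y)"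

instance
proof
  fix a b c :: gauss
  show "a * b * c = a * (b * c)" "a * b = b * a" "(a + b) * c = a * c + b * c"
    by (simp_all add: times_gauss_def plus_gauss_def algebra_simps)
  show "1 * a = a" "a + b + c = a + (b + c)" "a + b = b + a" "0 + a = a" "- a + a = 0"
    "a - b = a + - b" "(0 :: gauss) \<noteq> 1"
    by (simp_all add: zero_gauss_def one_gauss_def plus_gauss_def minus_gauss_def
        uminus_gauss_def times_gauss_def)
qed

end

lemma gauss_sel [simp]:
  "gre 0 = 0" "gim 0 = 0" "gre 1 = 1" "gim 1 = 0"
  "gre (x + y) = gre x + gre y" "gim (x + y) = gim x + gim y"
  "gre (x - y) = gre x - gre y" "gim (x - y) = gim x - gim y"
  "gre (- x) = - gre x" "gim (- x) = - gim x"
  "gre (x * y) = gre x * gre y - gim x * gim y"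
  "gim (x * y) = gre x * gim y + gim x * gre y"
  by (simp_all add: zero_gauss_def one_gauss_def plus_gauss_def minus_gauss_def uminus_gauss_def
        times_gauss_def)

lemma gauss_of_nat_sel [simp]: "gre (of_nat n) = int n" "gim (of_nat n) = 0"
  by (induction n) auto

lemma gauss_of_int_sel [simp]: "gre (of_int n) = n" "gim (of_int n) = 0"
  by (induction n) auto

lemma gauss_numeral_sel [simp]: "gre (numeral n) = numeral n" "gim (numeral n) = 0"
  using gauss_of_int_sel[of "numeral n"] by simp_all

lemma gauss_eq_iff: "x = y \<longleftrightarrow> gre x = gre y \<and> gim x = gim y"
  by (metis gauss.expand)

definition gnorm :: "gauss \<Rightarrow> int"
  where "gnorm z = (gre z)\<^sup>2 + (gim z)\<^sup>2"

definition gcnj :: "gauss \<Rightarrow> gauss"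
  where "gcnj z = Gauss (gre z) (- gim z)"

definition cpx :: "gauss \<Rightarrow> complex"
  where "cpx z = Complex (of_int (gre z)) (of_int (gim z))"

abbreviation gI :: gauss where "gI \<equiv> Gauss 0 1"

text \<open>
  The prime of norm 2.
\<close>

abbreviation glam :: gauss where "glam \<equiv> Gauss 1 1"

lemma gcnj_sel [simp]: "gre (gcnj z) = gre z" "gim (gcnj z) = - gim z"
  by (simp_all add: gcnj_def)

lemma gnorm_mult: "gnorm (x * y) = gnorm x * gnorm y"
  by (simp add: gnorm_def power2_eq_square algebra_simps)

lemma gnorm_ge_0 [simp]: "gnorm z \<ge> 0"
  by (simp add: gnorm_def)

lemma gnorm_0 [simp]: "gnorm 0 = 0" and gnorm_1 [simp]: "gnorm 1 = 1"
  by (simp_all add: gnorm_def)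

lemma gnorm_eq_0_iff [simp]: "gnorm z = 0 \<longleftrightarrow> z = 0"
  by (simp add: gnorm_def gauss_eq_iff sum_power2_eq_zero_iff)

lemma gnorm_pos_iff [simp]: "gnorm z > 0 \<longleftrightarrow> z \<noteq> 0"
  using gnorm_ge_0[of z] gnorm_eq_0_iff[of z] by linarith

lemma gnorm_ge_1_iff: "gnorm z \<ge> 1 \<longleftrightarrow> z \<noteq> 0"
  using gnorm_pos_iff[of z] by linarith

lemma gnorm_cnj [simp]: "gnorm (gcnj z) = gnorm z"
  by (simp add: gnorm_def)

lemma gnorm_of_nat: "gnorm (of_nat n) = int n * int n"
  by (simp add: gnorm_def power2_eq_square)

lemma gnorm_glam: "gnorm glam = 2"
  by (simp add: gnorm_def)

lemma gnorm_power: "gnorm (z ^ n) = gnorm z ^ n"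
  by (induction n) (auto simp: gnorm_mult)

lemma mult_gcnj: "z * gcnj z = of_int (gnorm z)"
  by (simp add: gauss_eq_iff gnorm_def power2_eq_square)

instance gauss :: idom
proof
  fix a b :: gauss assume "a \<noteq> 0" "b \<noteq> 0"
  then have "gnorm (a * b) \<noteq> 0" by (simp add: gnorm_mult)
  then show "a * b \<noteq> 0" by auto
qed

lemma cpx_simps [simp]:
  "cpx 0 = 0" "cpx 1 = 1" "cpx (x + y) = cpx x + cpx y" "cpx (x - y) = cpx x - cpx y"
  "cpx (- x) = - cpx x" "cpx (x * y) = cpx x * cpx y" "cpx (numeral n) = numeral n"
  by (simp_all add: cpx_def complex_eq_iff)

lemma cpx_power [simp]: "cpx (x ^ n) = cpx x ^ n"
  by (induction n) auto

lemma cpx_eq_iff [simp]: "cpx x = cpx y \<longleftrightarrow> x = y"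
  by (auto simp: cpx_def gauss_eq_iff complex_eq_iff)

lemma cpx_eq_0_iff [simp]: "cpx x = 0 \<longleftrightarrow> x = 0"
  using cpx_eq_iff[of x 0] by simp

lemma norm_cpx_sq: "(cmod (cpx z))\<^sup>2 = real_of_int (gnorm z)"
  by (simp add: cpx_def gnorm_def cmod_power2)

lemma norm_cpx: "cmod (cpx z) = sqrt (real_of_int (gnorm z))"
  by (metis norm_cpx_sq norm_ge_zero real_sqrt_unique)

lemma inj_cpx: "inj cpx"
  by (auto intro: injI)

lemma range_cpx: "range cpx = gaussian_integers"
proof (intro equalityI subsetI)
  fix z assume "z \<in> gaussian_integers"
  then obtain a b where "Re z = of_int a" "Im z = of_int b"
    by (auto simp: gaussian_integers_def elim!: Ints_cases)
  then have "z = cpx (Gauss a b)" by (simp add: cpx_def complex_eq_iff)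
  then show "z \<in> range cpx" by blast
qed (auto simp: gaussian_integers_def cpx_def)

lemma finite_gnorm_le: "finite {z. gnorm z \<le> n}"
proof (rule finite_subset)
  have sq: "\<bar>x\<bar> \<le> x\<^sup>2" for x :: int
    using self_le_power[of "\<bar>x\<bar>" 2] by (cases "x = 0") auto
  have "\<bar>gre z\<bar> \<le> n \<and> \<bar>gim z\<bar> \<le> n" if "gnorm z \<le> n" for z
    using that sq[of "gre z"] sq[of "gim z"] zero_le_power2[of "gre z"] zero_le_power2[of "gim z"]
    unfolding gnorm_def by linarith
  then show "{z. gnorm z \<le> n} \<subseteq> (\<lambda>(a, b). Gauss a b) ` ({-n..n} \<times> {-n..n})"
    by (force simp: image_iff abs_le_iff gauss_eq_iff)
qed auto

lemma finite_gnorm_le_real: "finite {z. real_of_int (gnorm z) \<le> x}"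
proof -
  have "{z. real_of_int (gnorm z) \<le> x} = {z. gnorm z \<le> \<lfloor>x\<rfloor>}" by (auto simp: le_floor_iff)
  then show ?thesis by (simp add: finite_gnorm_le)
qed

lemma finite_gnorm_eq: "finite {z. gnorm z = n}"
  by (rule finite_subset[OF _ finite_gnorm_le[of n]]) auto

lemma gnorm_eq_1_iff: "gnorm z = 1 \<longleftrightarrow> z \<in> {1, -1, gI, -gI}"
proof
  assume z: "gnorm z = 1"
  then have "(gre z)\<^sup>2 \<le> 1\<^sup>2" "(gim z)\<^sup>2 \<le> 1\<^sup>2"
    unfolding gnorm_def using zero_le_power2[of "gre z"] zero_le_power2[of "gim z"]
    by (simp_all only: one_power2)
  then have "\<bar>gre z\<bar> \<le> 1" "\<bar>gim z\<bar> \<le> 1"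
    by (metis abs_le_square_iff abs_1)+
  then have "gre z \<in> {-1, 0, 1}" "gim z \<in> {-1, 0, 1}" by auto
  then show "z \<in> {1, -1, gI, -gI}" using z by (auto simp: gauss_eq_iff gnorm_def)
qed (auto simp: gnorm_def)

lemma units_gauss: "{z. gnorm z = 1} = {1, -1, gI, -gI}"
  using gnorm_eq_1_iff by blast

lemma card_units_gauss: "card {z. gnorm z = 1} = 4"
  unfolding units_gauss by (simp add: gauss_eq_iff)

lemma gnorm_dvd: "a dvd b \<Longrightarrow> gnorm a dvd gnorm b"
  by (auto simp: gnorm_mult elim!: dvdE)

text \<open>
  A unit has norm dividing 1, and an element of norm 1 is inverted by its conjugate.
\<close>

lemma gauss_unit_iff: "z dvd 1 \<longleftrightarrow> gnorm z = 1"
proof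
  assume "z dvd 1"
  then have "gnorm z dvd 1" using gnorm_dvd[of z 1] by simp
  then have "\<bar>gnorm z\<bar> = 1" by (simp only: zdvd1_eq)
  then show "gnorm z = 1" using gnorm_ge_0[of z] by linarith
next
  assume "gnorm z = 1"
  then have "1 = z * gcnj z" by (simp add: mult_gcnj)
  then show "z dvd 1" by (rule dvdI)
qed

section \<open>Division with remainder and comaximality\<close>

text \<open>
  Coordinatewise rounding of \<open>z / c\<close> to a nearest Gaussian integer, with ties always
  rounded up. Because of the fixed tie rule the quotient commutes with adding multiples of
  \<open>c\<close>, so that \<open>gmod z c\<close> depends only on the class of \<open>z\<close> and is a canonical
  representative.
\<close>

definition gdiv :: "gauss \<Rightarrow> gauss \<Rightarrow> gauss"
  where "gdiv z c = (let w = z * gcnj c; n = gnorm c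
           in Gauss ((2 * gre w + n) div (2 * n)) ((2 * gim w + n) div (2 * n)))"

definition gmod :: "gauss \<Rightarrow> gauss \<Rightarrow> gauss"
  where "gmod z c = z - c * gdiv z c"

lemma gdiv_add_mult:
  assumes "c \<noteq> 0" shows "gdiv (z + c * w) c = gdiv z c + w"
proof -
  have n: "gnorm c \<noteq> 0" using assms by simp
  have *: "gre ((z + c * w) * gcnj c) = gre (z * gcnj c) + gnorm c * gre w"
          "gim ((z + c * w) * gcnj c) = gim (z * gcnj c) + gnorm c * gim w"
    by (simp_all add: gnorm_def power2_eq_square algebra_simps)
  have **: "(2 * (a + gnorm c * b) + gnorm c) div (2 * gnorm c) = (2 * a + gnorm c) div (2 * gnorm c) + b"
    for a b
  proof -
    have "2 * (a + gnorm c * b) + gnorm c = (2 * a + gnorm c) + b * (2 * gnorm c)"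
      by (simp add: algebra_simps)
    then show ?thesis using n by (simp only: div_mult_self1 add.commute)
  qed
  show ?thesis
    unfolding gdiv_def Let_def * ** by (simp add: gauss_eq_iff)
qed

lemma dvd_minus_gmod: "c dvd z - gmod z c"
  by (simp add: gmod_def)

lemma gmod_eq_iff:
  assumes "c \<noteq> 0" shows "gmod z c = gmod w c \<longleftrightarrow> c dvd z - w"
proof
  assume "gmod z c = gmod w c"
  then have "z - w = c * (gdiv z c - gdiv w c)" by (simp add: gmod_def algebra_simps)
  then show "c dvd z - w" by simp
next
  assume "c dvd z - w"
  then obtain u where "z - w = c * u" by (elim dvdE)
  then have "z = w + c * u" by (simp add: algebra_simps)
  then show "gmod z c = gmod w c" by (simp add: gmod_def gdiv_add_mult[OF assms] algebra_simps)
qed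

lemma gmod_gmod: "c \<noteq> 0 \<Longrightarrow> gmod (gmod z c) c = gmod z c"
  by (subst gmod_eq_iff) (auto simp: gmod_def)

text \<open>
  Both coordinates of \<open>z / c - gdiv z c\<close> have absolute value at most \<open>1/2\<close>, so that its
  norm is at most \<open>1/2\<close>. This makes the norm Euclidean.
\<close>

lemma gnorm_gmod:
  assumes "c \<noteq> 0" shows "2 * gnorm (gmod z c) \<le> gnorm c"
proof -
  define n where "n = gnorm c"
  define w where "w = z * gcnj c"
  have n: "n > 0" using assms by (simp add: n_def)
  define a b where "a = (2 * gre w + n) div (2 * n)" and "b = (2 * gim w + n) div (2 * n)"
  have g: "gdiv z c = Gauss a b" unfolding gdiv_def a_def b_def w_def n_def Let_def ..
  have r: "(2 * (x - n * ((2 * x + n) div (2 * n))))\<^sup>2 \<le> n\<^sup>2" for x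
  proof -
    have "(2 * n) * ((2 * x + n) div (2 * n)) + (2 * x + n) mod (2 * n) = 2 * x + n"
      by simp
    moreover have "0 \<le> (2 * x + n) mod (2 * n)" "(2 * x + n) mod (2 * n) < 2 * n" using n by auto
    ultimately have "\<bar>2 * (x - n * ((2 * x + n) div (2 * n)))\<bar> \<le> \<bar>n\<bar>"
      by (simp add: algebra_simps)
    then show ?thesis by (simp only: abs_le_square_iff)
  qed
  have e: "gmod z c * gcnj c = Gauss (gre w - n * a) (gim w - n * b)"
    by (simp add: gmod_def g w_def n_def gnorm_def gauss_eq_iff power2_eq_square algebra_simps)
  have "4 * (gnorm (gmod z c) * n) = (2 * (gre w - n * a))\<^sup>2 + (2 * (gim w - n * b))\<^sup>2"
    using arg_cong[OF e, of gnorm] by (simp add: gnorm_mult n_def) (simp add: gnorm_def algebra_simps power2_eq_square)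
  also have "\<dots> \<le> n\<^sup>2 + n\<^sup>2" unfolding a_def b_def by (intro add_mono r)
  finally have "n * (2 * gnorm (gmod z c)) \<le> n * n" by (simp add: power2_eq_square)
  then show ?thesis using n by (simp add: n_def)
qed

text \<open>
  The nonzero combination \<open>u * a + v * b\<close> of least norm divides all the others, since a
  remainder would be a combination of smaller norm.
\<close>

lemma gauss_bezout:
  obtains g u v :: gauss where "g dvd a" "g dvd b" "g = u * a + v * b"
proof (cases "a = 0 \<and> b = 0")
  case True then show ?thesis using that[of 0 0 0] by simp
next
  case False
  define I where "I = {z. z \<noteq> 0 \<and> (\<exists>u v. z = u * a + v * b)}"
  have "a = 1 * a + 0 * b" "b = 0 * a + 1 * b" by simp_all
  then have "a \<in> I \<or> b \<in> I" using False unfolding I_def by blast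
  then have "\<exists>z. z \<in> I" by blast
  then obtain g where g: "g \<in> I" and min: "\<And>z. z \<in> I \<Longrightarrow> nat (gnorm g) \<le> nat (gnorm z)"
    using ex_has_least_nat[of "\<lambda>z. z \<in> I" _ "\<lambda>z. nat (gnorm z)"] by blast
  obtain u v where guv: "g = u * a + v * b" and g0: "g \<noteq> 0" using g by (auto simp: I_def)
  have *: "g dvd x * a + y * b" for x y
  proof -
    let ?z = "x * a + y * b"
    have "gmod ?z g = 0"
    proof (rule ccontr)
      assume n0: "gmod ?z g \<noteq> 0"
      have "gmod ?z g = (x - gdiv ?z g * u) * a + (y - gdiv ?z g * v) * b"
        unfolding gmod_def by (subst guv) (simp add: algebra_simps)
      then have "gmod ?z g \<in> I" using n0 unfolding I_def by blast
      then have "gnorm g \<le> gnorm (gmod ?z g)" using min[of "gmod ?z g"] gnorm_ge_0[of "gmod ?z g"] by linarith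
      moreover have "2 * gnorm (gmod ?z g) \<le> gnorm g" by (rule gnorm_gmod[OF g0])
      moreover have "gnorm g > 0" using g0 by simp
      ultimately show False by linarith
    qed
    then show ?thesis using dvd_minus_gmod[of g ?z] by simp
  qed
  show ?thesis
    using that[OF _ _ guv] *[of 1 0] *[of 0 1] by simp
qed

text \<open>
  Coprimality in the form of a Bezout identity: this is the form in which it enters every
  divisibility argument below.
\<close>

definition comax :: "gauss \<Rightarrow> gauss \<Rightarrow> bool"
  where "comax a b \<longleftrightarrow> (\<exists>u v. u * a + v * b = 1)"

lemma comax_commute: "comax a b \<longleftrightarrow> comax b a"
proof -
  have "comax b a" if "comax a b" for a b
  proof -
    from that obtain u v where "u * a + v * b = 1" by (auto simp: comax_def)
    then have "v * b + u * a = 1" by (simp add: add.commute)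
    then show ?thesis unfolding comax_def by blast
  qed
  then show ?thesis by blast
qed

lemma comax_dvd_mult: "comax a b \<Longrightarrow> a dvd b * c \<Longrightarrow> a dvd c"
proof -
  assume "comax a b" and d: "a dvd b * c"
  then obtain u v where "u * a + v * b = 1" by (auto simp: comax_def)
  then have "c = (u * a + v * b) * c" by simp
  also have "\<dots> = a * (u * c) + (b * c) * v" by (simp add: algebra_simps)
  finally have "c = a * (u * c) + (b * c) * v" .
  moreover have "a dvd a * (u * c) + (b * c) * v" using d by (intro dvd_add dvd_triv_left) (rule dvd_mult2)
  ultimately show "a dvd c" by simp
qed

lemma comax_mult_dvd:
  assumes "comax a b" "a dvd c" "b dvd c" shows "a * b dvd c"
proof -
  obtain k where k: "c = b * k" using assms(3) by (elim dvdE)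
  then have "a dvd k" using assms comax_dvd_mult by blast
  then show ?thesis unfolding k by (subst mult.commute) (rule mult_dvd_mono[OF dvd_refl])
qed

lemma comax_mult_right:
  assumes "comax a b" "comax a c" shows "comax a (b * c)"
proof -
  obtain u v u' v' where "u * a + v * b = 1" "u' * a + v' * c = 1"
    using assms by (auto simp: comax_def)
  then have "1 = (u * a + v * b) * (u' * a + v' * c)" by simp
  also have "\<dots> = (u * u' * a + u * v' * c + v * b * u') * a + v * v' * (b * c)"
    by (simp add: algebra_simps)
  finally show ?thesis unfolding comax_def by (intro exI) (rule sym)
qed

lemma comax_unit_dvd: "comax a b \<Longrightarrow> d dvd a \<Longrightarrow> d dvd b \<Longrightarrow> d dvd 1"
proof -
  assume "comax a b" "d dvd a" "d dvd b"
  then obtain u v where "u * a + v * b = 1" by (auto simp: comax_def)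
  moreover have "d dvd u * a + v * b" using \<open>d dvd a\<close> \<open>d dvd b\<close> by (intro dvd_add dvd_mult)
  ultimately show "d dvd 1" by simp
qed

section \<open>Sums of two squares\<close>

text \<open>
  The representations of \<open>n\<close> as a sum of two squares.
\<close>

definition norm_fiber :: "nat \<Rightarrow> gauss set"
  where "norm_fiber n = {z. gnorm z = int n}"

text \<open>
  The nonprincipal Dirichlet character modulo 4.
\<close>

definition chi4 :: "nat \<Rightarrow> int"
  where "chi4 n = (if even n then 0 else if n mod 4 = 1 then 1 else -1)"

definition chi_sum :: "nat \<Rightarrow> int"
  where "chi_sum n = (\<Sum>d | d dvd n. chi4 d)"

lemma finite_norm_fiber [simp]: "finite (norm_fiber n)"
  unfolding norm_fiber_def by (rule finite_gnorm_eq)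

lemma chi4_mult: "chi4 (a * b) = chi4 a * chi4 b"
proof (cases "even a \<or> even b")
  case True then show ?thesis by (auto simp: chi4_def)
next
  case False
  then have "a mod 4 = 1 \<or> a mod 4 = 3" "b mod 4 = 1 \<or> b mod 4 = 3" by presburger+
  moreover have "a * b mod 4 = (a mod 4) * (b mod 4) mod 4" by (simp add: mod_mult_eq)
  ultimately show ?thesis using False by (auto simp: chi4_def)
qed

text \<open>
  The divisors of \<open>p * n\<close> are the divisors of \<open>n\<close> together with their multiples by \<open>p\<close>;
  the two sets overlap in the numbers \<open>p * d\<close> with \<open>d\<close> a divisor of \<open>n div p\<close>. Inclusion
  and exclusion gives the identity.
\<close>

lemma chi_sum_hecke:
  assumes p: "prime p" and n: "n > 0"
  shows "chi_sum (p * n) + (if p dvd n then chi4 p * chi_sum (n div p) else 0) = (1 + chi4 p) * chi_sum n"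
proof -
  have p0: "p > 0" using p by (simp add: prime_gt_0_nat)
  define A where "A = {d. d dvd n}"
  define B where "B = (*) p ` A"
  have fin: "finite A" "finite B" using n by (auto simp: A_def B_def)
  have sumB: "(\<Sum>d\<in>B. chi4 d) = chi4 p * chi_sum n"
    unfolding B_def using p0
    by (subst sum.reindex) (auto simp: inj_on_def chi4_mult sum_distrib_left A_def chi_sum_def)
  have union: "{d. d dvd p * n} = A \<union> B"
  proof (intro equalityI subsetI)
    fix d assume d: "d \<in> {d. d dvd p * n}"
    show "d \<in> A \<union> B"
    proof (cases "p dvd d")
      case True
      then obtain e where "d = p * e" by (elim dvdE)
      then show ?thesis using d p0 by (auto simp: A_def B_def)
    next
      case False
      then have "coprime d p" using p by (metis coprime_commute prime_imp_coprime)
      then show ?thesis using d by (auto simp: A_def coprime_dvd_mult_right_iff)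
    qed
  next
    fix d assume "d \<in> A \<union> B" then show "d \<in> {d. d dvd p * n}"
      by (auto simp: A_def B_def intro: mult_dvd_mono)
  qed
  have inter: "(\<Sum>d\<in>A \<inter> B. chi4 d) = (if p dvd n then chi4 p * chi_sum (n div p) else 0)"
  proof (cases "p dvd n")
    case True
    then obtain m where m: "n = p * m" by (elim dvdE)
    have "A \<inter> B = (*) p ` {d. d dvd m}" using p0 by (auto simp: A_def B_def m)
    then have "(\<Sum>d\<in>A \<inter> B. chi4 d) = chi4 p * chi_sum m" using p0
      by (simp add: sum.reindex inj_on_def chi4_mult sum_distrib_left chi_sum_def)
    then show ?thesis using True p0 m by simp
  next
    case False
    then have "A \<inter> B = {}" by (auto simp: A_def B_def dest: dvd_mult_left)
    then show ?thesis using False by simp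
  qed
  have "(\<Sum>d\<in>A \<union> B. chi4 d) + (\<Sum>d\<in>A \<inter> B. chi4 d) = (\<Sum>d\<in>A. chi4 d) + (\<Sum>d\<in>B. chi4 d)"
    by (rule sum.union_inter[OF fin])
  then show ?thesis unfolding inter sumB union[symmetric]
    by (simp add: chi_sum_def A_def algebra_simps)
qed

lemma glam_dvd_iff: "glam dvd z \<longleftrightarrow> even (gnorm z)"
proof
  assume "glam dvd z"
  then obtain w where "z = glam * w" by (elim dvdE)
  then show "even (gnorm z)" by (simp add: gnorm_mult) (simp add: gnorm_def)
next
  assume "even (gnorm z)"
  then have "even (gre z + gim z)" by (simp add: gnorm_def)
  then obtain k where k: "gre z + gim z = 2 * k" by (elim evenE)
  have "z = glam * Gauss k (k - gre z)" using k by (simp add: gauss_eq_iff)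
  then show "glam dvd z" by (rule dvdI)
qed

text \<open>
  An element of prime norm has only trivial divisors, so that its greatest common divisor
  with \<open>z\<close> is a unit or an associate of it.
\<close>

lemma prime_norm_dvd_or_comax:
  assumes p: "prime p" and q: "gnorm q = int p"
  shows "q dvd z \<or> comax q z"
proof -
  obtain g u v where g: "g dvd q" "g dvd z" "g = u * q + v * z" by (rule gauss_bezout)
  obtain w where w: "q = g * w" using g(1) by (elim dvdE)
  have "gnorm g * gnorm w = int p" using w q by (simp add: gnorm_mult)
  then have "nat (gnorm g) * nat (gnorm w) = p" by (metis gnorm_ge_0 nat_int nat_mult_distrib)
  then have "nat (gnorm g) = 1 \<or> nat (gnorm w) = 1" using p by (metis prime_product)
  then consider "gnorm g = 1" | "gnorm w = 1" by linarith
  then show ?thesis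
  proof cases
    case 1
    then have "gcnj g * g = 1" by (simp add: mult.commute mult_gcnj)
    then have "(gcnj g * u) * q + (gcnj g * v) * z = 1" using g(3) by (simp add: algebra_simps)
    then show ?thesis unfolding comax_def by blast
  next
    case 2
    then have "g = q * gcnj w" by (simp add: w mult.assoc mult_gcnj)
    then have "q dvd g" by simp
    then show ?thesis using g(2) dvd_trans by blast
  qed
qed

lemma of_nat_dvd_gauss_iff: "of_nat n dvd z \<longleftrightarrow> int n dvd gre z \<and> int n dvd gim z"
proof
  assume "int n dvd gre z \<and> int n dvd gim z"
  then obtain a b where "gre z = int n * a" "gim z = int n * b" by (auto elim!: dvdE)
  then have "z = of_nat n * Gauss a b" by (simp add: gauss_eq_iff)
  then show "of_nat n dvd z" by simp
qed (auto elim!: dvdE)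

text \<open>
  The greatest common divisor of \<open>p\<close> and \<open>z\<close> has norm \<open>1\<close>, \<open>p\<close> or \<open>p\<^sup>2\<close>. Norm \<open>1\<close> would
  make \<open>p\<close> divide the conjugate of \<open>z\<close>, and norm \<open>p\<^sup>2\<close> makes it an associate of \<open>p\<close>; both
  force \<open>p\<close> to divide \<open>z\<close>.
\<close>

lemma prime_dvd_or_norm_eq:
  assumes p: "prime p" and d: "int p dvd gnorm z" "\<not> of_nat p dvd z"
  obtains q where "gnorm q = int p"
proof -
  obtain g u v where g: "g dvd of_nat p" "g dvd z" "g = u * of_nat p + v * z" by (rule gauss_bezout)
  obtain w where w: "of_nat p = g * w" using g(1) by (elim dvdE)
  have "gnorm g * gnorm w = int (p ^ 2)" using arg_cong[OF w, of gnorm]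
    by (simp add: gnorm_mult) (simp add: gnorm_def)
  then have "nat (gnorm g) * nat (gnorm w) = p ^ 2" by (metis gnorm_ge_0 nat_int nat_mult_distrib)
  then obtain i where i: "i \<le> 2" "nat (gnorm g) = p ^ i"
    using p by (metis divides_primepow_nat dvd_triv_left)
  consider "i = 0" | "i = 1" | "i = 2" using i(1) by linarith
  then show ?thesis
  proof cases
    case 1
    then have "gnorm g = 1" using i by simp
    then have "1 = gcnj g * g" by (simp add: mult.commute mult_gcnj)
    then have "gcnj z = gcnj g * (u * of_nat p + v * z) * gcnj z" using g(3) by simp
    also have "\<dots> = of_nat p * (gcnj g * u * gcnj z) + gcnj g * v * of_int (gnorm z)"
      by (simp add: algebra_simps flip: mult_gcnj)
    finally have "gcnj z = of_nat p * (gcnj g * u * gcnj z) + gcnj g * v * of_int (gnorm z)" .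
    moreover have "of_nat p dvd (of_int (gnorm z) :: gauss)" using d(1) by (simp add: of_nat_dvd_gauss_iff)
    ultimately have "of_nat p dvd gcnj z" by (metis dvd_add dvd_mult dvd_triv_left)
    then show ?thesis using d(2) by (simp add: of_nat_dvd_gauss_iff)
  next
    case 2 then show ?thesis using i that by (metis gnorm_ge_0 int_nat_eq power_one_right)
  next
    case 3
    have "p > 0" using p by (simp add: prime_gt_0_nat)
    then have "nat (gnorm w) = 1" using i 3 \<open>nat (gnorm g) * nat (gnorm w) = p ^ 2\<close> by simp
    then have "gnorm w = 1" by linarith
    then have "g = of_nat p * gcnj w" by (simp add: w mult.assoc mult_gcnj)
    then have "of_nat p dvd z" using g(2) by (metis dvd_mult_left)
    then show ?thesis using d(2) by blast
  qed
qed

text \<open>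
  By Euler's criterion \<open>p\<close> divides \<open>u\<^sup>2 + 1\<close>, the norm of \<open>u + i\<close>, for some \<open>u\<close>, while
  \<open>p\<close> does not divide \<open>u + i\<close>.
\<close>

lemma ex_norm_eq_prime:
  assumes p: "prime p" and p4: "p mod 4 = 1"
  obtains q where "gnorm q = int p"
proof -
  have p2: "p > 2" using prime_gt_1_nat[OF p] p4 by (cases "p = 2") auto
  have "p - 1 = 4 * (p div 4)" using p4 p2 by presburger
  then have "(p - 1) div 2 = 2 * (p div 4)" by simp
  then have "[Legendre (-1) (int p) = 1] (mod int p)"
    using euler_criterion[OF p p2, of "-1"] by simp
  moreover have "Legendre (-1) (int p) \<in> {-1, 0, 1}" by (simp add: Legendre_def)
  moreover have "\<not> [-1 = 1] (mod int p)" "\<not> [0 = 1] (mod int p)"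
    using p2 by (auto simp: cong_iff_dvd_diff dest!: zdvd_imp_le)
  ultimately have "Legendre (-1) (int p) = 1" by auto
  then have "QuadRes (int p) (-1)" by (auto simp: Legendre_def split: if_splits)
  then obtain u where "[u\<^sup>2 = -1] (mod int p)" by (auto simp: QuadRes_def)
  then have "int p dvd gnorm (Gauss u 1)" by (simp add: gnorm_def cong_iff_dvd_diff)
  moreover have "\<not> of_nat p dvd Gauss u 1" using p2 by (simp add: of_nat_dvd_gauss_iff)
  ultimately show ?thesis using prime_dvd_or_norm_eq[OF p] that by blast
qed

text \<open>
  Let \<open>p\<close> be the product of \<open>q\<close> and its conjugate. An element of norm \<open>p * n\<close> is
  divisible by \<open>q\<close> or by the conjugate, and by both exactly when it is divisible by \<open>p\<close>,
  because the two are comaximal for odd \<open>p\<close>. Inclusion and exclusion gives the identity.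
\<close>

lemma card_norm_fiber_split:
  assumes p: "prime p" and q: "gnorm q = int p" and odd: "odd p"
  shows "int (card (norm_fiber (p * n))) + (if p dvd n then int (card (norm_fiber (n div p))) else 0)
           = 2 * int (card (norm_fiber n))"
proof -
  have p0: "p > 0" using p by (simp add: prime_gt_0_nat)
  let ?r = "gcnj q"
  have qr: "q * ?r = of_nat p" using mult_gcnj[of q] q by simp
  have q0: "q \<noteq> 0" "?r \<noteq> 0" using q p0 by (metis gnorm_0 gnorm_cnj of_nat_0_less_iff order_less_irrefl)+
  have cop: "comax q ?r"
  proof (rule ccontr)
    assume "\<not> comax q ?r"
    then have d: "q dvd ?r" using prime_norm_dvd_or_comax[OF p q] by blast
    (* Sum and difference of q and its conjugate are twice the real part and 2i times the imaginary
       part, so p would divide both parts of q, and its square would divide the norm p. *)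
    have "q dvd q + ?r" "q dvd q - ?r" using d by auto
    then have "int p dvd gnorm (q + ?r)" "int p dvd gnorm (q - ?r)"
      using gnorm_dvd q by metis+
    then have "int p dvd 2 * 2 * (gre q * gre q)" "int p dvd 2 * 2 * (gim q * gim q)"
      by (simp_all add: gnorm_def power2_eq_square)
    moreover have "coprime (int p) 2" using odd by simp
    then have "coprime (int p) (2 * 2)" by (simp only: coprime_mult_right_iff)
    ultimately have "int p dvd gre q * gre q" "int p dvd gim q * gim q"
      using coprime_dvd_mult_right_iff by blast+
    then have "int p dvd gre q" "int p dvd gim q"
      using p by (simp_all add: prime_dvd_mult_iff)
    then have "int p * int p dvd (gre q)\<^sup>2 + (gim q)\<^sup>2"
      by (simp add: power2_eq_square mult_dvd_mono)
    then have "int p * int p dvd int p * 1" using q by (simp add: gnorm_def)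
    then have "int p dvd 1" using p0 by (subst (asm) dvd_mult_cancel_left) auto
    then show False using prime_gt_1_nat[OF p] by simp
  qed
  define A where "A = (*) q ` norm_fiber n"
  define B where "B = (*) ?r ` norm_fiber n"
  have cA: "card A = card (norm_fiber n)" "card B = card (norm_fiber n)"
    unfolding A_def B_def using q0 by (auto intro!: card_image simp: inj_on_def)
  have mem: "q * w \<in> norm_fiber (p * n) \<longleftrightarrow> w \<in> norm_fiber n"
            "?r * w \<in> norm_fiber (p * n) \<longleftrightarrow> w \<in> norm_fiber n" for w
    using p0 by (auto simp: norm_fiber_def gnorm_mult q)
  have union: "norm_fiber (p * n) = A \<union> B"
  proof (intro equalityI subsetI)
    fix z assume z: "z \<in> norm_fiber (p * n)"
    have "q dvd z \<or> ?r dvd z"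
    proof (cases "comax q z")
      case False then show ?thesis using prime_norm_dvd_or_comax[OF p q] by blast
    next
      case True
      have "z * gcnj z = q * (?r * of_nat n)"
        using z by (simp add: mult_gcnj norm_fiber_def flip: qr mult.assoc)
      then have "q dvd gcnj z" using comax_dvd_mult[OF True] by (metis dvd_triv_left)
      then obtain w where "gcnj z = q * w" by (elim dvdE)
      then have "z = ?r * gcnj w" by (simp add: gauss_eq_iff)
      then show ?thesis by simp
    qed
    then show "z \<in> A \<union> B" using z mem unfolding A_def B_def by (auto elim!: dvdE)
  qed (use mem in \<open>auto simp: A_def B_def\<close>)
  have inter: "int (card (A \<inter> B)) = (if p dvd n then int (card (norm_fiber (n div p))) else 0)"
  proof -
    have *: "z \<in> A \<inter> B \<longleftrightarrow> (\<exists>w. z = of_nat p * w \<and> gnorm w * int p = int n)" for z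
    proof
      assume "z \<in> A \<inter> B"
      then have "\<exists>x. z = q * x" "\<exists>x. z = ?r * x" "z \<in> norm_fiber (p * n)"
        unfolding union unfolding A_def B_def by blast+
      then have "q dvd z" "?r dvd z" "z \<in> norm_fiber (p * n)"
        unfolding dvd_def by blast+
      then have z: "q dvd z" "?r dvd z" "gnorm z = int p * int n" by (auto simp: norm_fiber_def)
      then have "q * ?r dvd z" using comax_mult_dvd cop by blast
      then obtain w where w: "z = of_nat p * w" unfolding qr by (elim dvdE)
      then have "int p * (gnorm w * int p) = int p * int n" using z(3)
        by (simp add: gnorm_mult gnorm_of_nat mult_ac)
      then have "gnorm w * int p = int n" using p0 by simp
      then show "\<exists>w. z = of_nat p * w \<and> gnorm w * int p = int n" using w by blast
    next
      assume "\<exists>w. z = of_nat p * w \<and> gnorm w * int p = int n"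
      then obtain w where w: "z = of_nat p * w" "gnorm w * int p = int n" by blast
      have "z = q * (?r * w)" "z = ?r * (q * w)" using w(1) by (simp_all add: mult_ac flip: qr)
      moreover have "?r * w \<in> norm_fiber n" "q * w \<in> norm_fiber n"
        using w(2) q by (simp_all add: norm_fiber_def gnorm_mult mult.commute)
      ultimately show "z \<in> A \<inter> B" unfolding A_def B_def by blast
    qed
    show ?thesis
    proof (cases "p dvd n")
      case True
      then obtain m where m: "n = p * m" by (elim dvdE)
      have "A \<inter> B = (*) (of_nat p) ` norm_fiber m"
        unfolding set_eq_iff * using p0 by (auto simp: m norm_fiber_def image_iff)
      moreover have "(of_nat p :: gauss) \<noteq> 0" using q0 qr by (metis mult_eq_0_iff)
      ultimately have "card (A \<inter> B) = card (norm_fiber m)"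
        by (auto intro!: card_image simp: inj_on_def)
      then show ?thesis using True m p0 by simp
    next
      case False
      then have "A \<inter> B = {}" using * by (metis dvd_triv_right equals0I int_dvd_int_iff)
      then show ?thesis using False by simp
    qed
  qed
  have "card A + card B = card (A \<union> B) + card (A \<inter> B)"
    unfolding A_def B_def by (rule card_Un_Int) auto
  then show ?thesis unfolding inter[symmetric] union cA by linarith
qed

text \<open>
  The same recursion as for \<open>chi_sum\<close>. The prime 2 is ramified, so multiplication by
  \<open>1 + i\<close> is a bijection; primes congruent to 1 modulo 4 split; primes congruent to 3 are
  not norms, so that an element of norm divisible by \<open>p\<close> is itself divisible by \<open>p\<close>.
\<close>

lemma card_norm_fiber_hecke:
  assumes p: "prime p" and n: "n > 0"
  shows "int (card (norm_fiber (p * n))) +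
           (if p dvd n then chi4 p * int (card (norm_fiber (n div p))) else 0)
         = (1 + chi4 p) * int (card (norm_fiber n))"
proof -
  have p0: "p > 0" using p by (simp add: prime_gt_0_nat)
  consider "p = 2" | "odd p" "p mod 4 = 1" | "odd p" "p mod 4 = 3"
  proof -
    have "p = 2 \<or> odd p" using p by (metis prime_nat_iff primes_dvd_imp_eq two_is_prime_nat)
    moreover have "odd p \<Longrightarrow> p mod 4 = 1 \<or> p mod 4 = 3" by presburger
    ultimately show ?thesis using that by blast
  qed
  then show ?thesis
  proof cases
    case 1
    have "norm_fiber (2 * n) = (*) glam ` norm_fiber n"
    proof (intro equalityI subsetI)
      fix z assume z: "z \<in> norm_fiber (2 * n)"
      then have "glam dvd z" unfolding glam_dvd_iff by (simp add: norm_fiber_def)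
      then obtain w where w: "z = glam * w" by (elim dvdE)
      then have "w \<in> norm_fiber n" using z by (simp add: norm_fiber_def w gnorm_mult gnorm_glam del: gauss_sel)
      then show "z \<in> (*) glam ` norm_fiber n" using w by blast
    next
      fix z assume "z \<in> (*) glam ` norm_fiber n"
      then obtain w where "z = glam * w" "gnorm w = int n" by (auto simp: norm_fiber_def)
      then show "z \<in> norm_fiber (2 * n)" unfolding norm_fiber_def
        by (simp add: gnorm_mult) (simp add: gnorm_def)
    qed
    moreover have "glam \<noteq> 0" by (simp add: gauss_eq_iff)
    ultimately have "card (norm_fiber (2 * n)) = card (norm_fiber n)"
      by (auto intro!: card_image simp: inj_on_def)
    then show ?thesis using 1 by (simp add: chi4_def)
  next
    case 2
    obtain q where "gnorm q = int p" using ex_norm_eq_prime[OF p 2(2)] by blast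
    moreover have "chi4 p = 1" using 2 by (simp add: chi4_def)
    ultimately show ?thesis using card_norm_fiber_split[OF p _ 2(1), of q n] by (auto split: if_splits)
  next
    case 3
    have no: "gnorm q \<noteq> int p" for q
    proof
      assume "gnorm q = int p"
      moreover have "int p mod 4 = 3" using 3 by presburger
      moreover have "x\<^sup>2 mod 4 = 0 \<or> x\<^sup>2 mod 4 = 1" for x :: int
      proof -
        have "x mod 4 = 0 \<or> x mod 4 = 1 \<or> x mod 4 = 2 \<or> x mod 4 = 3" by presburger
        moreover have "x\<^sup>2 mod 4 = (x mod 4)\<^sup>2 mod 4" by (simp add: power_mod)
        ultimately show ?thesis by auto
      qed
      then have "(gre q)\<^sup>2 mod 4 = 0 \<or> (gre q)\<^sup>2 mod 4 = 1" "(gim q)\<^sup>2 mod 4 = 0 \<or> (gim q)\<^sup>2 mod 4 = 1" by blast+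
      then have "gnorm q mod 4 \<noteq> 3" unfolding gnorm_def by presburger
      ultimately show False by metis
    qed
    have div: "\<exists>w. z = of_nat p * w \<and> gnorm w * int p = int n" if "z \<in> norm_fiber (p * n)" for z
    proof -
      have "of_nat p dvd z"
        using prime_dvd_or_norm_eq[OF p, of z] that no by (auto simp: norm_fiber_def)
      then obtain w where w: "z = of_nat p * w" by (elim dvdE)
      then have "int p * (gnorm w * int p) = int p * int n" using that
        by (simp add: gnorm_mult norm_fiber_def gnorm_of_nat mult_ac)
      then have "gnorm w * int p = int n" using p0 by simp
      then show ?thesis using w by blast
    qed
    have "int (card (norm_fiber (p * n))) = (if p dvd n then int (card (norm_fiber (n div p))) else 0)"
    proof (cases "p dvd n")
      case True
      then obtain m where m: "n = p * m" by (elim dvdE)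
      have "norm_fiber (p * n) = (*) (of_nat p) ` norm_fiber m"
      proof (intro equalityI subsetI)
        fix z assume "z \<in> norm_fiber (p * n)"
        then show "z \<in> (*) (of_nat p) ` norm_fiber m" using div p0 by (force simp: m norm_fiber_def)
      next
        fix z assume "z \<in> (*) (of_nat p) ` norm_fiber m"
        then show "z \<in> norm_fiber (p * n)"
          by (auto simp: m norm_fiber_def gnorm_mult) (simp add: gnorm_def power2_eq_square)
      qed
      moreover have "(of_nat p :: gauss) \<noteq> 0" using p0 by (simp add: gauss_eq_iff)
      ultimately have "card (norm_fiber (p * n)) = card (norm_fiber m)"
        by (auto intro!: card_image simp: inj_on_def)
      then show ?thesis using True m p0 by simp
    next
      case False
      then have "norm_fiber (p * n) = {}" using div by (metis dvd_triv_right equals0I int_dvd_int_iff)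
      then show ?thesis using False by simp
    qed
    then show ?thesis using 3 by (auto simp: chi4_def)
  qed
qed

text \<open>
  Jacobi's two-square theorem. Both sides satisfy the same recursion at every prime
  divisor of the argument, and they agree at 1.
\<close>

lemma card_norm_fiber:
  assumes "n > 0" shows "int (card (norm_fiber n)) = 4 * chi_sum n"
  using assms
proof (induction n rule: less_induct)
  case (less n)
  show ?case
  proof (cases "n = 1")
    case True
    then show ?thesis using card_units_gauss by (simp add: norm_fiber_def chi_sum_def chi4_def)
  next
    case False
    then obtain p where p: "prime p" "p dvd n" using prime_factor_nat by blast
    then obtain m where m: "n = p * m" by (elim dvdE)
    have p1: "p > 1" using prime_gt_1_nat p by blast
    have m0: "m > 0" using m less.prems by (cases m) auto
    have "m < n" using m m0 p1 by simp
    moreover have "m div p < n" using \<open>m < n\<close> div_le_dividend le_less_trans by blast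
    moreover have "p dvd m \<Longrightarrow> m div p > 0" using m0 by (metis dvd_div_eq_0_iff neq0_conv)
    ultimately show ?thesis
      using card_norm_fiber_hecke[OF p(1) m0] chi_sum_hecke[OF p(1) m0] less.IH[of m] less.IH[of "m div p"] m0
      by (auto simp: m algebra_simps split: if_splits)
  qed
qed

section \<open>Sums over the Gaussian lattice\<close>

text \<open>
  The product of two absolutely convergent series, with the terms grouped by the product
  of their indices.
\<close>

lemma dirichlet_convolution_has_sum:
  fixes a b :: "nat \<Rightarrow> real"
  assumes a: "(a has_sum A) {1..}" and b: "(b has_sum B) {1..}"
  shows "((\<lambda>n. \<Sum>d | d dvd n. a (n div d) * b d) has_sum A * B) {1..}"
proof -
  have sa: "(\<lambda>n. \<bar>a n\<bar>) summable_on {1..}" and sb: "(\<lambda>n. \<bar>b n\<bar>) summable_on {1..}"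
    using has_sum_imp_summable[OF a] has_sum_imp_summable[OF b]
    by (simp_all only: real_norm_def[symmetric] summable_on_iff_abs_summable_on_real[symmetric])
  have "(\<lambda>(m, d). \<bar>a m * b d\<bar>) summable_on ({1..} \<times> {1..})"
  proof (rule summable_on_SigmaI)
    show "((\<lambda>d. case (m, d) of (m, d) \<Rightarrow> \<bar>a m * b d\<bar>) has_sum \<bar>a m\<bar> * (\<Sum>\<^sub>\<infinity>d\<in>{1..}. \<bar>b d\<bar>)) {1..}" for m
      using has_sum_cmult_right[OF has_sum_infsum[OF sb]] by (simp add: abs_mult)
    show "(\<lambda>m. \<bar>a m\<bar> * (\<Sum>\<^sub>\<infinity>d\<in>{1..}. \<bar>b d\<bar>)) summable_on {1..}"
      using summable_on_cmult_left[OF sa] by simp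
  qed auto
  then have "(\<lambda>(m, d). a m * b d) summable_on ({1..} \<times> {1..})"
    unfolding summable_on_iff_abs_summable_on_real[of "\<lambda>(m, d). a m * b d"]
    by (simp only: case_prod_unfold real_norm_def)
  then have "((\<lambda>(m, d). a m * b d) has_sum A * B) ({1..} \<times> {1..})"
    by (intro has_sum_SigmaI[where g = "\<lambda>m. a m * B"])
       (simp_all only: prod.case has_sum_cmult_left[OF a] has_sum_cmult_right[OF b])
  also have "?this \<longleftrightarrow> ((\<lambda>x. (\<lambda>(n, d). a (n div d) * b d) ((\<lambda>(m, d). (m * d, d)) x)) has_sum A * B)
      ({1..} \<times> {1..})"
    by (intro has_sum_cong) auto
  also have "\<dots> \<longleftrightarrow> ((\<lambda>(n, d). a (n div d) * b d) has_sum A * B) (Sigma {1..} (\<lambda>n. {d. d dvd n}))"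
  proof (rule has_sum_reindex_bij_betw, unfold bij_betw_def, intro conjI equalityI subsetI)
    show "inj_on (\<lambda>(m, d). (m * d, d)) ({1..} \<times> {1 :: nat..})"
      by (auto simp: inj_on_def)
    fix x :: "nat \<times> nat" assume "x \<in> Sigma {1..} (\<lambda>n. {d. d dvd n})"
    then obtain n d e where "x = (n, d)" "n = d * e" "n \<ge> 1" by (auto simp: dvd_def)
    then have "x = (\<lambda>(m, d). (m * d, d)) (e, d)" "(e, d) \<in> {1..} \<times> {1..}"
      by (auto simp: mult.commute Suc_le_eq)
    then show "x \<in> (\<lambda>(m, d). (m * d, d)) ` ({1..} \<times> {1..})" by (rule image_eqI)
  next
    fix x :: "nat \<times> nat" assume "x \<in> (\<lambda>(m, d). (m * d, d)) ` ({1..} \<times> {1..})"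
    then show "x \<in> Sigma {1..} (\<lambda>n. {d. d dvd n})" by (auto simp: Suc_le_eq)
  qed
  finally show ?thesis
    by (rule has_sum_SigmaD) (auto intro!: has_sum_finiteI)
qed

lemma inverse_squares_has_sum: "((\<lambda>n. 1 / (real n)\<^sup>2) has_sum (pi\<^sup>2 / 6)) {1..}"
proof -
  have "((\<lambda>n. 1 / (real (Suc n))\<^sup>2) has_sum (pi\<^sup>2 / 6)) UNIV"
    using inverse_squares_sums by (intro sums_nonneg_imp_has_sum) (auto simp: add.commute)
  moreover have "bij_betw Suc UNIV {1..}"
    by (rule bij_betwI[where g = "\<lambda>n. n - 1"]) auto
  ultimately show ?thesis
    using has_sum_reindex_bij_betw[of Suc UNIV "{1..}" "\<lambda>n. 1 / (real n)\<^sup>2"] by simp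
qed

lemma chi4_odd: "chi4 (2 * k + 1) = (-1) ^ k"
proof (cases "even k")
  case True
  then have "(2 * k + 1) mod 4 = 1" by presburger
  then show ?thesis using True by (simp add: chi4_def)
next
  case False
  then have "(2 * k + 1) mod 4 = 3" by presburger
  then show ?thesis using False by (simp add: chi4_def)
qed

text \<open>
  Catalan's constant as the sum over all positive integers that the convolution requires.
\<close>

lemma catalan_has_sum: "((\<lambda>n. of_int (chi4 n) / (real n)\<^sup>2) has_sum catalan) {1..}"
proof -
  have sq: "summable (\<lambda>k. 1 / (2 * real k + 1)\<^sup>2)"
  proof (rule summable_comparison_test_ev[OF _ sums_summable[OF inverse_squares_sums]])
    show "\<forall>\<^sub>F k in sequentially. norm (1 / (2 * real k + 1)\<^sup>2) \<le> 1 / real ((k + 1)\<^sup>2)"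
    proof (intro always_eventually allI)
      fix k
      have "(real k + 1)\<^sup>2 \<le> (2 * real k + 1)\<^sup>2" by (intro power_mono) auto
      then show "norm (1 / (2 * real k + 1)\<^sup>2) \<le> 1 / real ((k + 1)\<^sup>2)"
        by (auto intro!: divide_left_mono simp: add.commute)
    qed
  qed
  then have ns: "summable (\<lambda>k. norm ((-1) ^ k / (2 * real k + 1)\<^sup>2 :: real))"
    by (simp add: norm_divide norm_power)
  have "((\<lambda>k. (-1) ^ k / (2 * real k + 1)\<^sup>2) has_sum catalan) UNIV"
    unfolding catalan_def
    by (rule norm_summable_imp_has_sum[OF ns summable_sums[OF summable_norm_cancel[OF ns]]])
  moreover have "bij_betw (\<lambda>k. 2 * k + 1) (UNIV :: nat set) {n. odd n}"
    by (rule bij_betwI[where g = "\<lambda>n. n div 2"]) auto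
  ultimately have "((\<lambda>n. of_int (chi4 n) / (real n)\<^sup>2) has_sum catalan) {n. odd n}"
    using has_sum_reindex_bij_betw[of "\<lambda>k. 2 * k + 1" UNIV "{n. odd n}" "\<lambda>n. of_int (chi4 n) / (real n)\<^sup>2" catalan]
    by (simp only: chi4_odd of_int_power of_int_minus of_int_1 of_nat_add of_nat_mult of_nat_numeral of_nat_1)
  also have "?this \<longleftrightarrow> ?thesis"
    by (rule has_sum_cong_neutral) (auto simp: chi4_def intro: Suc_leI odd_pos)
  finally show ?thesis .
qed

text \<open>
  Passage between sums over lattice points and sums over the values of the norm.
\<close>

lemma gauss_norm_has_sum:
  fixes f :: "nat \<Rightarrow> real"
  assumes nn: "\<And>n. f n \<ge> 0"
    and s: "((\<lambda>n. real (card (norm_fiber n)) * f n) has_sum S) {1..}"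
  shows "((\<lambda>z. f (nat (gnorm z))) has_sum S) (- {0})"
proof -
  let ?g = "\<lambda>(n, z). f n"
  have inner: "((\<lambda>z. ?g (n, z)) has_sum (real (card (norm_fiber n)) * f n)) (norm_fiber n)" for n
    by (auto intro!: has_sum_finiteI)
  have "?g summable_on Sigma {1..} norm_fiber"
    by (rule summable_on_SigmaI[OF inner]) (use s nn in \<open>auto simp: has_sum_imp_summable\<close>)
  then have "(?g has_sum S) (Sigma {1..} norm_fiber)"
    by (intro has_sum_SigmaI[OF inner s])
  moreover have "bij_betw (\<lambda>z. (nat (gnorm z), z)) (- {0}) (Sigma {1..} norm_fiber)"
    by (rule bij_betwI[where g = snd]) (auto simp: norm_fiber_def Suc_le_eq)
  ultimately show ?thesis
    using has_sum_reindex_bij_betw[of "\<lambda>z. (nat (gnorm z), z)" "- {0}" "Sigma {1..} norm_fiber" ?g S]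
    by simp
qed

text \<open>
  By Jacobi's theorem the Dirichlet series of the norm is four times the convolution of
  the constant function 1 and \<open>chi4\<close>, hence \<open>4 \<zeta>(s) L(s, \<chi>)\<close>; here \<open>s = 2\<close>.
\<close>

lemma zeta_lattice_has_sum:
  "((\<lambda>z. 1 / (real_of_int (gnorm z))\<^sup>2) has_sum (2 * pi\<^sup>2 / 3 * catalan)) (- {0})"
proof -
  have "((\<lambda>n. \<Sum>d | d dvd n. 1 / (real (n div d))\<^sup>2 * (of_int (chi4 d) / (real d)\<^sup>2))
          has_sum (pi\<^sup>2 / 6) * catalan) {1..}"
    by (rule dirichlet_convolution_has_sum[OF inverse_squares_has_sum catalan_has_sum])
  also have "?this \<longleftrightarrow> ((\<lambda>n. of_int (chi_sum n) / (real n)\<^sup>2) has_sum (pi\<^sup>2 / 6) * catalan) {1..}"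
  proof (rule has_sum_cong)
    fix n :: nat assume "n \<in> {1..}"
    have "1 / (real (n div d))\<^sup>2 * (of_int (chi4 d) / (real d)\<^sup>2) = of_int (chi4 d) / (real n)\<^sup>2"
      if dn: "d dvd n" for d
    proof -
      obtain e where e: "n = d * e" using dn by (elim dvdE)
      then show ?thesis using \<open>n \<in> {1..}\<close> by (cases "d = 0") (auto simp: power_mult_distrib)
    qed
    then show "(\<Sum>d | d dvd n. 1 / (real (n div d))\<^sup>2 * (of_int (chi4 d) / (real d)\<^sup>2))
        = of_int (chi_sum n) / (real n)\<^sup>2"
      unfolding chi_sum_def of_int_sum sum_divide_distrib by (intro sum.cong) auto
  qed
  finally have "((\<lambda>n. 4 * (of_int (chi_sum n) / (real n)\<^sup>2)) has_sum 4 * ((pi\<^sup>2 / 6) * catalan)) {1..}"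
    by (rule has_sum_cmult_right)
  also have "?this \<longleftrightarrow> ((\<lambda>n. real (card (norm_fiber n)) * (1 / (real n)\<^sup>2)) has_sum 4 * ((pi\<^sup>2 / 6) * catalan)) {1..}"
  proof (rule has_sum_cong)
    fix n :: nat assume "n \<in> {1..}"
    then have "int (card (norm_fiber n)) = 4 * chi_sum n" by (intro card_norm_fiber) auto
    then have "real (card (norm_fiber n)) = 4 * of_int (chi_sum n)" by linarith
    then show "4 * (of_int (chi_sum n) / (real n)\<^sup>2) = real (card (norm_fiber n)) * (1 / (real n)\<^sup>2)" by simp
  qed
  finally have "((\<lambda>z. 1 / (real (nat (gnorm z)))\<^sup>2) has_sum 4 * ((pi\<^sup>2 / 6) * catalan)) (- {0})"
    by (intro gauss_norm_has_sum) auto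
  moreover have "4 * ((pi\<^sup>2 / 6) * catalan) = 2 * pi\<^sup>2 / 3 * catalan" by simp
  ultimately show ?thesis by (simp only: of_nat_nat gnorm_ge_0)
qed

text \<open>
  The number of representations of \<open>n\<close> is at most four times its number of divisors,
  whose Dirichlet series is the square of the zeta function. The exponent \<open>3/2\<close> leaves
  room for a logarithm in the series with exponent 2.
\<close>

lemma lattice_summable_three_halves:
  "(\<lambda>z. real_of_int (gnorm z) powr (-3/2)) summable_on (- {0})"
proof -
  have "summable (\<lambda>n. real n powr (-3/2))" by (simp add: summable_real_powr_iff)
  then have "(\<lambda>n. real n powr (-3/2)) summable_on {1..}"
    by (intro summable_on_subset_banach[OF norm_summable_imp_summable_on]) auto
  then obtain A where A: "((\<lambda>n. real n powr (-3/2)) has_sum A) {1..}"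
    by (auto simp: summable_on_def)
  have eq: "(\<Sum>d | d dvd n. real (n div d) powr (-3/2) * real d powr (-3/2))
      = real (card {d. d dvd n}) * real n powr (-3/2)" for n
    by (simp add: powr_mult[symmetric] flip: of_nat_mult)
  have s: "(\<lambda>n. 4 * (real (card {d. d dvd n}) * real n powr (-3/2))) summable_on {1..}"
    using dirichlet_convolution_has_sum[OF A A] unfolding eq
    by (auto intro!: summable_on_cmult_right dest: has_sum_imp_summable)
  have "(\<lambda>n. real (card (norm_fiber n)) * real n powr (-3/2)) summable_on {1..}"
  proof (rule summable_on_comparison_test[OF s])
    fix n :: nat assume "n \<in> {1..}"
    then have "int (card (norm_fiber n)) = 4 * chi_sum n" by (intro card_norm_fiber) auto
    moreover have "chi_sum n \<le> (\<Sum>d | d dvd n. 1)" unfolding chi_sum_def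
      by (rule sum_mono) (simp add: chi4_def)
    ultimately have "real (card (norm_fiber n)) \<le> 4 * real (card {d. d dvd n})" by simp
    then show "real (card (norm_fiber n)) * real n powr (-3/2)
        \<le> 4 * (real (card {d. d dvd n}) * real n powr (-3/2))"
      by (metis mult.assoc mult_right_mono powr_ge_zero)
  qed auto
  then have "(\<lambda>z. real (nat (gnorm z)) powr (-3/2)) summable_on (- {0})"
    using gauss_norm_has_sum[of "\<lambda>n. real n powr (-3/2)"] by (auto simp: summable_on_def)
  then show ?thesis by simp
qed

text \<open>
  The error of a partial sum of Leibniz's alternating series is at most the first omitted
  term.
\<close>

lemma chi_partial_sum:
  "\<bar>(\<Sum>d = 1..n. of_int (chi4 d) / real d) - pi / 4\<bar> \<le> 1 / (real n + 1)"
proof -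
  define a where "a = (\<lambda>k::nat. 1 / real (2 * k + 1))"
  have lim: "a \<longlonglongrightarrow> 0" unfolding a_def by real_asymp
  have mono: "a (Suc k) \<le> a k" and pos: "0 \<le> a k" for k by (auto simp: a_def frac_le)
  note L = summable_Leibniz'[OF lim pos mono]
  have pi4: "(\<Sum>k. (-1) ^ k * a k) = pi / 4" unfolding a_def pi_series by (simp add: mult.commute)
  have part: "\<bar>(\<Sum>i<K. (-1) ^ i * a i) - pi / 4\<bar> \<le> a K" for K
  proof (cases "even K")
    case True
    then obtain j where j: "K = 2 * j" by (elim evenE)
    show ?thesis using L(2)[of j] L(4)[of j] unfolding pi4 j by simp
  next
    case False
    then obtain j where j: "K = 2 * j + 1" by (elim oddE)
    show ?thesis using L(2)[of "Suc j"] L(4)[of j] unfolding pi4 j by (simp del: of_nat_Suc)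
  qed
  define K where "K = (n + 1) div 2"
  have "(\<Sum>d = 1..n. of_int (chi4 d) / real d) = (\<Sum>d \<in> (\<lambda>k. 2 * k + 1) ` {..<K}. of_int (chi4 d) / real d)"
  proof (rule sum.mono_neutral_right)
    show "(\<lambda>k. 2 * k + 1) ` {..<K} \<subseteq> {1..n}" unfolding K_def by auto
    show "\<forall>d\<in>{1..n} - (\<lambda>k. 2 * k + 1) ` {..<K}. of_int (chi4 d) / real d = 0"
    proof
      fix d assume d: "d \<in> {1..n} - (\<lambda>k. 2 * k + 1) ` {..<K}"
      have "even d"
      proof (rule ccontr)
        assume "odd d"
        then obtain k where "d = 2 * k + 1" by (elim oddE)
        moreover from this have "k < K" using d unfolding K_def by auto
        ultimately show False using d by auto
      qed
      then show "of_int (chi4 d) / real d = 0" by (simp add: chi4_def)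
    qed
  qed auto
  also have "\<dots> = (\<Sum>k<K. (-1) ^ k * a k)"
    by (subst sum.reindex) (auto simp: inj_on_def a_def chi4_odd[simplified])
  finally have "\<bar>(\<Sum>d = 1..n. of_int (chi4 d) / real d) - pi / 4\<bar> \<le> a K" using part by simp
  also have "a K \<le> 1 / (real n + 1)"
  proof -
    (* K counts the odd numbers up to n, so the first omitted term is at most 1 / (n + 1). *)
    have "n + 1 \<le> 2 * K + 1" unfolding K_def by presburger
    then have "real n + 1 \<le> real (2 * K + 1)" by linarith
    then show ?thesis unfolding a_def by (intro divide_left_mono) auto
  qed
  finally show ?thesis .
qed

lemma harm_bounds: "n > 0 \<Longrightarrow> \<bar>harm n - ln (real n)\<bar> \<le> (1::real)"
proof -
  assume n: "n > 0"
  have "ln (real n) \<le> harm n" using harm_ge_ln[of n] n by (smt (verit) ln_le_cancel_iff of_nat_0_less_iff)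
  moreover have "harm n - ln (real n) \<le> (1::real)"
  proof -
    have "harm (Suc (n - 1)) - ln (real (Suc (n - 1))) \<le> harm (Suc 0) - ln (real (Suc 0))"
      using decseq_harm_diff_ln by (rule decseqD) simp
    then show ?thesis using n by (simp add: harm_def)
  qed
  ultimately show ?thesis by linarith
qed

text \<open>
  Writing \<open>n = m * d\<close>, the sum becomes the sum over \<open>m\<close> of \<open>1 / m\<close> times a partial sum of
  Leibniz's series up to \<open>Y div m\<close>. Replacing each of these by \<open>pi / 4\<close> costs at most
  \<open>1 / Y\<close> per term.
\<close>

lemma chi_sum_log_average:
  assumes "Y > 0"
  shows "\<bar>(\<Sum>n = 1..Y. of_int (chi_sum n) / real n) - pi / 4 * ln (real Y)\<bar> \<le> 2"
proof -
  define c where "c = (\<lambda>d. of_int (chi4 d) / real d :: real)"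
  have "(\<Sum>n = 1..Y. of_int (chi_sum n) / real n) = (\<Sum>n = 1..Y. \<Sum>d | d dvd n. 1 / real (n div d) * c d)"
    by (intro sum.cong refl) (auto simp: chi_sum_def sum_divide_distrib c_def elim!: dvdE intro!: sum.cong)
  also have "\<dots> = (\<Sum>(n, d) \<in> Sigma {1..Y} (\<lambda>n. {d. d dvd n}). 1 / real (n div d) * c d)"
    by (rule sum.Sigma) auto
  also have "\<dots> = (\<Sum>(m, d) \<in> Sigma {1..Y} (\<lambda>m. {1..Y div m}). 1 / real m * c d)"
  proof -
    have img: "Sigma {1..Y} (\<lambda>n. {d. d dvd n}) = (\<lambda>(m, d). (m * d, d)) ` Sigma {1..Y} (\<lambda>m. {1..Y div m})"
    proof (intro equalityI subsetI)
      fix x assume "x \<in> Sigma {1..Y} (\<lambda>n. {d. d dvd n})"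
      then obtain d e where x: "x = (d * e, d)" "1 \<le> d * e" "d * e \<le> Y" by (auto simp: dvd_def)
      then have "d > 0" "e > 0" by (auto simp: Suc_le_eq)
      moreover have "e \<le> d * e" using \<open>d > 0\<close> by simp
      then have "e \<le> Y" using x by linarith
      ultimately have "(e, d) \<in> Sigma {1..Y} (\<lambda>m. {1..Y div m})"
        using x by (auto simp: Suc_le_eq less_eq_div_iff_mult_less_eq)
      moreover have "x = (\<lambda>(m, d). (m * d, d)) (e, d)" using x by (simp add: mult.commute)
      ultimately show "x \<in> (\<lambda>(m, d). (m * d, d)) ` Sigma {1..Y} (\<lambda>m. {1..Y div m})"
        by (rule rev_image_eqI)
    next
      fix x assume "x \<in> (\<lambda>(m, d). (m * d, d)) ` Sigma {1..Y} (\<lambda>m. {1..Y div m})"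
      then obtain m d where "x = (m * d, d)" "1 \<le> m" "1 \<le> d" "d \<le> Y div m" by auto
      then show "x \<in> Sigma {1..Y} (\<lambda>n. {d. d dvd n})"
        by (simp add: Suc_le_eq less_eq_div_iff_mult_less_eq mult.commute)
    qed
    have inj: "inj_on (\<lambda>(m, d). (m * d, d)) (Sigma {1..Y} (\<lambda>m. {1..Y div m}))"
      by (auto simp: inj_on_def)
    show ?thesis unfolding img by (subst sum.reindex[OF inj]) (auto intro!: sum.cong)
  qed
  also have "\<dots> = (\<Sum>m = 1..Y. \<Sum>d = 1..Y div m. 1 / real m * c d)"
    by (rule sum.Sigma[symmetric]) auto
  also have "\<dots> = (\<Sum>m = 1..Y. 1 / real m * (\<Sum>d = 1..Y div m. c d))"
    by (simp add: sum_distrib_left)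
  finally have eq: "(\<Sum>n = 1..Y. of_int (chi_sum n) / real n) = (\<Sum>m = 1..Y. 1 / real m * (\<Sum>d = 1..Y div m. c d))" .
  have "\<bar>(\<Sum>m = 1..Y. 1 / real m * (\<Sum>d = 1..Y div m. c d)) - pi / 4 * harm Y\<bar>
      = \<bar>\<Sum>m = 1..Y. 1 / real m * ((\<Sum>d = 1..Y div m. c d) - pi / 4)\<bar>"
    by (simp add: harm_def sum_distrib_left right_diff_distrib sum_subtractf inverse_eq_divide mult.commute)
  also have "\<dots> \<le> (\<Sum>m = 1..Y. 1 / real Y)"
  proof (rule order_trans[OF sum_abs sum_mono])
    fix m assume m: "m \<in> {1..Y}"
    have "Y < m * (Y div m) + m" using m dividend_less_times_div[of m Y] by simp
    then have "real Y \<le> real m * (real (Y div m) + 1)"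
      by (metis distrib_left less_imp_le mult.right_neutral of_nat_add of_nat_le_iff of_nat_mult)
    then have "1 / real m * (1 / (real (Y div m) + 1)) \<le> 1 / real Y"
      using m assms by (simp add: field_simps)
    moreover have "\<bar>(\<Sum>d = 1..Y div m. c d) - pi / 4\<bar> \<le> 1 / (real (Y div m) + 1)"
      unfolding c_def by (rule chi_partial_sum)
    then have "1 / real m * \<bar>(\<Sum>d = 1..Y div m. c d) - pi / 4\<bar> \<le> 1 / real m * (1 / (real (Y div m) + 1))"
      by (intro mult_left_mono) auto
    ultimately show "\<bar>1 / real m * ((\<Sum>d = 1..Y div m. c d) - pi / 4)\<bar> \<le> 1 / real Y"
      by (simp add: abs_mult)
  qed
  also have "\<dots> = 1" using assms by simp
  finally have "\<bar>(\<Sum>n = 1..Y. of_int (chi_sum n) / real n) - pi / 4 * harm Y\<bar> \<le> 1" unfolding eq .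
  moreover have "\<bar>pi / 4 * harm Y - pi / 4 * ln (real Y)\<bar> \<le> 1 * 1"
    unfolding right_diff_distrib[symmetric] abs_mult
    using harm_bounds[OF assms] pi_less_4 by (intro mult_mono) auto
  ultimately show ?thesis by linarith
qed

lemma sum_norm_fibers:
  fixes f :: "nat \<Rightarrow> real"
  shows "(\<Sum>z | z \<noteq> 0 \<and> gnorm z \<le> int Y. f (nat (gnorm z))) = (\<Sum>n = 1..Y. real (card (norm_fiber n)) * f n)"
proof -
  have "{z. z \<noteq> 0 \<and> gnorm z \<le> int Y} = (\<Union>n\<in>{1..Y}. norm_fiber n)"
  proof (intro equalityI subsetI)
    fix z assume "z \<in> {z. z \<noteq> 0 \<and> gnorm z \<le> int Y}"
    then have "nat (gnorm z) \<in> {1..Y}" "z \<in> norm_fiber (nat (gnorm z))"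
      by (auto simp: norm_fiber_def Suc_le_eq)
    then show "z \<in> (\<Union>n\<in>{1..Y}. norm_fiber n)" by blast
  next
    fix z assume "z \<in> (\<Union>n\<in>{1..Y}. norm_fiber n)"
    then obtain n where "1 \<le> n" "n \<le> Y" "gnorm z = int n" by (auto simp: norm_fiber_def)
    then show "z \<in> {z. z \<noteq> 0 \<and> gnorm z \<le> int Y}" by auto
  qed
  then have "(\<Sum>z | z \<noteq> 0 \<and> gnorm z \<le> int Y. f (nat (gnorm z)))
      = (\<Sum>z \<in> (\<Union>n\<in>{1..Y}. norm_fiber n). f (nat (gnorm z)))" by (simp only:)
  also have "\<dots> = (\<Sum>n = 1..Y. \<Sum>z\<in>norm_fiber n. f (nat (gnorm z)))"
    by (rule sum.UNION_disjoint) (auto simp: norm_fiber_def finite_gnorm_eq)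
  also have "\<dots> = (\<Sum>n = 1..Y. real (card (norm_fiber n)) * f n)"
    by (intro sum.cong refl) (simp add: norm_fiber_def)
  finally show ?thesis .
qed

text \<open>
  The centre is left out, since the norm occurs in denominators.
\<close>

definition gball :: "real \<Rightarrow> gauss set"
  where "gball x = {z. z \<noteq> 0 \<and> real_of_int (gnorm z) \<le> x}"

lemma finite_gball [simp]: "finite (gball x)"
  unfolding gball_def by (rule finite_subset[OF _ finite_gnorm_le_real[of x]]) auto

lemma gball_empty: "x < 1 \<Longrightarrow> gball x = {}"
proof -
  assume x: "x < 1"
  have "\<not> real_of_int (gnorm z) \<le> x" if "z \<noteq> 0" for z
  proof -
    have "gnorm z \<ge> 1" using that by (simp add: gnorm_ge_1_iff)
    then have "real_of_int (gnorm z) \<ge> 1" by linarith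
    then show ?thesis using x by linarith
  qed
  then show "gball x = {}" unfolding gball_def by blast
qed

text \<open>
  Jacobi's formula turns the sum into four times an average of \<open>chi_sum\<close>.
\<close>

lemma gauss_log_average:
  assumes "x \<ge> 1"
  shows "\<bar>(\<Sum>z\<in>gball x. 1 / real_of_int (gnorm z)) - pi * ln x\<bar> \<le> 12"
proof -
  define Y where "Y = nat \<lfloor>x\<rfloor>"
  have Y: "Y > 0" "real Y \<le> x" "x < real Y + 1" using assms unfolding Y_def by linarith+
  have "gball x = {z. z \<noteq> 0 \<and> gnorm z \<le> int Y}"
    using assms by (auto simp: gball_def Y_def le_floor_iff)
  then have "(\<Sum>z\<in>gball x. 1 / real_of_int (gnorm z)) = (\<Sum>n = 1..Y. real (card (norm_fiber n)) * (1 / real n))"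
    using sum_norm_fibers[of "\<lambda>n. 1 / real n" Y] by simp
  also have "\<dots> = (\<Sum>n = 1..Y. 4 * (of_int (chi_sum n) / real n))"
  proof (rule sum.cong[OF refl])
    fix n assume "n \<in> {1..Y}"
    then have "int (card (norm_fiber n)) = 4 * chi_sum n" by (intro card_norm_fiber) auto
    then have "real (card (norm_fiber n)) = 4 * of_int (chi_sum n)" by linarith
    then show "real (card (norm_fiber n)) * (1 / real n) = 4 * (of_int (chi_sum n) / real n)" by simp
  qed
  finally have e: "(\<Sum>z\<in>gball x. 1 / real_of_int (gnorm z)) = 4 * (\<Sum>n = 1..Y. of_int (chi_sum n) / real n)"
    by (simp add: sum_distrib_left)
  have "ln x - ln (real Y) \<le> 1" "ln (real Y) \<le> ln x"
  proof -
    have "ln x - ln (real Y) = ln (x / real Y)" using Y by (simp add: ln_div)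
    also have "\<dots> \<le> x / real Y - 1" using Y by (intro ln_le_minus_one) auto
    also have "x / real Y \<le> 2" using Y by (simp add: field_simps)
    finally show "ln x - ln (real Y) \<le> 1" by simp
    show "ln (real Y) \<le> ln x" using Y by simp
  qed
  then have "\<bar>pi * (ln x - ln (real Y))\<bar> \<le> 4 * 1" unfolding abs_mult
    using pi_less_4 by (intro mult_mono) auto
  then show ?thesis using chi_sum_log_average[OF Y(1)] unfolding e
    by (simp add: algebra_simps abs_le_iff)
qed

section \<open>Lattice points in discs and residue classes\<close>

text \<open>
  Lattice points in a disc with arbitrary centre: residue classes become such discs after
  rescaling.
\<close>

definition disc_points :: "complex \<Rightarrow> real \<Rightarrow> gauss set"
  where "disc_points u R = {w. cmod (cpx w - u) \<le> R}"

lemma finite_disc_points [simp]: "finite (disc_points u R)"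
proof (rule finite_subset)
  show "disc_points u R \<subseteq> {z. real_of_int (gnorm z) \<le> (R + cmod u)\<^sup>2}"
  proof
    fix z assume "z \<in> disc_points u R"
    then have "cmod (cpx z) \<le> R + cmod u"
      using norm_triangle_sub[of "cpx z" u] by (simp add: disc_points_def add.commute)
    then have "(cmod (cpx z))\<^sup>2 \<le> (R + cmod u)\<^sup>2" by (intro power_mono) auto
    then show "z \<in> {z. real_of_int (gnorm z) \<le> (R + cmod u)\<^sup>2}" by (simp add: norm_cpx_sq)
  qed
qed (rule finite_gnorm_le_real)

lemma measure_unit_square:
  "measure lborel (box z (z + Complex 1 1)) = 1" "measure lborel (cbox z (z + Complex 1 1)) = 1"
proof -
  have "z \<bullet> b \<le> (z + Complex 1 1) \<bullet> b" if "b \<in> Basis" for b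
    using that by (auto simp: Basis_complex_def inner_complex_def)
  moreover have "(\<Prod>b\<in>Basis. (z + Complex 1 1 - z) \<bullet> b) = 1"
    by (simp add: Basis_complex_def inner_complex_def)
  ultimately show "measure lborel (box z (z + Complex 1 1)) = 1" "measure lborel (cbox z (z + Complex 1 1)) = 1"
    by (simp_all add: measure_lborel_box measure_lborel_cbox)
qed

lemma in_unit_square_dist:
  assumes "Re w \<le> Re z" "Re z \<le> Re w + 1" "Im w \<le> Im z" "Im z \<le> Im w + 1"
  shows "cmod (z - w) \<le> 2"
  using cmod_le[of "z - w"] assms by auto

text \<open>
  The open unit squares with lower left corners at the counted points are disjoint, and
  they lie in a disc of radius \<open>R + 2\<close>.
\<close>

lemma card_disc_points_upper:
  assumes "R \<ge> 0" shows "real (card (disc_points u R)) \<le> pi * (R + 2)\<^sup>2"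
proof -
  let ?S = "disc_points u R"
  let ?Q = "\<lambda>w. box (cpx w) (cpx w + Complex 1 1)"
  have disj: "disjoint_family_on ?Q ?S"
  proof (unfold disjoint_family_on_def, intro ballI impI, rule ccontr)
    fix v w assume "v \<noteq> w" "?Q v \<inter> ?Q w \<noteq> {}"
    then obtain z where "z \<in> ?Q v" "z \<in> ?Q w" by blast
    then have "real_of_int (gre v) < Re z" "Re z < real_of_int (gre v) + 1"
      "real_of_int (gre w) < Re z" "Re z < real_of_int (gre w) + 1"
      "real_of_int (gim v) < Im z" "Im z < real_of_int (gim v) + 1"
      "real_of_int (gim w) < Im z" "Im z < real_of_int (gim w) + 1"
      by (auto simp: in_box_complex_iff cpx_def)
    then have "gre v = gre w" "gim v = gim w" by linarith+
    then show False using \<open>v \<noteq> w\<close> by (simp add: gauss_eq_iff)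
  qed
  have "real (card ?S) = (\<Sum>w\<in>?S. measure lborel (?Q w))" by (simp add: measure_unit_square)
  also have "\<dots> = measure lborel (\<Union>w\<in>?S. ?Q w)"
    by (rule measure_finite_Union[symmetric]) (use disj in \<open>auto simp: emeasure_lborel_box_eq\<close>)
  also have "\<dots> \<le> measure lborel (cball u (R + 2))"
  proof (rule measure_mono_fmeasurable)
    show "(\<Union>w\<in>?S. ?Q w) \<subseteq> cball u (R + 2)"
    proof
      fix z assume "z \<in> (\<Union>w\<in>?S. ?Q w)"
      then obtain w where w: "cmod (cpx w - u) \<le> R" "z \<in> ?Q w" by (auto simp: disc_points_def)
      then have "cmod (z - cpx w) \<le> 2"
        by (intro in_unit_square_dist) (auto simp: in_box_complex_iff)
      then have "cmod (z - u) \<le> R + 2" using w(1) norm_triangle_ineq[of "z - cpx w" "cpx w - u"] by simp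
      then show "z \<in> cball u (R + 2)" by (simp add: dist_norm norm_minus_commute)
    qed
    show "(\<Union>w\<in>?S. ?Q w) \<in> sets lborel" by (intro sets.finite_UN) auto
    show "cball u (R + 2) \<in> fmeasurable lborel"
      using emeasure_bounded_finite[OF bounded_cball, of u "R + 2"]
      by (intro fmeasurableI) (auto simp: top.not_eq_extremum)
  qed
  also have "\<dots> = pi * (R + 2)\<^sup>2" using assms by (simp add: content_cball unit_ball_vol_2)
  finally show ?thesis .
qed

text \<open>
  The closed unit squares at the counted points cover a disc of radius \<open>R - 2\<close>.
\<close>

lemma card_disc_points_lower:
  assumes "R \<ge> 2" shows "pi * (R - 2)\<^sup>2 \<le> real (card (disc_points u R))"
proof -
  let ?S = "disc_points u R"
  let ?Q = "\<lambda>w. cbox (cpx w) (cpx w + Complex 1 1)"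
  have "pi * (R - 2)\<^sup>2 = measure lborel (cball u (R - 2))" using assms by (simp add: content_cball unit_ball_vol_2)
  also have "\<dots> \<le> measure lborel (\<Union>w\<in>?S. ?Q w)"
  proof (rule measure_mono_fmeasurable)
    show "cball u (R - 2) \<subseteq> (\<Union>w\<in>?S. ?Q w)"
    proof
      fix z assume z: "z \<in> cball u (R - 2)"
      define w where "w = Gauss \<lfloor>Re z\<rfloor> \<lfloor>Im z\<rfloor>"
      have Q: "z \<in> ?Q w" by (auto simp: in_cbox_complex_iff cpx_def w_def)
      then have "cmod (z - cpx w) \<le> 2"
        by (intro in_unit_square_dist) (auto simp: in_cbox_complex_iff)
      moreover have "cmod (z - u) \<le> R - 2" using z by (simp add: dist_norm norm_minus_commute)
      ultimately have "cmod (cpx w - u) \<le> R"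
        using norm_triangle_ineq[of "cpx w - z" "z - u"] by (simp add: norm_minus_commute)
      then show "z \<in> (\<Union>w\<in>?S. ?Q w)" using Q by (auto simp: disc_points_def)
    qed
    show "(\<Union>w\<in>?S. ?Q w) \<in> fmeasurable lborel"
      by (intro fmeasurable.finite_UN) (auto intro: fmeasurableI)
  qed auto
  also have "\<dots> \<le> (\<Sum>w\<in>?S. measure lborel (?Q w))"
    by (rule measure_UNION_le) auto
  also have "\<dots> = real (card ?S)" by (simp add: measure_unit_square)
  finally show ?thesis .
qed

lemma card_disc_points:
  assumes "R \<ge> 0" shows "\<bar>real (card (disc_points u R)) - pi * R\<^sup>2\<bar> \<le> 16 * (R + 1)"
proof -
  have "pi * (R + 2)\<^sup>2 = pi * R\<^sup>2 + pi * (4 * (R + 1))" by (simp add: power2_eq_square algebra_simps)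
  also have "\<dots> \<le> pi * R\<^sup>2 + 4 * (4 * (R + 1))"
    using assms pi_less_4 by (intro add_left_mono mult_right_mono) auto
  finally have u: "real (card (disc_points u R)) \<le> pi * R\<^sup>2 + 16 * (R + 1)"
    using card_disc_points_upper[OF assms, of u] by simp
  have l: "pi * R\<^sup>2 - 16 * (R + 1) \<le> real (card (disc_points u R))"
  proof (cases "R \<ge> 2")
    case True
    have "pi * R\<^sup>2 - 16 * (R + 1) \<le> pi * R\<^sup>2 - pi * (4 * R) + pi * 4"
    proof -
      define x where "x = pi * (4 * R)"
      have "x \<le> 4 * (4 * R)" unfolding x_def using assms pi_less_4 by (intro mult_right_mono) auto
      then have "a - 16 * (R + 1) \<le> a - x + pi * 4" for a using pi_gt_zero by argo
      then show ?thesis unfolding x_def by blast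
    qed
    also have "\<dots> = pi * (R - 2)\<^sup>2" by (simp add: power2_eq_square algebra_simps)
    finally show ?thesis using card_disc_points_lower[OF True, of u] by simp
  next
    case False
    have "pi * R\<^sup>2 \<le> 4 * (2 * R)" using False assms pi_less_4
      by (intro mult_mono) (auto simp: power2_eq_square intro: mult_right_mono)
    then have "pi * R\<^sup>2 - 16 * (R + 1) \<le> 0" using assms by simp
    then show ?thesis using of_nat_0_le_iff order_trans by blast
  qed
  show ?thesis using u l by (simp add: abs_le_iff)
qed

definition residues :: "gauss \<Rightarrow> gauss set"
  where "residues c = {r. gmod r c = r}"

definition periodic_mod :: "gauss \<Rightarrow> (gauss \<Rightarrow> bool) \<Rightarrow> bool"
  where "periodic_mod c P \<longleftrightarrow> (\<forall>a b. c dvd a - b \<longrightarrow> P a = P b)"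

text \<open>
  Meaningful for predicates that are periodic modulo \<open>c\<close>, where it counts residue
  classes.
\<close>

definition residue_count :: "gauss \<Rightarrow> (gauss \<Rightarrow> bool) \<Rightarrow> nat"
  where "residue_count c P = card {r \<in> residues c. P r}"

lemma finite_residues: "c \<noteq> 0 \<Longrightarrow> finite (residues c)"
proof (rule finite_subset[OF _ finite_gnorm_le[of "gnorm c"]])
  assume c: "c \<noteq> 0"
  show "residues c \<subseteq> {z. gnorm z \<le> gnorm c}"
  proof
    fix z assume "z \<in> residues c"
    then have "2 * gnorm z \<le> gnorm c" using gnorm_gmod[OF c, of z] by (simp add: residues_def)
    then have "gnorm z \<le> gnorm c" using gnorm_ge_0[of z] by linarith
    then show "z \<in> {z. gnorm z \<le> gnorm c}" by simp
  qed
qed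

lemma gmod_in_residues: "c \<noteq> 0 \<Longrightarrow> gmod z c \<in> residues c"
  by (simp add: residues_def gmod_gmod)

lemma residues_dvd_imp_eq:
  assumes "c \<noteq> 0" "r \<in> residues c" "s \<in> residues c" "c dvd r - s" shows "r = s"
  using assms gmod_eq_iff[of c r s] by (simp add: residues_def)

text \<open>
  The substitution \<open>d = r + c * w\<close> turns the condition on \<open>d\<close> into one that \<open>w\<close> lie in a
  disc of radius \<open>s / (2 * cmod (cpx c))\<close>.
\<close>

lemma card_residue_class_disc:
  assumes c: "c \<noteq> 0" and s: "s \<ge> 0"
  shows "finite {d. c dvd d - r \<and> cmod (2 * cpx d + v) \<le> s}"
    and "\<bar>real (card {d. c dvd d - r \<and> cmod (2 * cpx d + v) \<le> s}) - pi * s\<^sup>2 / (4 * real_of_int (gnorm c))\<bar>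
        \<le> 16 * (s / (2 * cmod (cpx c)) + 1)"
proof -
  let ?A = "{d. c dvd d - r \<and> cmod (2 * cpx d + v) \<le> s}"
  define u where "u = - (2 * cpx r + v) / (2 * cpx c)"
  define R where "R = s / (2 * cmod (cpx c))"
  have c0: "cpx c \<noteq> 0" "cmod (cpx c) > 0" using c by auto
  have eq: "?A = (\<lambda>w. r + c * w) ` disc_points u R"
  proof -
    have *: "cmod (2 * cpx (r + c * w) + v) \<le> s \<longleftrightarrow> w \<in> disc_points u R" for w
    proof -
      have "2 * cpx (r + c * w) + v = (2 * cpx c) * (cpx w - u)"
        using c0 by (simp add: u_def field_simps)
      then have "cmod (2 * cpx (r + c * w) + v) = (2 * cmod (cpx c)) * cmod (cpx w - u)"
        by (simp add: norm_mult)
      then show ?thesis using c0 by (simp add: disc_points_def R_def field_simps)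
    qed
    show ?thesis
    proof (intro equalityI subsetI)
      fix d assume d: "d \<in> ?A"
      then obtain w where "d - r = c * w" by (auto elim: dvdE)
      then have "d = r + c * w" by (simp add: algebra_simps)
      then show "d \<in> (\<lambda>w. r + c * w) ` disc_points u R" using d * by blast
    next
      fix d assume "d \<in> (\<lambda>w. r + c * w) ` disc_points u R"
      then show "d \<in> ?A" using * by auto
    qed
  qed
  show "finite ?A" unfolding eq by simp
  have "card ?A = card (disc_points u R)" unfolding eq using c
    by (intro card_image) (auto simp: inj_on_def)
  moreover have "pi * R\<^sup>2 = pi * s\<^sup>2 / (4 * real_of_int (gnorm c))"
    by (simp add: R_def power_divide power_mult_distrib norm_cpx_sq)
  moreover have "R \<ge> 0" using s by (simp add: R_def)
  ultimately show "\<bar>real (card ?A) - pi * s\<^sup>2 / (4 * real_of_int (gnorm c))\<bar>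
        \<le> 16 * (s / (2 * cmod (cpx c)) + 1)"
    using card_disc_points[of R u] by (simp add: R_def)
qed

lemma card_periodic_disc:
  assumes c: "c \<noteq> 0" and s: "s \<ge> 0" and P: "periodic_mod c P"
  shows "finite {d. P d \<and> cmod (2 * cpx d + v) \<le> s}"
    and "\<bar>real (card {d. P d \<and> cmod (2 * cpx d + v) \<le> s})
           - real (residue_count c P) * (pi * s\<^sup>2 / (4 * real_of_int (gnorm c)))\<bar>
        \<le> real (residue_count c P) * (16 * (s / (2 * cmod (cpx c)) + 1))"
proof -
  let ?X = "{r \<in> residues c. P r}"
  let ?A = "\<lambda>r. {d. c dvd d - r \<and> cmod (2 * cpx d + v) \<le> s}"
  have eq: "{d. P d \<and> cmod (2 * cpx d + v) \<le> s} = (\<Union>r\<in>?X. ?A r)"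
  proof (intro equalityI subsetI)
    fix d assume d: "d \<in> {d. P d \<and> cmod (2 * cpx d + v) \<le> s}"
    have "c dvd d - gmod d c" by (rule dvd_minus_gmod)
    moreover from this have "P (gmod d c)" using d P unfolding periodic_mod_def by blast
    ultimately show "d \<in> (\<Union>r\<in>?X. ?A r)" using d gmod_in_residues[OF c, of d] by blast
  next
    fix d assume "d \<in> (\<Union>r\<in>?X. ?A r)"
    then show "d \<in> {d. P d \<and> cmod (2 * cpx d + v) \<le> s}" using P unfolding periodic_mod_def by blast
  qed
  have fin: "finite ?X" using finite_residues[OF c] by simp
  show "finite {d. P d \<and> cmod (2 * cpx d + v) \<le> s}"
    unfolding eq using fin card_residue_class_disc(1)[OF c s] by blast
  have "card (\<Union>r\<in>?X. ?A r) = (\<Sum>r\<in>?X. card (?A r))"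
  proof (rule card_UN_disjoint[OF fin])
    show "\<forall>r\<in>?X. \<forall>r'\<in>?X. r \<noteq> r' \<longrightarrow> ?A r \<inter> ?A r' = {}"
    proof (intro ballI impI, rule ccontr)
      fix r r' assume r: "r \<in> ?X" "r' \<in> ?X" "r \<noteq> r'" "?A r \<inter> ?A r' \<noteq> {}"
      then obtain d where "c dvd d - r" "c dvd d - r'" by blast
      then have "c dvd (d - r') - (d - r)" by (rule dvd_diff[rotated])
      then have "c dvd r - r'" by simp
      then show False using residues_dvd_imp_eq[OF c, of r r'] r by auto
    qed
  qed (use card_residue_class_disc(1)[OF c s] in auto)
  then have "\<bar>real (card {d. P d \<and> cmod (2 * cpx d + v) \<le> s})
           - real (residue_count c P) * (pi * s\<^sup>2 / (4 * real_of_int (gnorm c)))\<bar>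
      = \<bar>\<Sum>r\<in>?X. (real (card (?A r)) - pi * s\<^sup>2 / (4 * real_of_int (gnorm c)))\<bar>"
    unfolding eq by (simp add: sum_subtractf residue_count_def)
  also have "\<dots> \<le> (\<Sum>r\<in>?X. 16 * (s / (2 * cmod (cpx c)) + 1))"
    by (rule order_trans[OF sum_abs sum_mono]) (rule card_residue_class_disc(2)[OF c s])
  finally show "\<bar>real (card {d. P d \<and> cmod (2 * cpx d + v) \<le> s})
           - real (residue_count c P) * (pi * s\<^sup>2 / (4 * real_of_int (gnorm c)))\<bar>
        \<le> real (residue_count c P) * (16 * (s / (2 * cmod (cpx c)) + 1))"
    by (simp add: residue_count_def)
qed

lemma quadratic_le_linear_imp_zero:
  fixes a :: real
  assumes "\<And>s. s \<ge> 1 \<Longrightarrow> \<bar>a\<bar> * s\<^sup>2 \<le> B * s" shows "a = 0"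
proof (rule ccontr)
  assume "a \<noteq> 0"
  define s where "s = \<bar>B\<bar> / \<bar>a\<bar> + 1"
  have s: "s \<ge> 1" by (simp add: s_def)
  have "(\<bar>a\<bar> * s) * s \<le> B * s" using assms[OF s] by (simp add: power2_eq_square mult.assoc)
  then have "\<bar>a\<bar> * s \<le> B" using s by simp
  moreover have "\<bar>a\<bar> * s = \<bar>B\<bar> + \<bar>a\<bar>" using \<open>a \<noteq> 0\<close> by (simp add: s_def field_simps)
  ultimately show False using \<open>a \<noteq> 0\<close> by linarith
qed

text \<open>
  Both sides are the density of the solutions of \<open>P\<close> in large discs. Thus a count of
  residues may be made modulo any period of the predicate.
\<close>

lemma residue_density_unique:
  assumes c: "c \<noteq> 0" and m: "m \<noteq> 0" and P: "periodic_mod c P" "periodic_mod m P"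
  shows "real (residue_count c P) / real_of_int (gnorm c) = real (residue_count m P) / real_of_int (gnorm m)"
proof -
  let ?x = "real (residue_count c P) / real_of_int (gnorm c)"
  let ?y = "real (residue_count m P) / real_of_int (gnorm m)"
  define D where "D = (\<lambda>c. real (residue_count c P) * (16 * (1 / (2 * cmod (cpx c)) + 1)))"
  (* The two main terms differ by a multiple of s^2, but only by a linear error. *)
  have "(?x - ?y) * (pi / 4) = 0"
  proof (rule quadratic_le_linear_imp_zero[where B = "D c + D m"])
    fix s :: real assume s: "s \<ge> 1"
    have b: "\<bar>real (card {d. P d \<and> cmod (2 * cpx d + 0) \<le> s}) -
        real (residue_count c P) / real_of_int (gnorm c) * (pi / 4) * s\<^sup>2\<bar> \<le> D c * s"
      if "c \<noteq> 0" "periodic_mod c P" for c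
    proof -
      have "s / (2 * cmod (cpx c)) + 1 \<le> (1 / (2 * cmod (cpx c)) + 1) * s"
        using s by (simp add: algebra_simps)
      then have "real (residue_count c P) * (16 * (s / (2 * cmod (cpx c)) + 1)) \<le>
         real (residue_count c P) * (16 * ((1 / (2 * cmod (cpx c)) + 1) * s))"
        by (intro mult_left_mono) auto
      then show ?thesis using card_periodic_disc(2)[OF that(1) _ that(2), of s 0] s
        by (simp add: D_def mult_ac)
    qed
    have "\<bar>?x * (pi / 4) * s\<^sup>2 - ?y * (pi / 4) * s\<^sup>2\<bar> \<le> D c * s + D m * s"
      using b[OF c P(1)] b[OF m P(2)] by linarith
    moreover have "?x * (pi / 4) * s\<^sup>2 - ?y * (pi / 4) * s\<^sup>2 = ((?x - ?y) * (pi / 4)) * s\<^sup>2"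
      by (simp add: algebra_simps)
    ultimately show "\<bar>(?x - ?y) * (pi / 4)\<bar> * s\<^sup>2 \<le> (D c + D m) * s"
      by (simp add: abs_mult distrib_right)
  qed
  then show ?thesis by simp
qed

lemma gmod_one [simp]: "gmod z 1 = 0"
  by (simp add: gmod_def gdiv_def gauss_eq_iff)

lemma residues_one: "residues 1 = {0}"
  by (auto simp: residues_def)

text \<open>
  The predicate that always holds has period 1 and density 1.
\<close>

lemma card_residues:
  assumes "c \<noteq> 0" shows "card (residues c) = nat (gnorm c)"
proof -
  have "real (residue_count c (\<lambda>_. True)) / real_of_int (gnorm c)
      = real (residue_count 1 (\<lambda>_. True)) / real_of_int (gnorm 1)"
    by (rule residue_density_unique) (auto simp: assms periodic_mod_def)
  then have "real (card (residues c)) = real_of_int (gnorm c)"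
    using assms by (simp add: residue_count_def residues_one)
  then show ?thesis by linarith
qed

section \<open>Square roots of one modulo a Gaussian integer\<close>

lemma periodic_mod_dvd_sub: "periodic_mod m (\<lambda>d. m dvd d - a)"
  unfolding periodic_mod_def
proof (intro allI impI)
  fix x y assume d: "m dvd x - y"
  have "x - a = (y - a) + (x - y)" by simp
  then show "(m dvd x - a) = (m dvd y - a)" using dvd_add_left_iff[OF d, of "y - a"] by simp
qed

lemma periodic_mod_disj: "periodic_mod m P \<Longrightarrow> periodic_mod m Q \<Longrightarrow> periodic_mod m (\<lambda>d. P d \<or> Q d)"
  unfolding periodic_mod_def by blast

lemma periodic_mod_square: "periodic_mod c (\<lambda>d. c dvd d * d - 1)"
  unfolding periodic_mod_def
proof (intro allI impI)
  fix x y assume d: "c dvd x - y"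
  have e: "x * x - 1 = (y * y - 1) + (x - y) * (x + y)" by (simp add: algebra_simps)
  show "(c dvd x * x - 1) = (c dvd y * y - 1)"
    unfolding e by (rule dvd_add_left_iff[OF dvd_mult2[OF d]])
qed

lemma residue_eq_gmod_iff:
  assumes "m \<noteq> 0" shows "r \<in> residues m \<and> m dvd r - a \<longleftrightarrow> r = gmod a m"
proof
  assume "r \<in> residues m \<and> m dvd r - a"
  then show "r = gmod a m" using gmod_eq_iff[OF assms, of r a] by (simp add: residues_def)
next
  assume r: "r = gmod a m"
  then have "gmod r m = gmod a m" using gmod_gmod[OF assms] by simp
  then show "r \<in> residues m \<and> m dvd r - a"
    using gmod_eq_iff[OF assms, of r a] r by (simp add: residues_def)
qed

lemma residue_count_dvd_sub:
  assumes "m \<noteq> 0" shows "residue_count m (\<lambda>d. m dvd d - a) = 1"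
proof -
  have "{r \<in> residues m. m dvd r - a} = {gmod a m}"
    using residue_eq_gmod_iff[OF assms] by blast
  then show ?thesis by (simp add: residue_count_def)
qed

lemma residue_count_disj:
  assumes "m \<noteq> 0" "\<not> m dvd a - b"
  shows "residue_count m (\<lambda>d. m dvd d - a \<or> m dvd d - b) = 2"
proof -
  have "{r \<in> residues m. m dvd r - a \<or> m dvd r - b} = {gmod a m, gmod b m}"
    using residue_eq_gmod_iff[OF assms(1)] by blast
  moreover have "gmod a m \<noteq> gmod b m" using gmod_eq_iff[OF assms(1)] assms(2) by blast
  ultimately show ?thesis by (simp add: residue_count_def)
qed

lemma chinese_remainder_gauss:
  assumes "comax a b" obtains r where "a dvd r - x" "b dvd r - y"
proof -
  obtain u v where uv: "u * a + v * b = 1" using assms by (auto simp: comax_def)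
  define r where "r = u * a * y + v * b * x"
  have "r - x = u * a * y + v * b * x - (u * a + v * b) * x" by (simp add: uv r_def)
  also have "\<dots> = a * (u * (y - x))" by (simp add: algebra_simps)
  finally have 1: "a dvd r - x" by (rule dvdI)
  have "r - y = u * a * y + v * b * x - (u * a + v * b) * y" by (simp add: uv r_def)
  also have "\<dots> = b * (v * (x - y))" by (simp add: algebra_simps)
  finally have "b dvd r - y" by (rule dvdI)
  with 1 show ?thesis using that by blast
qed

text \<open>
  The Chinese remainder theorem.
\<close>

lemma residue_count_mult:
  assumes ab: "comax a b" "a \<noteq> 0" "b \<noteq> 0" and P: "periodic_mod a P" and Q: "periodic_mod b Q"
  shows "residue_count (a * b) (\<lambda>d. P d \<and> Q d) = residue_count a P * residue_count b Q"
proof -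
  have n0: "a * b \<noteq> 0" using ab by simp
  let ?f = "\<lambda>r. (gmod r a, gmod r b)"
  let ?X = "{r \<in> residues (a * b). P r \<and> Q r}"
  have Pm: "P (gmod r a) = P r" "Q (gmod r b) = Q r" for r
    using P[unfolded periodic_mod_def, rule_format, OF dvd_minus_gmod]
      Q[unfolded periodic_mod_def, rule_format, OF dvd_minus_gmod] by simp_all
  have "inj_on ?f ?X"
  proof (rule inj_onI)
    fix r s assume rs: "r \<in> ?X" "s \<in> ?X" "?f r = ?f s"
    then have "a dvd r - s" "b dvd r - s" using gmod_eq_iff[OF ab(2)] gmod_eq_iff[OF ab(3)] by auto
    then have "a * b dvd r - s" using comax_mult_dvd ab by blast
    then show "r = s" using residues_dvd_imp_eq[OF n0] rs by blast
  qed
  moreover have "?f ` ?X = {r \<in> residues a. P r} \<times> {r \<in> residues b. Q r}"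
  proof (intro equalityI subsetI)
    fix z assume "z \<in> ?f ` ?X"
    then show "z \<in> {r \<in> residues a. P r} \<times> {r \<in> residues b. Q r}"
      using gmod_in_residues[OF ab(2)] gmod_in_residues[OF ab(3)] by (auto simp: Pm)
  next
    fix z assume "z \<in> {r \<in> residues a. P r} \<times> {r \<in> residues b. Q r}"
    then obtain x y where z: "z = (x, y)" "x \<in> residues a" "P x" "y \<in> residues b" "Q y" by auto
    obtain r where r: "a dvd r - x" "b dvd r - y" using chinese_remainder_gauss[OF ab(1)] by blast
    define s where "s = gmod r (a * b)"
    have "a * b dvd r - s" unfolding s_def by (rule dvd_minus_gmod)
    then have ds: "a dvd r - s" "b dvd r - s" by (rule dvd_mult_left, rule dvd_mult_right)
    have sx: "a dvd s - x" "b dvd s - y"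
      using dvd_diff[OF r(1) ds(1)] dvd_diff[OF r(2) ds(2)] by simp_all
    then have "gmod s a = x" "gmod s b = y" using z gmod_eq_iff[OF ab(2), of s x] gmod_eq_iff[OF ab(3), of s y]
      by (auto simp: residues_def)
    moreover have "s \<in> residues (a * b)" unfolding s_def by (rule gmod_in_residues[OF n0])
    moreover have "P s" "Q s"
      using P[unfolded periodic_mod_def, rule_format, OF sx(1)]
        Q[unfolded periodic_mod_def, rule_format, OF sx(2)] z by simp_all
    ultimately have "s \<in> ?X" "z = ?f s" using z by simp_all
    then show "z \<in> ?f ` ?X" by (rule rev_image_eqI)
  qed
  ultimately have "card ({r \<in> residues a. P r} \<times> {r \<in> residues b. Q r}) = card ?X"
    using card_image[of ?f ?X] by simp
  then show ?thesis by (simp add: residue_count_def card_cartesian_product)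
qed

text \<open>
  The number of square roots of 1 modulo \<open>c\<close>.
\<close>

definition rho :: "gauss \<Rightarrow> nat"
  where "rho c = residue_count c (\<lambda>d. c dvd d * d - 1)"

lemma rho_mult:
  assumes "comax a b" "a \<noteq> 0" "b \<noteq> 0" shows "rho (a * b) = rho a * rho b"
proof -
  have e: "a * b dvd z \<longleftrightarrow> a dvd z \<and> b dvd z" for z
    using comax_mult_dvd[OF assms(1), of z] dvd_mult_left[of a b z] dvd_mult_right[of a b z] by blast
  show ?thesis unfolding rho_def e
    by (rule residue_count_mult[OF assms periodic_mod_square periodic_mod_square])
qed

lemma glam_dvd_iff_parity: "glam dvd z \<longleftrightarrow> even (gre z + gim z)"
  unfolding glam_dvd_iff by (simp add: gnorm_def)

lemma glam_neq_0 [simp]: "glam \<noteq> 0"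
  by (simp add: gauss_eq_iff)

lemma glam_dvd_mult_iff: "glam dvd x * y \<longleftrightarrow> glam dvd x \<or> glam dvd y"
  unfolding glam_dvd_iff gnorm_mult by simp

lemma odd_comax_glam_power:
  assumes "\<not> glam dvd z" shows "comax (glam ^ i) z"
proof (induction i)
  case 0
  have "1 * 1 + 0 * z = 1" by simp
  then show ?case unfolding comax_def power_0 by blast
next
  case (Suc i)
  have "comax glam z" using prime_norm_dvd_or_comax[of 2 glam z] assms gnorm_glam by auto
  then show ?case using Suc comax_mult_right[of z glam "glam ^ i"] comax_commute by auto
qed

lemma two_eq_glam: "2 = glam ^ 2 * (- gI)"
  by (simp add: gauss_eq_iff power2_eq_square)

lemma glam_power_dvd_mult_odd:
  assumes "\<not> glam dvd w" shows "glam ^ i dvd z * w \<longleftrightarrow> glam ^ i dvd z"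
  using comax_dvd_mult[OF odd_comax_glam_power[OF assms, of i], of z] by (auto simp: mult.commute)

text \<open>
  Put \<open>x = d - 1\<close>, so that \<open>d\<^sup>2 - 1 = x * (x + 2)\<close>, and let \<open>\<lambda> = 1 + i\<close>, with \<open>2 = - i \<lambda>\<^sup>2\<close>.
  If \<open>\<lambda>\<close> does not divide \<open>x\<close>, neither factor is divisible by \<open>\<lambda>\<close>. If \<open>\<lambda>\<close> divides \<open>x\<close> exactly
  once, the same holds for \<open>x + 2\<close>. If \<open>x = \<lambda>\<^sup>2 * v\<close>, the product is \<open>\<lambda>\<^sup>4 * v * (v - i)\<close>, and
  exactly one of \<open>v\<close> and \<open>v - i\<close> is divisible by \<open>\<lambda>\<close>.
\<close>

lemma glam_power_dvd_square_minus_1: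
  "glam ^ j dvd d * d - 1 \<longleftrightarrow>
     (if j = 0 then True else if j \<le> 2 then glam dvd d - 1
      else if j \<le> 4 then glam ^ 2 dvd d - 1
      else glam ^ (j - 2) dvd d - 1 \<or> glam ^ (j - 2) dvd d - (- 1))"
proof -
  define x where "x = d - 1"
  have f: "d * d - 1 = x * (x + 2)" and x2: "d - (- 1) = x + 2" by (simp_all add: x_def algebra_simps)
  have pow_dvd: "glam ^ i dvd glam ^ k" if "i \<le> k" for i k :: nat using that by (rule le_imp_power_dvd)
  consider "\<not> glam dvd x" | w where "x = glam * w" "\<not> glam dvd w" | v where "x = glam ^ 2 * v"
  proof (cases "glam dvd x")
    case True
    then obtain w where w: "x = glam * w" by (elim dvdE)
    show ?thesis
    proof (cases "glam dvd w")
      case True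
      then obtain v where "w = glam * v" by (elim dvdE)
      then show ?thesis using w that(3)[of v] by (simp add: power2_eq_square mult.assoc)
    qed (use w that in blast)
  qed (use that in blast)
  then show ?thesis
  proof cases
    case 1
    have "\<not> glam dvd x + 2" using 1 by (simp add: glam_dvd_iff_parity)
    then have "\<not> glam dvd x * (x + 2)" using 1 by (simp add: glam_dvd_mult_iff)
    moreover have "glam dvd glam ^ i" if "i > 0" for i using that by (simp add: dvd_power)
    ultimately have "\<not> glam ^ i dvd x * (x + 2)" "\<not> glam ^ i dvd x" "\<not> glam ^ i dvd x + 2" if "i > 0" for i
      using that 1 \<open>\<not> glam dvd x + 2\<close> dvd_trans by blast+
    then show ?thesis unfolding f x2 using 1 by (auto simp flip: x_def)
  next
    case (2 w)
    have e: "x + 2 = glam * (w + glam * (- gI))" unfolding 2(1) by (subst two_eq_glam) (simp add: algebra_simps power2_eq_square)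
    have o: "\<not> glam dvd w + glam * (- gI)" using 2(2) by (simp add: glam_dvd_iff_parity)
    have p: "x * (x + 2) = glam ^ 2 * (w * (w + glam * (- gI)))"
    proof -
      have "x * (x + 2) = x * (glam * (w + glam * (- gI)))" by (simp only: e)
      also have "\<dots> = glam ^ 2 * (w * (w + glam * (- gI)))"
        by (simp only: 2(1) power2_eq_square mult_ac)
      finally show ?thesis .
    qed
    have ow: "\<not> glam dvd w * (w + glam * (- gI))" using o 2(2) by (simp add: glam_dvd_mult_iff)
    have n3: "\<not> glam ^ i dvd x * (x + 2)" if "i \<ge> 3" for i
    proof
      assume "glam ^ i dvd x * (x + 2)"
      then have "glam ^ 3 dvd glam ^ 2 * (w * (w + glam * (- gI)))" using pow_dvd[OF that] dvd_trans unfolding p by blast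
      then have "glam ^ 2 * glam dvd glam ^ 2 * (w * (w + glam * (- gI)))" by (simp only: power3_eq_cube power2_eq_square)
      then have "glam dvd w * (w + glam * (- gI))" by (subst (asm) dvd_mult_cancel_left) simp
      then show False using ow by blast
    qed
    have n2: "\<not> glam ^ i dvd glam * y" if "i \<ge> 2" "\<not> glam dvd y" for i y
    proof
      assume "glam ^ i dvd glam * y"
      then have "glam * glam dvd glam * y" using pow_dvd[OF that(1)] dvd_trans by (metis power2_eq_square)
      then have "glam dvd y" by (subst (asm) dvd_mult_cancel_left) simp
      then show False using that by blast
    qed
    have "glam ^ j dvd x * (x + 2)" if "j \<le> 2"
      unfolding p using pow_dvd[OF that] by (rule dvd_mult2)
    then show ?thesis unfolding f x2 x_def[symmetric]
      using n3[of j] n2[of _ w] n2[of _ "w + glam * (- gI)"] 2 o unfolding e by auto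
  next
    case (3 v)
    have e: "x + 2 = glam ^ 2 * (v - gI)" unfolding 3(1) by (subst two_eq_glam) (simp add: algebra_simps)
    have p: "x * (x + 2) = glam ^ 4 * (v * (v - gI))"
    proof -
      have "glam ^ 4 = glam ^ 2 * glam ^ 2" by (simp flip: power_add)
      then show ?thesis by (simp only: e) (simp only: 3 mult_ac)
    qed
    show ?thesis
    proof (cases "j \<le> 4")
      case True
      have "glam ^ j dvd x * (x + 2)" unfolding p using pow_dvd[OF True] by (rule dvd_mult2)
      moreover have "glam dvd x" "glam ^ 2 dvd x" unfolding 3 by (auto simp: power2_eq_square)
      ultimately show ?thesis unfolding f x_def[symmetric] using True by auto
    next
      case False
      define i where "i = j - 4"
      have j: "j = 4 + i" "j - 2 = 2 + i" using False by (auto simp: i_def)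
      have "glam ^ j dvd x * (x + 2) \<longleftrightarrow> glam ^ i dvd v * (v - gI)"
        unfolding p j power_add by simp
      also have "\<dots> \<longleftrightarrow> glam ^ i dvd v \<or> glam ^ i dvd v - gI"
      proof (cases "glam dvd v")
        case True
        then have o: "\<not> glam dvd v - gI" by (simp add: glam_dvd_iff_parity)
        moreover have "glam dvd glam ^ i" using False by (auto simp: i_def intro: dvd_power)
        ultimately have "\<not> glam ^ i dvd v - gI" using dvd_trans by blast
        then show ?thesis using glam_power_dvd_mult_odd[OF o] by simp
      next
        case v: False
        moreover have "glam dvd glam ^ i" using False by (auto simp: i_def intro: dvd_power)
        ultimately have "\<not> glam ^ i dvd v" using dvd_trans by blast
        then show ?thesis using glam_power_dvd_mult_odd[OF v, of i "v - gI"] by (simp add: mult.commute)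
      qed
      also have "glam ^ i dvd v \<longleftrightarrow> glam ^ (j - 2) dvd x"
        unfolding 3 j(2) power_add dvd_mult_cancel_left by simp
      also have "glam ^ i dvd v - gI \<longleftrightarrow> glam ^ (j - 2) dvd x + 2"
        unfolding e j(2) power_add dvd_mult_cancel_left by simp
      finally show ?thesis unfolding f x2 using False by (simp flip: x_def)
    qed
  qed
qed

text \<open>
  The density of the square roots of 1 modulo \<open>(1 + i) ^ j\<close>.
\<close>

definition lam_weight :: "nat \<Rightarrow> real"
  where "lam_weight j = (if j = 0 then 1 else if j \<le> 2 then 1/2 else if j \<le> 4 then 1/4 else 8 / 2 ^ j)"

text \<open>
  The congruence modulo \<open>(1 + i) ^ j\<close> holds on classes modulo a lower power of \<open>1 + i\<close>,
  where the solutions are visible; densities do not depend on the modulus.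
\<close>

lemma rho_glam_power: "real (rho (glam ^ j)) / 2 ^ j = lam_weight j"
proof -
  define P where "P = (\<lambda>d. glam ^ j dvd d * d - 1)"
  have per: "periodic_mod (glam ^ j) P" unfolding P_def by (rule periodic_mod_square)
  have gn: "real_of_int (gnorm (glam ^ i)) = 2 ^ i" for i by (simp add: gnorm_power gnorm_glam)
  have dens: "real (rho (glam ^ j)) / 2 ^ j = real (residue_count (glam ^ i) P) / 2 ^ i"
    if "periodic_mod (glam ^ i) P" for i
    using residue_density_unique[OF _ _ per that] unfolding gn by (simp add: rho_def P_def)
  consider "j = 0" | "j > 0" "j \<le> 2" | "j > 2" "j \<le> 4" | "j > 4" by linarith
  then show ?thesis
  proof cases
    case 1
    then show ?thesis by (simp add: rho_def lam_weight_def residue_count_def residues_one)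
  next
    case 2
    then have P: "P = (\<lambda>d. glam ^ 1 dvd d - 1)" unfolding P_def glam_power_dvd_square_minus_1 by auto
    have "real (rho (glam ^ j)) / 2 ^ j = real (residue_count (glam ^ 1) P) / 2 ^ 1"
      by (rule dens, unfold P, rule periodic_mod_dvd_sub)
    also have "\<dots> = lam_weight j"
      unfolding P using 2 by (subst residue_count_dvd_sub) (simp_all add: lam_weight_def)
    finally show ?thesis .
  next
    case 3
    then have P: "P = (\<lambda>d. glam ^ 2 dvd d - 1)" unfolding P_def glam_power_dvd_square_minus_1 by auto
    have "real (rho (glam ^ j)) / 2 ^ j = real (residue_count (glam ^ 2) P) / 2 ^ 2"
      by (rule dens, unfold P, rule periodic_mod_dvd_sub)
    also have "\<dots> = lam_weight j"
      unfolding P using 3 by (subst residue_count_dvd_sub) (simp_all add: lam_weight_def)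
    finally show ?thesis .
  next
    case 4
    then have P: "P = (\<lambda>d. glam ^ (j - 2) dvd d - 1 \<or> glam ^ (j - 2) dvd d - (- 1))"
      unfolding P_def glam_power_dvd_square_minus_1 by auto
    have nd: "\<not> glam ^ (j - 2) dvd 1 - (- 1)"
    proof
      assume "glam ^ (j - 2) dvd 1 - (- 1)"
      then have "gnorm (glam ^ (j - 2)) dvd gnorm (1 - (- 1))" by (rule gnorm_dvd)
      then have "(2 :: int) ^ (j - 2) dvd 4" by (simp add: gnorm_power gnorm_glam) (simp add: gnorm_def)
      moreover have "(2 :: int) ^ 3 dvd 2 ^ (j - 2)" using 4 by (intro le_imp_power_dvd) auto
      ultimately have "(2 :: int) ^ 3 dvd 4" by (rule dvd_trans[rotated])
      then show False by simp
    qed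
    have j2: "2 ^ j = (2 :: real) ^ (j - 2) * 4" using 4 by (simp add: power_diff)
    have "real (rho (glam ^ j)) / 2 ^ j = real (residue_count (glam ^ (j - 2)) P) / 2 ^ (j - 2)"
      by (rule dens, unfold P, intro periodic_mod_disj periodic_mod_dvd_sub)
    also have "\<dots> = 2 / 2 ^ (j - 2)"
      unfolding P by (subst residue_count_disj[OF _ nd]) simp_all
    also have "\<dots> = lam_weight j" using 4 by (simp add: lam_weight_def j2)
    finally show ?thesis .
  qed
qed

lemma lam_weight_nonneg: "lam_weight j \<ge> 0"
  by (simp add: lam_weight_def)

lemma lam_weight_le: "lam_weight j \<le> 8 / 2 ^ j"
proof (cases "j \<le> 4")
  case True
  then have "j \<in> {0, 1, 2, 3, 4}" by auto
  then show ?thesis by (auto simp: lam_weight_def)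
qed (auto simp: lam_weight_def)

text \<open>
  The value 3 is also that of the Euler factor \<open>(1 + x) / (1 - x)\<close> at \<open>x = 1/2\<close>, the form
  which the factors at odd primes take at \<open>x = 1 / N(p)\<close>. So the prime \<open>1 + i\<close> does not
  distort the leading constant.
\<close>

lemma lam_weight_sums: "lam_weight sums 3"
proof -
  have "(\<lambda>n. (1/2) ^ n) sums (1 / (1 - 1/2 :: real))" by (rule geometric_sums) simp
  then have "(\<lambda>n. 1/4 * (1/2) ^ n) sums (1/4 * (2 :: real))" by (intro sums_mult) simp
  then have "(\<lambda>n. lam_weight (n + 5)) sums (1/2)"
    by (simp add: lam_weight_def power_add power_divide)
  then have "lam_weight sums (1/2 + (\<Sum>i<5. lam_weight i))" by (subst (asm) sums_iff_shift)
  then show ?thesis by (simp add: lam_weight_def numeral_eq_Suc)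
qed

text \<open>
  The numbers \<open>r + 1\<close> and \<open>r - 1\<close> differ by 2, an associate of \<open>(1 + i)\<^sup>2\<close>, which is
  invertible modulo the odd element \<open>a\<close>.
\<close>

lemma odd_comax_of_two:
  assumes "\<not> glam dvd a" "a dvd r - 1" "b dvd r + 1" shows "comax a b"
proof -
  have "comax (glam ^ 2) a" by (rule odd_comax_glam_power[OF assms(1)])
  then obtain u v where uv: "u * glam ^ 2 + v * a = 1" by (auto simp: comax_def)
  obtain x y where xy: "r - 1 = a * x" "r + 1 = b * y" using assms by (auto elim!: dvdE)
  have "glam ^ 2 = gI * 2" by (simp add: gauss_eq_iff power2_eq_square)
  also have "\<dots> = gI * ((r + 1) - (r - 1))" by simp
  also have "\<dots> = gI * (b * y - a * x)" unfolding xy ..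
  finally have "glam ^ 2 = gI * (b * y - a * x)" .
  then have "u * (gI * (b * y - a * x)) + v * a = 1" using uv by (simp only:)
  then have "(v - u * gI * x) * a + (u * gI * y) * b = 1"
    by (simp add: algebra_simps)
  then show ?thesis unfolding comax_def by blast
qed

definition coprime_factorizations :: "gauss \<Rightarrow> (gauss \<times> gauss) set"
  where "coprime_factorizations c = {(a, b). a * b = c \<and> comax a b}"

lemma gauss_unit_mult_gcnj: "gnorm e = 1 \<Longrightarrow> e * gcnj e = 1" "gnorm e = 1 \<Longrightarrow> gcnj e * e = 1"
  by (simp_all add: mult_gcnj mult.commute)

text \<open>
  For odd \<open>c\<close>, a square root \<open>r\<close> of 1 modulo \<open>c\<close> corresponds to the splitting of \<open>c\<close> into
  its parts dividing \<open>r - 1\<close> and \<open>r + 1\<close>. These parts are determined up to the four units,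
  and by the Chinese remainder theorem each comaximal factorization arises from exactly
  one residue class \<open>r\<close>.
\<close>

lemma card_coprime_factorizations:
  assumes c: "\<not> glam dvd c"
  shows "card (coprime_factorizations c) = 4 * rho c" "finite (coprime_factorizations c)"
proof -
  have c0: "c \<noteq> 0" using c by auto
  define sol where "sol = {r \<in> residues c. c dvd r * r - 1}"
  have fin: "finite sol" unfolding sol_def using finite_residues[OF c0] by simp
  define F where "F = (\<lambda>r. {(a, b). a * b = c \<and> a dvd r - 1 \<and> b dvd r + 1})"
  have odd_dvd: "\<not> glam dvd a" if "a dvd c" for a using c dvd_trans[OF _ that] by blast
  have cF: "card (F r) = 4 \<and> finite (F r)" if r: "r \<in> sol" for r
  proof -
    obtain g u v where g: "g dvd c" "g dvd r - 1" "g = u * c + v * (r - 1)" by (rule gauss_bezout)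
    obtain b0 where b0: "c = g * b0" using g(1) by (elim dvdE)
    obtain x where x: "r - 1 = g * x" using g(2) by (elim dvdE)
    have g0: "g \<noteq> 0" "b0 \<noteq> 0" using b0 c0 by auto
    have "g * 1 = g * (u * b0 + v * x)" using g(3) unfolding b0 x by (simp add: algebra_simps)
    then have "u * b0 + v * x = 1" using g0 by (simp only: mult_cancel_left) auto
    then have cop: "comax b0 x" unfolding comax_def by blast
    have "c dvd (r - 1) * (r + 1)" using r by (simp add: sol_def algebra_simps)
    then have "g * b0 dvd g * (x * (r + 1))" unfolding b0 x by (simp add: mult.assoc)
    then have "b0 dvd x * (r + 1)" using g0 by simp
    then have b0d: "b0 dvd r + 1" using comax_dvd_mult[OF cop] by blast
    (* With g the greatest common divisor of c and r - 1, the admissible first factors are the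
       associates of g, and the second factor is determined by the first. *)
    have "F r = (\<lambda>e. (g * e, b0 * gcnj e)) ` {z. gnorm z = 1}"
    proof (intro equalityI subsetI)
      fix z assume "z \<in> F r"
      then obtain a b where z: "z = (a, b)" "a * b = c" "a dvd r - 1" "b dvd r + 1" by (auto simp: F_def)
      have "comax g b" using odd_comax_of_two[OF odd_dvd[OF g(1)] g(2) z(4)] .
      moreover have "g dvd b * a" using g(1) z(2) by (simp add: mult.commute)
      ultimately have "g dvd a" by (rule comax_dvd_mult)
      then obtain e where e: "a = g * e" by (elim dvdE)
      have "a dvd g" unfolding g(3) using z by (intro dvd_add dvd_mult) auto
      then obtain e' where "g = a * e'" by (elim dvdE)
      then have "g * 1 = g * (e * e')" using e by (simp add: mult.assoc)
      then have "1 = e * e'" using g0 by (simp only: mult_cancel_left) auto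
      then have "e dvd 1" by (rule dvdI)
      then have e1: "gnorm e = 1" unfolding gauss_unit_iff .
      have "g * (e * b) = g * b0" using z(2) e b0 by (simp add: mult.assoc)
      then have "e * b = b0" using g0 by simp
      then have "b0 * gcnj e = (e * b) * gcnj e" by simp
      also have "\<dots> = (e * gcnj e) * b" by (simp only: mult_ac)
      finally have "b = b0 * gcnj e" using gauss_unit_mult_gcnj(1)[OF e1] by simp
      then show "z \<in> (\<lambda>e. (g * e, b0 * gcnj e)) ` {z. gnorm z = 1}" using z e e1 by blast
    next
      fix z assume "z \<in> (\<lambda>e. (g * e, b0 * gcnj e)) ` {z. gnorm z = 1}"
      then obtain e where e: "z = (g * e, b0 * gcnj e)" "gnorm e = 1" by blast
      have "g * e * (b0 * gcnj e) = c * (e * gcnj e)" unfolding b0 by (simp only: mult_ac)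
      then have 1: "g * e * (b0 * gcnj e) = c" using gauss_unit_mult_gcnj[OF e(2)] by simp
      have "(g * e) * (gcnj e * x) = (e * gcnj e) * (g * x)" by (simp only: mult_ac)
      also have "\<dots> = r - 1" using gauss_unit_mult_gcnj[OF e(2)] x by simp
      finally have 2: "g * e dvd r - 1" by (intro dvdI) (rule sym)
      obtain y where y: "r + 1 = b0 * y" using b0d by (elim dvdE)
      have "(b0 * gcnj e) * (e * y) = (e * gcnj e) * (b0 * y)" by (simp only: mult_ac)
      also have "\<dots> = r + 1" using gauss_unit_mult_gcnj[OF e(2)] y by simp
      finally have 3: "b0 * gcnj e dvd r + 1" by (intro dvdI) (rule sym)
      show "z \<in> F r" unfolding F_def using e 1 2 3 by simp
    qed
    moreover have "inj_on (\<lambda>e. (g * e, b0 * gcnj e)) {z. gnorm z = 1}"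
      using g0 by (auto simp: inj_on_def)
    ultimately show ?thesis using card_units_gauss finite_gnorm_eq by (simp add: card_image)
  qed
  (* Counting the triples (r, a, b) along either projection compares the two cardinalities. *)
  have "snd ` Sigma sol F = coprime_factorizations c"
  proof (intro equalityI subsetI)
    fix z assume "z \<in> snd ` Sigma sol F"
    then obtain r a b where "z = (a, b)" "a * b = c" "a dvd r - 1" "b dvd r + 1" by (auto simp: F_def)
    moreover from this have "comax a b" using odd_comax_of_two[of a r b] odd_dvd[of a] by auto
    ultimately show "z \<in> coprime_factorizations c" by (simp add: coprime_factorizations_def)
  next
    fix z assume "z \<in> coprime_factorizations c"
    then obtain a b where z: "z = (a, b)" "a * b = c" "comax a b" by (auto simp: coprime_factorizations_def)
    obtain r where r: "a dvd r - 1" "b dvd r - (- 1)" using chinese_remainder_gauss[OF z(3)] by blast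
    define s where "s = gmod r c"
    have "a * b dvd r - s" using dvd_minus_gmod[of c r] z(2) unfolding s_def by simp
    then have ds: "a dvd r - s" "b dvd r - s" by (rule dvd_mult_left, rule dvd_mult_right)
    have d: "a dvd s - 1" "b dvd s + 1"
      using dvd_diff[OF r(1) ds(1)] dvd_diff[OF r(2) ds(2)] by (simp_all add: add.commute)
    have "a * b dvd (s - 1) * (s + 1)" using d by (rule mult_dvd_mono)
    then have "s \<in> sol" using z gmod_in_residues[OF c0, of r] by (simp add: sol_def s_def algebra_simps)
    then have "(s, (a, b)) \<in> Sigma sol F" using d z by (auto simp: F_def)
    then show "z \<in> snd ` Sigma sol F" unfolding z(1) by (rule rev_image_eqI) simp
  qed
  moreover have "inj_on snd (Sigma sol F)"
  proof (rule inj_onI)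
    fix p q assume pq: "p \<in> Sigma sol F" "q \<in> Sigma sol F" "snd p = snd q"
    obtain r a b s a' b' where v: "p = (r, (a, b))" "q = (s, (a', b'))" by (metis surj_pair)
    then have v: "p = (r, (a, b))" "q = (s, (a, b))" using pq(3) by simp_all
    then have "a dvd r - 1" "b dvd r + 1" "a dvd s - 1" "b dvd s + 1" "a * b = c" "r \<in> residues c" "s \<in> residues c"
      using pq by (auto simp: F_def sol_def)
    note w = this
    have "a dvd r - s" "b dvd r - s"
      using dvd_diff[OF w(1) w(3)] dvd_diff[OF w(2) w(4)] by simp_all
    moreover have "comax a b" using w odd_comax_of_two[of a r b] odd_dvd[of a] by auto
    ultimately have "c dvd r - s" using comax_mult_dvd[of a b "r - s"] w(5) by simp
    then show "p = q" using residues_dvd_imp_eq[OF c0 w(6,7)] v by simp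
  qed
  ultimately have "card (coprime_factorizations c) = card (Sigma sol F)"
    and f: "finite (coprime_factorizations c) \<longleftrightarrow> finite (Sigma sol F)"
    using card_image[of snd "Sigma sol F"] finite_image_iff[of snd "Sigma sol F"] by simp_all
  moreover have "card (Sigma sol F) = (\<Sum>r\<in>sol. card (F r))"
    by (rule card_SigmaI) (use fin cF in auto)
  ultimately show "card (coprime_factorizations c) = 4 * rho c"
    using cF by (simp add: rho_def residue_count_def sol_def)
  show "finite (coprime_factorizations c)" unfolding f using fin cF by (intro finite_SigmaI) auto
qed

section \<open>Logarithmic sums over odd elements\<close>

abbreviation rnorm :: "gauss \<Rightarrow> real"
  where "rnorm z \<equiv> real_of_int (gnorm z)"

lemma rnorm_ge_1: "z \<noteq> 0 \<Longrightarrow> rnorm z \<ge> 1"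
proof -
  assume "z \<noteq> 0"
  then have "gnorm z \<ge> 1" by (simp add: gnorm_ge_1_iff)
  then show ?thesis by linarith
qed

text \<open>
  Elements prime to \<open>1 + i\<close>, called odd below.
\<close>

definition oball :: "real \<Rightarrow> gauss set"
  where "oball x = {z \<in> gball x. \<not> glam dvd z}"

lemma finite_oball [simp]: "finite (oball x)"
  by (simp add: oball_def)

lemma oball_neq_0: "z \<in> oball x \<Longrightarrow> z \<noteq> 0"
  by (auto simp: oball_def gball_def)

lemma oball_rnorm_le: "z \<in> oball x \<Longrightarrow> rnorm z \<le> x"
  by (simp add: oball_def gball_def)

text \<open>
  An average of \<open>f (x / n)\<close> with summable weights keeps the growth \<open>b * (ln x)\<^sup>2\<close> of \<open>f\<close>.
  Replacing \<open>ln (x / n)\<close> by \<open>ln x\<close> changes the square by at most \<open>2 * ln x * ln n\<close>, and the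
  weights with \<open>n > x\<close> that are missing have sum at most \<open>V / ln x\<close>.
\<close>

lemma weighted_log_square_bound:
  fixes w n :: "'a \<Rightarrow> real"
  assumes w0: "\<And>i. i \<in> I \<Longrightarrow> w i \<ge> 0" and n1: "\<And>i. i \<in> I \<Longrightarrow> n i \<ge> 1"
    and fin: "finite {i \<in> I. n i \<le> x}"
    and W: "(w has_sum W) I" and V: "((\<lambda>i. w i * ln (n i)) has_sum V) I"
    and x: "x \<ge> 1" and B: "B \<ge> 0"
    and f: "\<And>i. i \<in> I \<Longrightarrow> n i \<le> x \<Longrightarrow> \<bar>f (x / n i) - b * (ln (x / n i))\<^sup>2\<bar> \<le> B"
  shows "\<bar>(\<Sum>i | i \<in> I \<and> n i \<le> x. w i * f (x / n i)) - W * b * (ln x)\<^sup>2\<bar> \<le> W * B + 3 * \<bar>b\<bar> * V * ln x"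
proof -
  let ?J = "{i \<in> I. n i \<le> x}"
  let ?R = "I - ?J"
  have L0: "ln x \<ge> 0" using x by simp
  have WR: "(w has_sum (W - sum w ?J)) ?R"
    using W fin by (intro has_sum_Diff has_sum_finite) auto
  have VR: "((\<lambda>i. w i * ln (n i)) has_sum (V - (\<Sum>i\<in>?J. w i * ln (n i)))) ?R"
    using V fin by (intro has_sum_Diff has_sum_finite) auto
  have R0: "W - sum w ?J \<ge> 0" using WR by (rule has_sum_nonneg) (use w0 in auto)
  have RL: "ln x * (W - sum w ?J) \<le> V - (\<Sum>i\<in>?J. w i * ln (n i))"
  proof (rule has_sum_mono[OF has_sum_cmult_right[OF WR] VR])
    fix i assume i: "i \<in> ?R"
    then have "ln x \<le> ln (n i)" using x by auto
    then show "ln x * w i \<le> w i * ln (n i)"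
      using mult_right_mono[of "ln x" "ln (n i)" "w i"] w0[of i] i by (simp add: mult.commute)
  qed
  have VJ: "0 \<le> (\<Sum>i\<in>?J. w i * ln (n i))"
    using w0 n1 by (intro sum_nonneg mult_nonneg_nonneg) auto
  have VJV: "(\<Sum>i\<in>?J. w i * ln (n i)) \<le> V"
    using RL R0 L0 by (smt (verit) mult_nonneg_nonneg)
  have eq: "(\<Sum>i\<in>?J. w i * f (x / n i)) - W * b * (ln x)\<^sup>2
      = (\<Sum>i\<in>?J. w i * (f (x / n i) - b * (ln x)\<^sup>2)) - (W - sum w ?J) * b * (ln x)\<^sup>2"
    by (simp add: right_diff_distrib sum_subtractf left_diff_distrib sum_distrib_right mult.assoc)
  have "\<bar>\<Sum>i\<in>?J. w i * (f (x / n i) - b * (ln x)\<^sup>2)\<bar> \<le> (\<Sum>i\<in>?J. w i * B + 2 * \<bar>b\<bar> * ln x * (w i * ln (n i)))"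
  proof (rule order_trans[OF sum_abs sum_mono])
    fix i assume i: "i \<in> ?J"
    have l: "0 \<le> ln (n i)" "ln (n i) \<le> ln x" using n1[of i] i x by auto
    have lx: "ln (x / n i) = ln x - ln (n i)" using n1[of i] i x by (simp add: ln_div)
    have "(ln x)\<^sup>2 - (ln x - ln (n i))\<^sup>2 = ln (n i) * (2 * ln x - ln (n i))"
      by (simp add: power2_eq_square algebra_simps)
    moreover have "0 \<le> ln (n i) * (2 * ln x - ln (n i))" using l by (intro mult_nonneg_nonneg) auto
    moreover have "ln (n i) * (2 * ln x - ln (n i)) \<le> ln (n i) * (2 * ln x)" using l by (intro mult_left_mono) auto
    ultimately have sq: "\<bar>(ln (x / n i))\<^sup>2 - (ln x)\<^sup>2\<bar> \<le> 2 * ln x * ln (n i)" unfolding lx by (simp add: abs_if mult_ac)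
    have "\<bar>b * ((ln (x / n i))\<^sup>2 - (ln x)\<^sup>2)\<bar> \<le> \<bar>b\<bar> * (2 * ln x * ln (n i))"
      unfolding abs_mult using sq by (intro mult_left_mono) auto
    moreover have "\<bar>f (x / n i) - b * (ln (x / n i))\<^sup>2\<bar> \<le> B" using f i by auto
    ultimately have "\<bar>f (x / n i) - b * (ln x)\<^sup>2\<bar> \<le> B + \<bar>b\<bar> * (2 * ln x * ln (n i))"
      unfolding right_diff_distrib by linarith
    then have "w i * \<bar>f (x / n i) - b * (ln x)\<^sup>2\<bar> \<le> w i * (B + \<bar>b\<bar> * (2 * ln x * ln (n i)))"
      using w0[of i] i by (intro mult_left_mono) auto
    moreover have "\<bar>w i * (f (x / n i) - b * (ln x)\<^sup>2)\<bar> = w i * \<bar>f (x / n i) - b * (ln x)\<^sup>2\<bar>"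
      using w0[of i] i by (simp only: abs_mult) simp
    ultimately show "\<bar>w i * (f (x / n i) - b * (ln x)\<^sup>2)\<bar> \<le> w i * B + 2 * \<bar>b\<bar> * ln x * (w i * ln (n i))"
      by (simp add: algebra_simps)
  qed
  also have "\<dots> = sum w ?J * B + 2 * \<bar>b\<bar> * ln x * (\<Sum>i\<in>?J. w i * ln (n i))"
    by (simp add: sum.distrib sum_distrib_left sum_distrib_right)
  also have "\<dots> \<le> W * B + 2 * \<bar>b\<bar> * ln x * V"
    using R0 B L0 VJV by (intro add_mono mult_right_mono mult_left_mono) auto
  finally have 1: "\<bar>\<Sum>i\<in>?J. w i * (f (x / n i) - b * (ln x)\<^sup>2)\<bar> \<le> W * B + 2 * \<bar>b\<bar> * ln x * V" .
  have "(W - sum w ?J) * ln x \<le> V" using RL VJ by (simp add: mult.commute)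
  then have "(W - sum w ?J) * ln x * (\<bar>b\<bar> * ln x) \<le> V * (\<bar>b\<bar> * ln x)"
    using L0 by (intro mult_right_mono) auto
  then have 2: "\<bar>(W - sum w ?J) * b * (ln x)\<^sup>2\<bar> \<le> \<bar>b\<bar> * ln x * V"
    using R0 by (simp add: abs_mult power2_eq_square mult_ac)
  show ?thesis unfolding eq using 1 2 by (simp add: algebra_simps)
qed

text \<open>
  The function \<open>P\<close> is recovered from its sum with weighted averages of itself at smaller
  arguments. Since the weights have sum \<open>D < 1\<close>, a bound \<open>K * (1 + ln x)\<close> for the error
  reproduces itself by induction over dyadic ranges of \<open>x\<close>.
\<close>

lemma log_square_renewal:
  fixes w n :: "'a \<Rightarrow> real" and P :: "real \<Rightarrow> real"
  assumes w0: "\<And>i. i \<in> I \<Longrightarrow> w i \<ge> 0" and n2: "\<And>i. i \<in> I \<Longrightarrow> n i \<ge> 2"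
    and fin: "\<And>x. finite {i \<in> I. n i \<le> x}"
    and D: "(w has_sum D) I" "D < 1" and V: "((\<lambda>i. w i * ln (n i)) has_sum V) I"
    and L: "\<And>x. x \<ge> 1 \<Longrightarrow>
      \<bar>P x + (\<Sum>i | i \<in> I \<and> n i \<le> x. w i * P (x / n i)) - (1 + D) * b * (ln x)\<^sup>2\<bar> \<le> C * (1 + ln x)"
  obtains K where "K \<ge> 0" "\<And>x. x \<ge> 1 \<Longrightarrow> \<bar>P x - b * (ln x)\<^sup>2\<bar> \<le> K * (1 + ln x)"
proof -
  (* The fixed point of K = C + 3 * b * V + D * K, the inequality that the induction step needs. *)
  define K where "K = (\<bar>C\<bar> + 3 * \<bar>b\<bar> * V) / (1 - D)"
  have D0: "D \<ge> 0" using D(1) by (rule has_sum_nonneg) (use w0 in auto)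
  have V0: "V \<ge> 0" using V
  proof (rule has_sum_nonneg)
    fix i assume "i \<in> I"
    then show "0 \<le> w i * ln (n i)" using w0[of i] n2[of i] by simp
  qed
  have K0: "K \<ge> 0" using V0 D by (simp add: K_def)
  have Keq: "\<bar>C\<bar> + 3 * \<bar>b\<bar> * V + D * K = K" using D(2) by (simp add: K_def field_simps)
  have "\<bar>P x - b * (ln x)\<^sup>2\<bar> \<le> K * (1 + ln x)" if "x \<ge> 1" "x < 2 ^ k" for x and k :: nat
    using that
  proof (induction k arbitrary: x)
    case 0 then show ?case by simp
  next
    case (Suc k)
    have L0: "ln x \<ge> 0" using Suc.prems by simp
    have "\<bar>(\<Sum>i | i \<in> I \<and> n i \<le> x. w i * P (x / n i)) - D * b * (ln x)\<^sup>2\<bar>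
        \<le> D * (K * (1 + ln x)) + 3 * \<bar>b\<bar> * V * ln x"
    proof (rule weighted_log_square_bound[OF w0 _ fin D(1) V])
      show "1 \<le> n i" if "i \<in> I" for i using n2[OF that] by simp
      show "0 \<le> K * (1 + ln x)" using K0 L0 by simp
      fix i assume i: "i \<in> I" "n i \<le> x"
      have ni: "n i \<ge> 2" using n2 i by blast
      have "x / n i \<le> x / 2" using ni Suc.prems by (intro divide_left_mono) auto
      moreover have "x / 2 < 2 ^ k" using Suc.prems by simp
      ultimately have "x / n i < 2 ^ k" by linarith
      moreover have "x / n i \<ge> 1" using i ni by simp
      ultimately have "\<bar>P (x / n i) - b * (ln (x / n i))\<^sup>2\<bar> \<le> K * (1 + ln (x / n i))" by (intro Suc.IH)
      also have "ln (x / n i) \<le> ln x" using ni Suc.prems by (simp add: ln_div)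
      finally show "\<bar>P (x / n i) - b * (ln (x / n i))\<^sup>2\<bar> \<le> K * (1 + ln x)" using K0
        by (simp add: mult_left_mono)
    qed (use Suc.prems in auto)
    moreover have "C * (1 + ln x) \<le> \<bar>C\<bar> * (1 + ln x)" using L0 by (intro mult_right_mono) auto
    moreover have "3 * \<bar>b\<bar> * V * ln x \<le> 3 * \<bar>b\<bar> * V * (1 + ln x)" using V0 by (intro mult_left_mono) auto
    moreover have "(1 + D) * b * (ln x)\<^sup>2 = b * (ln x)\<^sup>2 + D * b * (ln x)\<^sup>2" by (simp add: algebra_simps)
    ultimately have "\<bar>P x - b * (ln x)\<^sup>2\<bar> \<le> \<bar>C\<bar> * (1 + ln x) + D * (K * (1 + ln x)) + 3 * \<bar>b\<bar> * V * (1 + ln x)"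
      using L[OF Suc.prems(1)] by linarith
    also have "\<dots> = (\<bar>C\<bar> + 3 * \<bar>b\<bar> * V + D * K) * (1 + ln x)" by (simp add: algebra_simps)
    finally show ?case unfolding Keq .
  qed
  moreover have "\<exists>k. x < 2 ^ k" for x :: real
    using real_arch_pow[of 2 x] by simp
  ultimately show ?thesis using that[OF K0] by blast
qed

lemma sum_even_gball:
  "(\<Sum>z | z \<in> gball x \<and> glam dvd z. f z) = (\<Sum>z\<in>gball (x / 2). f (glam * z))"
proof -
  have "{z. z \<in> gball x \<and> glam dvd z} = (*) glam ` gball (x / 2)"
    by (auto simp: gball_def gnorm_mult gnorm_glam elim!: dvdE simp del: gauss_sel)
  then show ?thesis by (simp add: sum.reindex inj_on_def)
qed

definition odd_harm :: "real \<Rightarrow> real"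
  where "odd_harm x = (\<Sum>z\<in>oball x. 1 / rnorm z)"

text \<open>
  The even elements are \<open>1 + i\<close> times all elements, so that their part of the sum is half
  of the full sum at \<open>x / 2\<close>.
\<close>

lemma odd_harm_bound:
  assumes x: "x \<ge> 1" shows "\<bar>odd_harm x - pi / 2 * ln x\<bar> \<le> 20"
proof -
  have split: "(\<Sum>z\<in>gball x. 1 / rnorm z) = odd_harm x + (\<Sum>z\<in>gball (x / 2). 1 / rnorm z) / 2"
  proof -
    define E where "E = {z. z \<in> gball x \<and> glam dvd z}"
    have "gball x = oball x \<union> E" by (auto simp: oball_def E_def)
    moreover have "finite E" "oball x \<inter> E = {}" by (auto simp: oball_def E_def)
    ultimately have "(\<Sum>z\<in>gball x. 1 / rnorm z) = (\<Sum>z\<in>oball x. 1 / rnorm z) + (\<Sum>z\<in>E. 1 / rnorm z)"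
      by (simp only: sum.union_disjoint finite_oball)
    then have "(\<Sum>z\<in>gball x. 1 / rnorm z) = odd_harm x + (\<Sum>z | z \<in> gball x \<and> glam dvd z. 1 / rnorm z)"
      by (simp only: odd_harm_def E_def)
    also have "(\<Sum>z | z \<in> gball x \<and> glam dvd z. 1 / rnorm z) = (\<Sum>z\<in>gball (x / 2). 1 / rnorm z) / 2"
      unfolding sum_even_gball by (simp add: gnorm_mult gnorm_glam sum_divide_distrib mult.commute)
    finally show ?thesis .
  qed
  have p2: "0 \<le> pi / 2 * ln 2" "pi / 2 * ln 2 \<le> 2"
  proof -
    have "pi / 2 * ln 2 \<le> 2 * 1" using pi_less_4 ln_2_less_1 by (intro mult_mono) auto
    then show "pi / 2 * ln 2 \<le> 2" by simp
  qed simp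
  have g: "\<bar>(\<Sum>z\<in>gball x. 1 / rnorm z) - pi * ln x\<bar> \<le> 12" by (rule gauss_log_average[OF x])
  show ?thesis
  proof (cases "x \<ge> 2")
    case True
    then have "\<bar>(\<Sum>z\<in>gball (x / 2). 1 / rnorm z) - pi * ln (x / 2)\<bar> \<le> 12"
      by (intro gauss_log_average) simp
    moreover have "pi * ln (x / 2) = pi * ln x - 2 * (pi / 2 * ln 2)" using x by (simp add: ln_div algebra_simps)
    moreover have "pi * ln x = 2 * (pi / 2 * ln x)" by simp
    ultimately show ?thesis using g p2 unfolding split by linarith
  next
    case False
    then have "gball (x / 2) = {}" by (intro gball_empty) simp
    then have "odd_harm x = (\<Sum>z\<in>gball x. 1 / rnorm z)" unfolding split by simp
    moreover have "pi / 2 * ln x \<le> pi / 2 * ln 2" "0 \<le> pi / 2 * ln x"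
      using x False by (intro mult_left_mono mult_nonneg_nonneg; simp)+
    moreover have "pi * ln x = 2 * (pi / 2 * ln x)" by simp
    ultimately show ?thesis using g p2 by linarith
  qed
qed

text \<open>
  The logarithm \<open>ln (x / N)\<close> is, up to an error less than 1, the number of integers
  \<open>m \<ge> 1\<close> with \<open>N \<le> x / exp m\<close>. Exchanging the summations leaves \<open>odd_harm\<close> at the points
  \<open>x / exp m\<close>, and an arithmetic progression to be summed.
\<close>

lemma odd_log_weighted:
  assumes x: "x \<ge> 1"
  shows "\<bar>(\<Sum>a\<in>oball x. 1 / rnorm a * ln (x / rnorm a)) - pi / 4 * (ln x)\<^sup>2\<bar> \<le> 50 * (1 + ln x)"
proof -
  define n where "n = nat \<lfloor>ln x\<rfloor>"
  have L0: "ln x \<ge> 0" using x by simp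
  have n: "real n \<le> ln x" "ln x < real n + 1" unfolding n_def using L0 by linarith+
  have xe: "x / exp (real m) \<ge> 1" if "m \<in> {1..n}" for m
  proof -
    have "exp (real m) \<le> exp (ln x)" using n that by simp
    then show ?thesis using x by simp
  qed
  have floor_eq: "(\<Sum>a\<in>oball x. 1 / rnorm a * of_int \<lfloor>ln (x / rnorm a)\<rfloor>) = (\<Sum>m = 1..n. odd_harm (x / exp (real m)))"
  proof -
    have "(\<Sum>a\<in>oball x. 1 / rnorm a * of_int \<lfloor>ln (x / rnorm a)\<rfloor>)
        = (\<Sum>a\<in>oball x. \<Sum>m | m \<in> {1..n} \<and> rnorm a \<le> x / exp (real m). 1 / rnorm a)"
    proof (rule sum.cong[OF refl])
      fix a assume a: "a \<in> oball x"
      have a0: "a \<noteq> 0" using oball_neq_0[OF a] .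
      have a1: "rnorm a \<ge> 1" "rnorm a \<le> x" using rnorm_ge_1[OF a0] oball_rnorm_le[OF a] .
      have lr: "0 \<le> ln (x / rnorm a)" "ln (x / rnorm a) \<le> ln x" using a1 x by (auto simp: ln_div)
      have xr: "x / rnorm a > 0" using a0 x by simp
      have le: "rnorm a \<le> x / exp (real m) \<longleftrightarrow> real m \<le> ln (x / rnorm a)" for m
      proof -
        have "rnorm a \<le> x / exp (real m) \<longleftrightarrow> exp (real m) \<le> x / rnorm a" using a0 by (simp add: field_simps)
        also have "\<dots> \<longleftrightarrow> real m \<le> ln (x / rnorm a)" using xr by (simp only: ln_ge_iff)
        finally show ?thesis .
      qed
      have "{m. m \<in> {1..n} \<and> rnorm a \<le> x / exp (real m)} = {1..nat \<lfloor>ln (x / rnorm a)\<rfloor>}"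
        unfolding le using n lr by (auto simp: le_nat_floor le_floor_iff nat_le_iff) linarith+
      then show "1 / rnorm a * of_int \<lfloor>ln (x / rnorm a)\<rfloor> = (\<Sum>m | m \<in> {1..n} \<and> rnorm a \<le> x / exp (real m). 1 / rnorm a)"
        using lr by simp
    qed
    also have "\<dots> = (\<Sum>m = 1..n. \<Sum>a | a \<in> oball x \<and> rnorm a \<le> x / exp (real m). 1 / rnorm a)"
      by (rule sum.swap_restrict) auto
    also have "\<dots> = (\<Sum>m = 1..n. odd_harm (x / exp (real m)))"
    proof (rule sum.cong[OF refl])
      fix m :: nat
      have "x / exp (real m) \<le> x" using x by (simp add: field_simps)
      then have "{a. a \<in> oball x \<and> rnorm a \<le> x / exp (real m)} = oball (x / exp (real m))"
        by (auto simp: oball_def gball_def)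
      then show "(\<Sum>a | a \<in> oball x \<and> rnorm a \<le> x / exp (real m). 1 / rnorm a) = odd_harm (x / exp (real m))"
        by (simp add: odd_harm_def)
    qed
    finally show ?thesis .
  qed
  have "\<bar>(\<Sum>m = 1..n. odd_harm (x / exp (real m))) - (\<Sum>m = 1..n. pi / 2 * (ln x - real m))\<bar> \<le> (\<Sum>m = 1..n. 20)"
    unfolding sum_subtractf[symmetric]
  proof (rule order_trans[OF sum_abs sum_mono])
    fix m assume m: "m \<in> {1..n}"
    have "ln (x / exp (real m)) = ln x - real m" using x by (simp add: ln_div)
    then show "\<bar>odd_harm (x / exp (real m)) - pi / 2 * (ln x - real m)\<bar> \<le> 20"
      using odd_harm_bound[OF xe[OF m]] by simp
  qed
  also have "\<dots> \<le> 20 * ln x" using n by simp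
  finally have 1: "\<bar>(\<Sum>m = 1..n. odd_harm (x / exp (real m))) - (\<Sum>m = 1..n. pi / 2 * (ln x - real m))\<bar> \<le> 20 * ln x" .
  have gs: "(\<Sum>m = 1..n. real m) = real n * (real n + 1) / 2"
    by (induction n) (auto simp: field_simps)
  have "(\<Sum>m = 1..n. pi / 2 * (ln x - real m)) = pi / 2 * (real n * ln x - real n * (real n + 1) / 2)"
    unfolding sum_distrib_left[symmetric] sum_subtractf gs by simp
  (* Completing the square isolates the main term; ln x - n is a fractional part. *)
  also have "\<dots> = pi / 4 * (ln x)\<^sup>2 - pi / 4 * ((ln x - real n)\<^sup>2 + real n)"
    by (simp add: power2_eq_square field_simps)
  finally have s: "(\<Sum>m = 1..n. pi / 2 * (ln x - real m)) = pi / 4 * (ln x)\<^sup>2 - pi / 4 * ((ln x - real n)\<^sup>2 + real n)" .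
  have "(ln x - real n)\<^sup>2 \<le> 1" using n by (simp add: abs_square_le_1)
  then have "(ln x - real n)\<^sup>2 + real n \<le> 1 + ln x" using n by linarith
  then have "pi / 4 * ((ln x - real n)\<^sup>2 + real n) \<le> 1 * (1 + ln x)"
    using pi_less_4 by (intro mult_mono) auto
  moreover have "0 \<le> pi / 4 * ((ln x - real n)\<^sup>2 + real n)" by simp
  ultimately have 2: "\<bar>(\<Sum>m = 1..n. pi / 2 * (ln x - real m)) - pi / 4 * (ln x)\<^sup>2\<bar> \<le> 1 + ln x" unfolding s by simp
  have "\<bar>(\<Sum>a\<in>oball x. 1 / rnorm a * ln (x / rnorm a)) - (\<Sum>a\<in>oball x. 1 / rnorm a * of_int \<lfloor>ln (x / rnorm a)\<rfloor>)\<bar>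
      \<le> (\<Sum>a\<in>oball x. 1 / rnorm a)"
    unfolding sum_subtractf[symmetric]
  proof (rule order_trans[OF sum_abs sum_mono])
    fix a assume "a \<in> oball x"
    have "\<bar>1 / rnorm a * (ln (x / rnorm a) - of_int \<lfloor>ln (x / rnorm a)\<rfloor>)\<bar> \<le> 1 / rnorm a * 1"
      unfolding abs_mult by (intro mult_mono) (auto, linarith)
    then show "\<bar>1 / rnorm a * ln (x / rnorm a) - 1 / rnorm a * of_int \<lfloor>ln (x / rnorm a)\<rfloor>\<bar> \<le> 1 / rnorm a"
      by (simp add: right_diff_distrib)
  qed
  also have "\<dots> \<le> 20 + 2 * ln x"
  proof -
    have "pi / 2 * ln x \<le> 2 * ln x" using L0 pi_less_4 by (intro mult_right_mono) auto
    then show ?thesis using odd_harm_bound[OF x] unfolding odd_harm_def by linarith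
  qed
  finally show ?thesis using 1 2 L0 unfolding floor_eq by (simp add: algebra_simps)
qed

definition odd_pairs :: "real \<Rightarrow> (gauss \<times> gauss) set"
  where "odd_pairs x = {(a, b). \<not> glam dvd a \<and> \<not> glam dvd b \<and> rnorm a * rnorm b \<le> x}"

lemma odd_pairs_eq: "odd_pairs x = Sigma (oball x) (\<lambda>a. oball (x / rnorm a))"
proof (intro equalityI subsetI)
  fix p assume "p \<in> odd_pairs x"
  then obtain a b where p: "p = (a, b)" "\<not> glam dvd a" "\<not> glam dvd b" "rnorm a * rnorm b \<le> x"
    by (auto simp: odd_pairs_def)
  have nz: "a \<noteq> 0" "b \<noteq> 0" using p by auto
  then have r: "rnorm a \<ge> 1" "rnorm b \<ge> 1" using rnorm_ge_1 by blast+
  then have "rnorm a * 1 \<le> rnorm a * rnorm b" by (intro mult_left_mono) auto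
  then have "rnorm a \<le> x" using p by simp
  moreover have "rnorm b \<le> x / rnorm a" using p(4) nz by (simp add: field_simps)
  ultimately show "p \<in> Sigma (oball x) (\<lambda>a. oball (x / rnorm a))"
    using p nz by (simp add: oball_def gball_def)
next
  fix p assume p: "p \<in> Sigma (oball x) (\<lambda>a. oball (x / rnorm a))"
  then obtain a b where ab: "p = (a, b)" "a \<in> oball x" "b \<in> oball (x / rnorm a)" by auto
  then have "a \<noteq> 0" using oball_neq_0 by blast
  then show "p \<in> odd_pairs x" using ab by (simp add: odd_pairs_def oball_def gball_def field_simps)
qed

lemma finite_odd_pairs [simp]: "finite (odd_pairs x)"
  unfolding odd_pairs_eq by auto

lemma odd_pairs_neq_0: "(a, b) \<in> odd_pairs x \<Longrightarrow> a \<noteq> 0 \<and> b \<noteq> 0"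
  by (auto simp: odd_pairs_def)

abbreviation pair_weight :: "gauss \<times> gauss \<Rightarrow> real"
  where "pair_weight p \<equiv> 1 / (rnorm (fst p) * rnorm (snd p))"

text \<open>
  Dirichlet's hyperbola sum: the inner sum over \<open>b\<close> is \<open>odd_harm (x / N(a))\<close>.
\<close>

lemma odd_pairs_sum_bound:
  assumes x: "x \<ge> 1"
  shows "\<bar>(\<Sum>p\<in>odd_pairs x. pair_weight p) - pi\<^sup>2 / 8 * (ln x)\<^sup>2\<bar> \<le> 600 * (1 + ln x)"
proof -
  have L0: "ln x \<ge> 0" using x by simp
  have e: "(\<Sum>p\<in>odd_pairs x. pair_weight p) = (\<Sum>a\<in>oball x. 1 / rnorm a * odd_harm (x / rnorm a))"
    using sum.Sigma[of "oball x" "\<lambda>a. oball (x / rnorm a)" "\<lambda>a b. 1 / (rnorm a * rnorm b)"]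
    unfolding odd_pairs_eq odd_harm_def by (simp add: sum_distrib_left case_prod_unfold)
  have "\<bar>(\<Sum>a\<in>oball x. 1 / rnorm a * odd_harm (x / rnorm a)) - pi / 2 * (\<Sum>a\<in>oball x. 1 / rnorm a * ln (x / rnorm a))\<bar>
      \<le> (\<Sum>a\<in>oball x. 20 * (1 / rnorm a))"
    unfolding sum_distrib_left sum_subtractf[symmetric]
  proof (rule order_trans[OF sum_abs sum_mono])
    fix a assume a: "a \<in> oball x"
    have a1: "rnorm a \<ge> 1" "rnorm a \<le> x" using rnorm_ge_1 oball_neq_0 oball_rnorm_le a by blast+
    then have "1 \<le> x / rnorm a" by (subst le_divide_eq_1_pos) linarith+
    then have "\<bar>odd_harm (x / rnorm a) - pi / 2 * ln (x / rnorm a)\<bar> \<le> 20" by (rule odd_harm_bound)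
    then have "\<bar>1 / rnorm a * (odd_harm (x / rnorm a) - pi / 2 * ln (x / rnorm a))\<bar> \<le> 1 / rnorm a * 20"
      unfolding abs_mult using a1 by (intro mult_mono) auto
    then show "\<bar>1 / rnorm a * odd_harm (x / rnorm a) - pi / 2 * (1 / rnorm a * ln (x / rnorm a))\<bar> \<le> 20 * (1 / rnorm a)"
      by (simp add: right_diff_distrib mult_ac)
  qed
  also have "\<dots> = 20 * odd_harm x" by (simp add: odd_harm_def sum_distrib_left)
  also have "\<dots> \<le> 20 * (20 + 2 * ln x)"
  proof -
    have "pi / 2 * ln x \<le> 2 * ln x" using L0 pi_less_4 by (intro mult_right_mono) auto
    then have "odd_harm x \<le> 20 + 2 * ln x" using odd_harm_bound[OF x] by linarith
    then show ?thesis by simp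
  qed
  finally have 1: "\<bar>(\<Sum>p\<in>odd_pairs x. pair_weight p) - pi / 2 * (\<Sum>a\<in>oball x. 1 / rnorm a * ln (x / rnorm a))\<bar>
      \<le> 20 * (20 + 2 * ln x)" unfolding e .
  have "\<bar>pi / 2 * ((\<Sum>a\<in>oball x. 1 / rnorm a * ln (x / rnorm a)) - pi / 4 * (ln x)\<^sup>2)\<bar> \<le> 2 * (50 * (1 + ln x))"
    unfolding abs_mult using odd_log_weighted[OF x] pi_less_4 L0 by (intro mult_mono) auto
  then have "\<bar>pi / 2 * (\<Sum>a\<in>oball x. 1 / rnorm a * ln (x / rnorm a)) - pi\<^sup>2 / 8 * (ln x)\<^sup>2\<bar> \<le> 2 * (50 * (1 + ln x))"
    by (simp add: right_diff_distrib power2_eq_square mult_ac)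
  then show ?thesis using 1 L0 by (simp add: algebra_simps)
qed

section \<open>The average number of square roots of one\<close>

definition cop_pairs :: "real \<Rightarrow> (gauss \<times> gauss) set"
  where "cop_pairs x = {p \<in> odd_pairs x. comax (fst p) (snd p)}"

definition cop_sum :: "real \<Rightarrow> real"
  where "cop_sum x = (\<Sum>p\<in>cop_pairs x. pair_weight p)"

lemma finite_cop_pairs [simp]: "finite (cop_pairs x)"
  by (simp add: cop_pairs_def)

text \<open>
  A greatest common divisor is unique up to one of the four units.
\<close>

lemma card_gcd_fiber:
  assumes A: "A \<noteq> 0"
  shows "card {(g, a, b). g * a = A \<and> g * b = B \<and> comax a b} = 4"
proof -
  obtain g u v where g: "g dvd A" "g dvd B" "g = u * A + v * B" by (rule gauss_bezout)
  obtain a0 where a0: "A = g * a0" using g(1) by (elim dvdE)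
  obtain b0 where b0: "B = g * b0" using g(2) by (elim dvdE)
  have g0: "g \<noteq> 0" "a0 \<noteq> 0" using a0 A by auto
  have "g * 1 = g * (u * a0 + v * b0)" using g(3) unfolding a0 b0 by (simp add: algebra_simps)
  then have uv: "u * a0 + v * b0 = 1" using g0 by (simp only: mult_cancel_left) auto
  let ?f = "\<lambda>e. (g * e, gcnj e * a0, gcnj e * b0)"
  have "{(g, a, b). g * a = A \<and> g * b = B \<and> comax a b} = ?f ` {e. gnorm e = 1}"
  proof (intro equalityI subsetI)
    fix t assume "t \<in> {(g, a, b). g * a = A \<and> g * b = B \<and> comax a b}"
    then obtain h a b where t: "t = (h, a, b)" "h * a = A" "h * b = B" "comax a b" by auto
    have "h dvd g" unfolding g(3) using t(2,3) by (intro dvd_add dvd_mult) (auto intro: dvdI[OF sym])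
    then obtain k where k: "g = h * k" by (elim dvdE)
    have h0: "h \<noteq> 0" using k g0 by auto
    have "h * a = h * (k * a0)" "h * b = h * (k * b0)" using t(2,3) a0 b0 k by (simp_all add: mult.assoc)
    then have ab: "a = k * a0" "b = k * b0" using h0 by simp_all
    have "k dvd 1" using comax_unit_dvd[OF t(4), of k] ab by simp
    then have k1: "gnorm k = 1" unfolding gauss_unit_iff .
    have "g * gcnj k = h * (k * gcnj k)" using k by (simp add: mult.assoc)
    then have "h = g * gcnj k" using gauss_unit_mult_gcnj(1)[OF k1] by simp
    moreover have "gcnj (gcnj k) = k" by (simp add: gauss_eq_iff)
    ultimately have "t = ?f (gcnj k)" using t(1) ab by simp
    moreover have "gcnj k \<in> {e. gnorm e = 1}" using k1 by simp
    ultimately show "t \<in> ?f ` {e. gnorm e = 1}" by blast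
  next
    fix t assume "t \<in> ?f ` {e. gnorm e = 1}"
    then obtain e where e: "t = ?f e" "gnorm e = 1" by blast
    note u1 = gauss_unit_mult_gcnj(1)[OF e(2)]
    have "(g * e) * (gcnj e * a0) = (e * gcnj e) * (g * a0)" "(g * e) * (gcnj e * b0) = (e * gcnj e) * (g * b0)"
      by (simp_all only: mult_ac)
    then have 1: "(g * e) * (gcnj e * a0) = A" "(g * e) * (gcnj e * b0) = B" using u1 a0 b0 by simp_all
    have "(u * e) * (gcnj e * a0) + (v * e) * (gcnj e * b0) = (e * gcnj e) * (u * a0 + v * b0)"
      by (simp only: algebra_simps)
    then have "comax (gcnj e * a0) (gcnj e * b0)" unfolding comax_def using u1 uv by (metis mult.left_neutral)
    then show "t \<in> {(g, a, b). g * a = A \<and> g * b = B \<and> comax a b}" using e 1 by simp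
  qed
  moreover have "inj_on ?f {e. gnorm e = 1}" using g0 by (auto simp: inj_on_def)
  ultimately show ?thesis using card_units_gauss by (simp add: card_image)
qed

lemma odd_square_ball_finite: "finite {g. \<not> glam dvd g \<and> (rnorm g)\<^sup>2 \<le> x}"
proof (rule finite_subset)
  show "{g. \<not> glam dvd g \<and> (rnorm g)\<^sup>2 \<le> x} \<subseteq> gball x"
  proof
    fix g assume g: "g \<in> {g. \<not> glam dvd g \<and> (rnorm g)\<^sup>2 \<le> x}"
    then have "g \<noteq> 0" by auto
    then have "rnorm g \<le> (rnorm g)\<^sup>2" by (rule self_le_power[OF rnorm_ge_1 pos2])
    also have "\<dots> \<le> x" using g by simp
    finally show "g \<in> gball x" using \<open>g \<noteq> 0\<close> by (simp add: gball_def)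
  qed
qed simp

text \<open>
  Pairs are sorted by their greatest common divisor, each pair being counted once for
  every associate of it.
\<close>

lemma odd_pairs_by_gcd:
  "4 * (\<Sum>p\<in>odd_pairs x. pair_weight p)
    = (\<Sum>g | \<not> glam dvd g \<and> (rnorm g)\<^sup>2 \<le> x. 1 / (rnorm g)\<^sup>2 * cop_sum (x / (rnorm g)\<^sup>2))"
proof -
  define G where "G = {g. \<not> glam dvd g \<and> (rnorm g)\<^sup>2 \<le> x}"
  define T where "T = Sigma G (\<lambda>g. cop_pairs (x / (rnorm g)\<^sup>2))"
  define phi where "phi = (\<lambda>(g :: gauss, a, b). (g * a, g * b))"
  have finT: "finite T" unfolding T_def G_def using odd_square_ball_finite by auto
  have mem: "(g, a, b) \<in> T \<longleftrightarrow> (g * a, g * b) \<in> odd_pairs x \<and> comax a b" for g a b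
  proof
    assume t: "(g, a, b) \<in> T"
    then have "g \<noteq> 0" by (auto simp: T_def G_def)
    then show "(g * a, g * b) \<in> odd_pairs x \<and> comax a b" using t
      by (auto simp: T_def G_def cop_pairs_def odd_pairs_def glam_dvd_mult_iff gnorm_mult field_simps power2_eq_square)
  next
    assume t: "(g * a, g * b) \<in> odd_pairs x \<and> comax a b"
    then have nz: "g \<noteq> 0" "a \<noteq> 0" "b \<noteq> 0" using odd_pairs_neq_0 by fastforce+
    have le: "rnorm g * rnorm g * (rnorm a * rnorm b) \<le> x"
      using t by (auto simp: odd_pairs_def gnorm_mult mult_ac)
    have "1 * 1 \<le> rnorm a * rnorm b" using rnorm_ge_1 nz by (intro mult_mono) auto
    then have "rnorm g * rnorm g * 1 \<le> rnorm g * rnorm g * (rnorm a * rnorm b)"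
      by (intro mult_left_mono) auto
    then have "(rnorm g)\<^sup>2 \<le> x" using le by (simp add: power2_eq_square)
    moreover have "rnorm a * rnorm b \<le> x / (rnorm g)\<^sup>2" using le nz by (simp add: field_simps power2_eq_square)
    ultimately show "(g, a, b) \<in> T"
      using t by (auto simp: T_def G_def cop_pairs_def odd_pairs_def glam_dvd_mult_iff)
  qed
  have sub: "phi ` T \<subseteq> odd_pairs x" using mem by (auto simp: phi_def)
  have s1: "(\<Sum>y\<in>odd_pairs x. \<Sum>t | t \<in> T \<and> phi t = y. pair_weight (phi t)) = (\<Sum>t\<in>T. pair_weight (phi t))"
    by (rule sum.group[OF finT finite_odd_pairs sub])
  have s2: "(\<Sum>t | t \<in> T \<and> phi t = y. pair_weight (phi t)) = 4 * pair_weight y" if y: "y \<in> odd_pairs x" for y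
  proof -
    obtain A B where AB: "y = (A, B)" by (cases y)
    have "{t. t \<in> T \<and> phi t = y} = {(g, a, b). g * a = A \<and> g * b = B \<and> comax a b}"
      using mem y unfolding AB phi_def by auto
    then have "card {t. t \<in> T \<and> phi t = y} = 4"
      using card_gcd_fiber[of A B] odd_pairs_neq_0[of A B x] y AB by simp
    moreover have "(\<Sum>t | t \<in> T \<and> phi t = y. pair_weight (phi t)) = (\<Sum>t | t \<in> T \<and> phi t = y. pair_weight y)"
      by (intro sum.cong) auto
    ultimately show ?thesis by simp
  qed
  have s3: "(\<Sum>t\<in>T. pair_weight (phi t)) = (\<Sum>g\<in>G. 1 / (rnorm g)\<^sup>2 * cop_sum (x / (rnorm g)\<^sup>2))"
  proof -
    have "(\<Sum>t\<in>T. pair_weight (phi t)) = (\<Sum>(g, p)\<in>T. 1 / (rnorm g)\<^sup>2 * pair_weight p)"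
      by (intro sum.cong) (auto simp: phi_def gnorm_mult power2_eq_square)
    also have "\<dots> = (\<Sum>g\<in>G. \<Sum>p\<in>cop_pairs (x / (rnorm g)\<^sup>2). 1 / (rnorm g)\<^sup>2 * pair_weight p)"
      unfolding T_def by (rule sum.Sigma[symmetric]) (use odd_square_ball_finite in \<open>auto simp: G_def\<close>)
    finally show ?thesis by (simp add: cop_sum_def sum_distrib_left)
  qed
  have "4 * (\<Sum>p\<in>odd_pairs x. pair_weight p) = (\<Sum>y\<in>odd_pairs x. \<Sum>t | t \<in> T \<and> phi t = y. pair_weight (phi t))"
    unfolding sum_distrib_left by (rule sum.cong[OF refl]) (rule s2[symmetric])
  then show ?thesis unfolding s1 s3 G_def .
qed

definition odd_nonunits :: "gauss set"
  where "odd_nonunits = {g. \<not> glam dvd g \<and> gnorm g \<noteq> 1}"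

lemma odd_nonunits_rnorm: "g \<in> odd_nonunits \<Longrightarrow> (rnorm g)\<^sup>2 \<ge> 2"
proof -
  assume "g \<in> odd_nonunits"
  then have "g \<noteq> 0" "gnorm g \<noteq> 1" by (auto simp: odd_nonunits_def)
  then have "gnorm g \<ge> 2" using gnorm_ge_1_iff[of g] by simp
  then have "rnorm g \<ge> 2" by linarith
  then have "2 * 1 \<le> rnorm g * rnorm g" by (intro mult_mono) auto
  then show ?thesis by (simp add: power2_eq_square)
qed

text \<open>
  The four units among the common divisors together contribute \<open>cop_sum x\<close> itself.
\<close>

lemma odd_pairs_renewal:
  assumes x: "x \<ge> 1"
  shows "(\<Sum>p\<in>odd_pairs x. pair_weight p) = cop_sum x +
    (\<Sum>g | g \<in> odd_nonunits \<and> (rnorm g)\<^sup>2 \<le> x. (1 / (4 * (rnorm g)\<^sup>2)) * cop_sum (x / (rnorm g)\<^sup>2))"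
proof -
  define f where "f = (\<lambda>g. 1 / (rnorm g)\<^sup>2 * cop_sum (x / (rnorm g)\<^sup>2))"
  have odd_unit: "\<not> glam dvd g" if "gnorm g = 1" for g
    using that unfolding glam_dvd_iff by simp
  have "{g. \<not> glam dvd g \<and> (rnorm g)\<^sup>2 \<le> x} = {g. gnorm g = 1} \<union> {g. g \<in> odd_nonunits \<and> (rnorm g)\<^sup>2 \<le> x}"
    using odd_unit x by (auto simp: odd_nonunits_def)
  then have "(\<Sum>g | \<not> glam dvd g \<and> (rnorm g)\<^sup>2 \<le> x. f g)
      = (\<Sum>g | gnorm g = 1. f g) + (\<Sum>g | g \<in> odd_nonunits \<and> (rnorm g)\<^sup>2 \<le> x. f g)"
    using odd_square_ball_finite[of x]
    by (simp only:) (subst sum.union_disjoint, auto simp: odd_nonunits_def finite_gnorm_eq)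
  moreover have "(\<Sum>g | gnorm g = 1. f g) = 4 * cop_sum x"
    using card_units_gauss by (simp add: f_def)
  ultimately have "4 * (\<Sum>p\<in>odd_pairs x. pair_weight p) = 4 * cop_sum x + (\<Sum>g | g \<in> odd_nonunits \<and> (rnorm g)\<^sup>2 \<le> x. f g)"
    unfolding odd_pairs_by_gcd f_def by simp
  moreover have "(\<Sum>g | g \<in> odd_nonunits \<and> (rnorm g)\<^sup>2 \<le> x. f g)
      = 4 * (\<Sum>g | g \<in> odd_nonunits \<and> (rnorm g)\<^sup>2 \<le> x. (1 / (4 * (rnorm g)\<^sup>2)) * cop_sum (x / (rnorm g)\<^sup>2))"
    unfolding sum_distrib_left by (intro sum.cong) (auto simp: f_def)
  ultimately show ?thesis by simp
qed

lemma catalan_bounds: "catalan > 0" "catalan \<le> 1"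
proof -
  define a where "a = (\<lambda>k::nat. 1 / (2 * real k + 1)\<^sup>2)"
  have lim: "a \<longlonglongrightarrow> 0" unfolding a_def by real_asymp
  have mono: "a (Suc k) \<le> a k" and pos: "0 \<le> a k" for k
    by (auto simp: a_def intro!: divide_left_mono power_mono)
  note L = summable_Leibniz'[OF lim pos mono]
  have c: "(\<Sum>k. (-1) ^ k * a k) = catalan" by (simp add: a_def catalan_def)
  show "catalan \<le> 1" using L(4)[of 0] unfolding c by (simp add: a_def)
  have "1 - 1 / 9 \<le> catalan" using L(2)[of 1] unfolding c by (simp add: a_def numeral_2_eq_2 power2_eq_square)
  then show "catalan > 0" by simp
qed

text \<open>
  The Euler factor at \<open>1 + i\<close> removes a quarter of the lattice sum, and the four units
  contribute 1.
\<close>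

lemma odd_nonunits_weight_has_sum:
  "((\<lambda>g. 1 / (4 * (rnorm g)\<^sup>2)) has_sum (pi\<^sup>2 * catalan / 8 - 1)) odd_nonunits"
proof -
  let ?Z = "2 * pi\<^sup>2 / 3 * catalan"
  let ?E = "{z. glam dvd z} - {0}"
  have Z: "((\<lambda>z. 1 / (rnorm z)\<^sup>2) has_sum ?Z) (- {0})" by (rule zeta_lattice_has_sum)
  have "bij_betw ((*) glam) (- {0}) ?E"
    by (auto simp: bij_betw_def inj_on_def elim!: dvdE)
  then have "((\<lambda>z. 1 / (rnorm z)\<^sup>2) has_sum ?Z / 4) ?E \<longleftrightarrow> ((\<lambda>z. 1 / (rnorm (glam * z))\<^sup>2) has_sum ?Z / 4) (- {0})"
    by (rule has_sum_reindex_bij_betw[symmetric])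
  moreover have "((\<lambda>z. 1 / (rnorm (glam * z))\<^sup>2) has_sum ?Z / 4) (- {0})"
    using has_sum_cmult_right[OF Z, of "1/4"] by (simp add: gnorm_mult gnorm_glam power_mult_distrib del: gauss_sel)
  ultimately have "((\<lambda>z. 1 / (rnorm z)\<^sup>2) has_sum ?Z / 4) ?E" by blast
  then have O: "((\<lambda>z. 1 / (rnorm z)\<^sup>2) has_sum (?Z - ?Z / 4)) (- {0} - ?E)"
    by (intro has_sum_Diff[OF Z]) auto
  have U: "((\<lambda>z. 1 / (rnorm z)\<^sup>2) has_sum 4) {z. gnorm z = 1}"
    using card_units_gauss by (intro has_sum_finiteI) (auto simp: finite_gnorm_eq)
  have "{z. gnorm z = 1} \<subseteq> - {0} - ?E" by (auto simp: glam_dvd_iff)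
  then have "((\<lambda>z. 1 / (rnorm z)\<^sup>2) has_sum (?Z - ?Z / 4 - 4)) (- {0} - ?E - {z. gnorm z = 1})"
    by (rule has_sum_Diff[OF O U])
  moreover have "- {0} - ?E - {z. gnorm z = 1} = odd_nonunits" by (auto simp: odd_nonunits_def)
  ultimately have "((\<lambda>z. 1 / 4 * (1 / (rnorm z)\<^sup>2)) has_sum (1 / 4 * (?Z - ?Z / 4 - 4))) odd_nonunits"
    by (intro has_sum_cmult_right) simp
  moreover have "1 / 4 * (?Z - ?Z / 4 - 4) = pi\<^sup>2 * catalan / 8 - 1" by (simp add: field_simps)
  moreover have "1 / 4 * (1 / (rnorm z)\<^sup>2) = 1 / (4 * (rnorm z)\<^sup>2)" for z by simp
  ultimately show ?thesis by (simp only:)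
qed

text \<open>
  Since \<open>ln N \<le> 2 * N powr (1/2)\<close>, the terms are bounded by those of the lattice sum with
  exponent \<open>3/2\<close>.
\<close>

lemma odd_nonunits_log_summable:
  "(\<lambda>g. 1 / (4 * (rnorm g)\<^sup>2) * ln ((rnorm g)\<^sup>2)) summable_on odd_nonunits"
proof (rule summable_on_comparison_test)
  show "(\<lambda>z. rnorm z powr (-3/2)) summable_on odd_nonunits"
    by (rule summable_on_subset_banach[OF lattice_summable_three_halves]) (auto simp: odd_nonunits_def)
  fix g assume g: "g \<in> odd_nonunits"
  then have "g \<noteq> 0" by (auto simp: odd_nonunits_def)
  then have r: "rnorm g \<ge> 1" by (rule rnorm_ge_1)
  have pos: "rnorm g > 0" using r by linarith
  have "ln (rnorm g) = 2 * ln (sqrt (rnorm g))" using pos by (simp only: ln_sqrt)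
  also have "\<dots> \<le> 2 * (sqrt (rnorm g) - 1)" using pos by (intro mult_left_mono ln_le_minus_one) auto
  finally have l: "ln (rnorm g) \<le> 2 * rnorm g powr (1/2)" using pos by (simp add: powr_half_sqrt algebra_simps)
  have "1 / (4 * (rnorm g)\<^sup>2) * ln ((rnorm g)\<^sup>2) = 1 / (2 * (rnorm g)\<^sup>2) * ln (rnorm g)"
    using pos by (simp add: ln_realpow)
  also have "\<dots> \<le> 1 / (2 * (rnorm g)\<^sup>2) * (2 * rnorm g powr (1/2))" using l by (intro mult_left_mono) auto
  also have "\<dots> = rnorm g powr (1/2) / rnorm g powr 2" using pos by (simp only: powr_numeral) simp
  also have "\<dots> = rnorm g powr (1/2 - 2)" by (simp only: powr_diff)
  also have "(1/2 - 2 :: real) = -3/2" by simp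
  finally show "1 / (4 * (rnorm g)\<^sup>2) * ln ((rnorm g)\<^sup>2) \<le> rnorm g powr (-3/2)" .
  show "0 \<le> 1 / (4 * (rnorm g)\<^sup>2) * ln ((rnorm g)\<^sup>2)"
    using odd_nonunits_rnorm[OF g] by (intro mult_nonneg_nonneg ln_ge_zero) auto
qed

text \<open>
  The renewal argument applies because \<open>pi\<^sup>2 * catalan / 8 - 1 < 1\<close>, by \<open>pi < 4\<close> and
  \<open>catalan \<le> 1\<close>. The leading constant is \<open>(pi\<^sup>2 / 8) / (pi\<^sup>2 * catalan / 8)\<close>.
\<close>

lemma cop_sum_asymptotic:
  obtains K where "K \<ge> 0" "\<And>x. x \<ge> 1 \<Longrightarrow> \<bar>cop_sum x - 1 / catalan * (ln x)\<^sup>2\<bar> \<le> K * (1 + ln x)"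
proof -
  let ?D = "pi\<^sup>2 * catalan / 8 - 1"
  obtain V where V: "((\<lambda>g. 1 / (4 * (rnorm g)\<^sup>2) * ln ((rnorm g)\<^sup>2)) has_sum V) odd_nonunits"
    using odd_nonunits_log_summable by (auto simp: summable_on_def)
  have "pi * pi < 4 * 4" using pi_less_4 by (intro mult_strict_mono) auto
  then have "pi\<^sup>2 * catalan < 16 * 1" using catalan_bounds by (intro mult_less_le_imp_less) (auto simp: power2_eq_square)
  then have D1: "?D < 1" by simp
  show ?thesis
  proof (rule log_square_renewal[where I = odd_nonunits and w = "\<lambda>g. 1 / (4 * (rnorm g)\<^sup>2)" and n = "\<lambda>g. (rnorm g)\<^sup>2"
        and D = ?D and V = V and P = cop_sum and b = "1 / catalan" and C = 600])
    show "finite {i \<in> odd_nonunits. (rnorm i)\<^sup>2 \<le> x}" for x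
      by (rule finite_subset[OF _ odd_square_ball_finite[of x]]) (auto simp: odd_nonunits_def)
    fix x :: real assume x: "x \<ge> 1"
    have "(1 + ?D) * (1 / catalan) = pi\<^sup>2 / 8" using catalan_bounds by simp
    then show "\<bar>cop_sum x + (\<Sum>i | i \<in> odd_nonunits \<and> (rnorm i)\<^sup>2 \<le> x. 1 / (4 * (rnorm i)\<^sup>2) * cop_sum (x / (rnorm i)\<^sup>2)) -
              (1 + ?D) * (1 / catalan) * (ln x)\<^sup>2\<bar> \<le> 600 * (1 + ln x)"
      using odd_pairs_sum_bound[OF x] unfolding odd_pairs_renewal[OF x] by (simp only:)
  qed (use odd_nonunits_rnorm odd_nonunits_weight_has_sum D1 V that in auto)
qed

definition odd_rho_sum :: "real \<Rightarrow> real"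
  where "odd_rho_sum x = (\<Sum>c\<in>oball x. real (rho c) / rnorm c)"

text \<open>
  Comaximal pairs are sorted by their product.
\<close>

lemma cop_sum_eq_odd_rho_sum: "cop_sum x = 4 * odd_rho_sum x"
proof -
  let ?phi = "\<lambda>p :: gauss \<times> gauss. fst p * snd p"
  have mem: "(a, b) \<in> cop_pairs x \<longleftrightarrow> a * b \<in> oball x \<and> comax a b" for a b
    by (auto simp: cop_pairs_def odd_pairs_def oball_def gball_def gnorm_mult glam_dvd_mult_iff)
  then have sub: "?phi ` cop_pairs x \<subseteq> oball x" by auto
  have "cop_sum x = (\<Sum>c\<in>oball x. \<Sum>p | p \<in> cop_pairs x \<and> ?phi p = c. pair_weight p)"
    unfolding cop_sum_def by (rule sum.group[symmetric, OF finite_cop_pairs finite_oball sub])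
  also have "\<dots> = (\<Sum>c\<in>oball x. 4 * (real (rho c) / rnorm c))"
  proof (rule sum.cong[OF refl])
    fix c assume c: "c \<in> oball x"
    have "{p. p \<in> cop_pairs x \<and> ?phi p = c} = coprime_factorizations c"
      using mem c by (auto simp: coprime_factorizations_def)
    moreover have "pair_weight p = 1 / rnorm c" if "p \<in> coprime_factorizations c" for p
      using that by (auto simp: coprime_factorizations_def gnorm_mult)
    moreover have "card (coprime_factorizations c) = 4 * rho c"
      using c by (intro card_coprime_factorizations) (auto simp: oball_def)
    ultimately show "(\<Sum>p | p \<in> cop_pairs x \<and> ?phi p = c. pair_weight p) = 4 * (real (rho c) / rnorm c)"
      by simp
  qed
  finally show ?thesis by (simp add: odd_rho_sum_def sum_distrib_left)
qed

lemma glam_power_odd_decomp: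
  assumes "z \<noteq> 0" obtains j w where "z = glam ^ j * w" "\<not> glam dvd w"
proof -
  have "\<exists>j w. z = glam ^ j * w \<and> \<not> glam dvd w" using assms
  proof (induction "nat (gnorm z)" arbitrary: z rule: less_induct)
    case less
    show ?case
    proof (cases "glam dvd z")
      case False then show ?thesis by (intro exI[of _ 0] exI[of _ z]) simp
    next
      case True
      then obtain y where y: "z = glam * y" by (elim dvdE)
      then have "y \<noteq> 0" "gnorm z = 2 * gnorm y" using less.prems by (auto simp: gnorm_mult gnorm_glam simp del: gauss_sel)
      moreover from this have "gnorm y > 0" by simp
      ultimately have "nat (gnorm y) < nat (gnorm z)" by linarith
      then obtain j w where "y = glam ^ j * w" "\<not> glam dvd w" using less.hyps \<open>y \<noteq> 0\<close> by blast
      then have "z = glam ^ Suc j * w" "\<not> glam dvd w" using y by (simp_all add: mult.assoc)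
      then show ?thesis by blast
    qed
  qed
  then show ?thesis using that by blast
qed

lemma glam_power_odd_unique:
  assumes "glam ^ j * w = glam ^ k * v" "\<not> glam dvd w" "\<not> glam dvd v" shows "j = k \<and> w = v"
proof -
  have *: "\<not> j < k" if eq: "glam ^ j * w = glam ^ k * v" and "\<not> glam dvd w" for j k w v
  proof
    assume "j < k"
    then have "glam ^ k = glam ^ j * (glam * glam ^ (k - j - 1))"
      by (simp flip: power_Suc power_add add: Suc_diff_Suc del: power_Suc)
    then have "glam ^ j * w = glam ^ j * (glam * (glam ^ (k - j - 1) * v))" using eq by (simp only: mult.assoc)
    then have "w = glam * (glam ^ (k - j - 1) * v)" by simp
    then show False using \<open>\<not> glam dvd w\<close> by (metis dvd_triv_left)
  qed
  have "j = k" using *[OF assms(1,2)] *[OF assms(1)[symmetric] assms(3)] by linarith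
  then show ?thesis using assms(1) by simp
qed

definition rho_sum :: "real \<Rightarrow> real"
  where "rho_sum x = (\<Sum>c\<in>gball x. real (rho c) / rnorm c)"

lemma finite_powers_of_two_le: "finite {j :: nat. 2 ^ j \<le> (x :: real)}"
proof -
  obtain k where k: "x < 2 ^ k" using real_arch_pow[of 2 x] by auto
  have "{j :: nat. 2 ^ j \<le> x} \<subseteq> {..k}"
  proof
    fix j assume "j \<in> {j :: nat. 2 ^ j \<le> x}"
    then have "2 ^ j \<le> x" by simp
    then have "(2 :: real) ^ j < 2 ^ k" using k by (rule le_less_trans)
    then show "j \<in> {..k}" by simp
  qed
  then show ?thesis using finite_subset by blast
qed

text \<open>
  Every nonzero element is uniquely a power of \<open>1 + i\<close> times an odd element, and \<open>rho\<close> is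
  multiplicative.
\<close>

lemma rho_sum_by_glam_power:
  "rho_sum x = (\<Sum>j | j \<in> UNIV \<and> 2 ^ j \<le> x. lam_weight j * odd_rho_sum (x / 2 ^ j))"
proof -
  let ?J = "{j :: nat. j \<in> UNIV \<and> 2 ^ j \<le> x}"
  let ?T = "Sigma ?J (\<lambda>j. oball (x / 2 ^ j))"
  let ?f = "\<lambda>(j, w). glam ^ j * w"
  have finJ: "finite ?J" using finite_powers_of_two_le[of x] by simp
  have gn: "rnorm (glam ^ j * w) = 2 ^ j * rnorm w" for j w by (simp add: gnorm_mult gnorm_power gnorm_glam)
  have img: "?f ` ?T = gball x"
  proof (intro equalityI subsetI)
    fix z assume "z \<in> ?f ` ?T"
    then obtain j w where "z = glam ^ j * w" "w \<in> oball (x / 2 ^ j)" by auto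
    then show "z \<in> gball x" using gn[of j w] by (auto simp: oball_def gball_def field_simps)
  next
    fix z assume z: "z \<in> gball x"
    then obtain j w where jw: "z = glam ^ j * w" "\<not> glam dvd w" using glam_power_odd_decomp[of z] by (auto simp: gball_def)
    then have w0: "w \<noteq> 0" by auto
    have le: "2 ^ j * rnorm w \<le> x" using z gn[of j w] jw by (simp add: gball_def)
    (* An odd element has norm at least 1, so only powers with 2 ^ j <= x occur. *)
    have "2 ^ j * 1 \<le> 2 ^ j * rnorm w" using rnorm_ge_1[OF w0] by (intro mult_left_mono) auto
    then have "2 ^ j * 1 \<le> x" using le by (rule order_trans)
    then have "j \<in> ?J" by simp
    moreover have "w \<in> oball (x / 2 ^ j)" using le w0 jw by (simp add: oball_def gball_def field_simps)
    ultimately have "(j, w) \<in> ?T" by blast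
    then show "z \<in> ?f ` ?T" using jw by (intro rev_image_eqI) auto
  qed
  have inj: "inj_on ?f ?T"
  proof (rule inj_onI)
    fix p q assume pq: "p \<in> ?T" "q \<in> ?T" "?f p = ?f q"
    obtain j w k v where e: "p = (j, w)" "q = (k, v)" by (metis surj_pair)
    then have "glam ^ j * w = glam ^ k * v" "\<not> glam dvd w" "\<not> glam dvd v" using pq by (auto simp: oball_def)
    then show "p = q" using glam_power_odd_unique e by blast
  qed
  have "rho_sum x = (\<Sum>p\<in>?T. real (rho (?f p)) / rnorm (?f p))"
    unfolding rho_sum_def img[symmetric] by (subst sum.reindex[OF inj]) simp
  also have "\<dots> = (\<Sum>(j, w)\<in>?T. lam_weight j * (real (rho w) / rnorm w))"
  proof (rule sum.cong[OF refl])
    fix p assume p: "p \<in> ?T"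
    obtain j w where jw: "p = (j, w)" by (cases p)
    have w: "\<not> glam dvd w" "w \<noteq> 0" using p jw by (auto simp: oball_def)
    have "rho (glam ^ j * w) = rho (glam ^ j) * rho w"
      using w by (intro rho_mult odd_comax_glam_power) auto
    then have "real (rho (glam ^ j * w)) / rnorm (glam ^ j * w) = (real (rho (glam ^ j)) / 2 ^ j) * (real (rho w) / rnorm w)"
      unfolding gn by simp
    then show "real (rho (?f p)) / rnorm (?f p) = (case p of (j, w) \<Rightarrow> lam_weight j * (real (rho w) / rnorm w))"
      unfolding jw rho_glam_power by simp
  qed
  also have "\<dots> = (\<Sum>j\<in>?J. \<Sum>w\<in>oball (x / 2 ^ j). lam_weight j * (real (rho w) / rnorm w))"
    by (rule sum.Sigma[symmetric]) (use finJ in auto)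
  finally show ?thesis by (simp add: odd_rho_sum_def sum_distrib_left)
qed

text \<open>
  The weights \<open>lam_weight j\<close> have sum 3 and decay geometrically, so that averaging the
  odd sum, which grows like \<open>(ln x)\<^sup>2 / (4 * catalan)\<close>, multiplies its leading constant by
  3.
\<close>

lemma rho_sum_asymptotic:
  obtains K where "K \<ge> 0" "\<And>x. x \<ge> 1 \<Longrightarrow> \<bar>rho_sum x - 3 / (4 * catalan) * (ln x)\<^sup>2\<bar> \<le> K * (1 + ln x)"
proof -
  obtain K where K: "K \<ge> 0" "\<And>x. x \<ge> 1 \<Longrightarrow> \<bar>cop_sum x - 1 / catalan * (ln x)\<^sup>2\<bar> \<le> K * (1 + ln x)"
    using cop_sum_asymptotic by blast
  let ?b = "1 / (4 * catalan)"
  have odd: "\<bar>odd_rho_sum x - ?b * (ln x)\<^sup>2\<bar> \<le> K * (1 + ln x)" if "x \<ge> 1" for x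
  proof -
    have "\<bar>4 * (odd_rho_sum x - ?b * (ln x)\<^sup>2)\<bar> \<le> K * (1 + ln x)"
      using K(2)[OF that] unfolding cop_sum_eq_odd_rho_sum by (simp add: right_diff_distrib)
    then show ?thesis by (simp add: abs_mult)
  qed
  have W: "(lam_weight has_sum 3) UNIV"
    using lam_weight_sums lam_weight_nonneg by (intro sums_nonneg_imp_has_sum) auto
  have "summable (\<lambda>j. 16 * (3/4 :: real) ^ j)" by (intro summable_mult summable_geometric) simp
  then have "summable (\<lambda>j. lam_weight j * ln (2 ^ j))"
  proof (rule summable_comparison_test[rotated], intro exI[of _ 0] allI impI)
    fix j :: nat
    have "lam_weight j * ln (2 ^ j) \<le> (8 / 2 ^ j) * real j"
    proof (rule mult_mono)
      have "real j * ln 2 \<le> real j * 1" using ln_2_less_1 by (intro mult_left_mono) auto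
      then show "ln (2 ^ j) \<le> real j" by (simp add: ln_realpow)
    qed (auto simp: lam_weight_le)
    also have "\<dots> \<le> (8 / 2 ^ j) * (2 * (3/2) ^ j)"
      using Bernoulli_inequality[of "1/2 :: real" j] by (intro mult_left_mono) auto
    also have "\<dots> = 16 * (3/4) ^ j" by (simp add: power_divide flip: power_mult_distrib)
    finally show "norm (lam_weight j * ln (2 ^ j)) \<le> 16 * (3/4) ^ j"
      using lam_weight_nonneg[of j] by (simp add: abs_mult)
  qed
  then have "(\<lambda>j. lam_weight j * ln (2 ^ j)) summable_on UNIV"
    using lam_weight_nonneg by (intro norm_summable_imp_summable_on) (auto simp: abs_mult)
  then obtain V where V: "((\<lambda>j. lam_weight j * ln (2 ^ j)) has_sum V) UNIV" by (auto simp: summable_on_def)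
  have V0: "V \<ge> 0" using V by (rule has_sum_nonneg) (simp add: lam_weight_nonneg)
  have b0: "?b \<ge> 0" using catalan_bounds by simp
  show ?thesis
  proof (rule that[of "3 * K + 3 * ?b * V"])
    show "0 \<le> 3 * K + 3 * ?b * V" using K V0 b0 by (intro add_nonneg_nonneg mult_nonneg_nonneg) auto
    fix x :: real assume x: "x \<ge> 1"
    have L0: "ln x \<ge> 0" using x by simp
    have fin: "finite {j \<in> UNIV. (2 :: real) ^ j \<le> x}" using finite_powers_of_two_le[of x] by simp
    have "\<bar>(\<Sum>j | j \<in> UNIV \<and> 2 ^ j \<le> x. lam_weight j * odd_rho_sum (x / 2 ^ j)) - 3 * ?b * (ln x)\<^sup>2\<bar>
        \<le> 3 * (K * (1 + ln x)) + 3 * \<bar>?b\<bar> * V * ln x"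
    proof (rule weighted_log_square_bound[OF lam_weight_nonneg _ fin W V x])
      show "0 \<le> K * (1 + ln x)" using K L0 by simp
      fix j :: nat assume j: "2 ^ j \<le> x"
      have "\<bar>odd_rho_sum (x / 2 ^ j) - ?b * (ln (x / 2 ^ j))\<^sup>2\<bar> \<le> K * (1 + ln (x / 2 ^ j))"
        using j by (intro odd) simp
      also have "ln (x / 2 ^ j) \<le> ln x" using x by (simp add: ln_div)
      finally show "\<bar>odd_rho_sum (x / 2 ^ j) - ?b * (ln (x / 2 ^ j))\<^sup>2\<bar> \<le> K * (1 + ln x)"
        using K by (simp add: mult_left_mono)
    qed simp
    also have "\<dots> \<le> 3 * (K * (1 + ln x)) + 3 * ?b * V * (1 + ln x)"
    proof -
      have "3 * \<bar>?b\<bar> * V * ln x \<le> 3 * ?b * V * (1 + ln x)" using b0 V0 L0 by (intro mult_mono) auto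
      then show ?thesis by simp
    qed
    finally show "\<bar>rho_sum x - 3 / (4 * catalan) * (ln x)\<^sup>2\<bar> \<le> (3 * K + 3 * ?b * V) * (1 + ln x)"
      unfolding rho_sum_by_glam_power by (simp add: algebra_simps)
  qed
qed

section \<open>The hyperbola method for matrices with given trace\<close>

lemma norm_cpx_pos: "c \<noteq> 0 \<Longrightarrow> cmod (cpx c) \<ge> 1"
  using rnorm_ge_1[of c] by (simp add: norm_cpx)

text \<open>
  The error terms of the lattice point counts are governed by this sum.
\<close>

definition rho_root_sum :: "real \<Rightarrow> real"
  where "rho_root_sum x = (\<Sum>c\<in>gball x. real (rho c) / cmod (cpx c))"

text \<open>
  The main terms at \<open>x\<close> and \<open>x / 4\<close> differ by \<open>O(ln x)\<close>.
\<close>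

lemma rho_sum_increment:
  obtains C where "C \<ge> 0" "\<And>x. x \<ge> 1 \<Longrightarrow> rho_sum x - rho_sum (x / 4) \<le> C * (1 + ln x)"
proof -
  define b where "b = 3 / (4 * catalan)"
  obtain K where K: "K \<ge> 0" "\<And>x. x \<ge> 1 \<Longrightarrow> \<bar>rho_sum x - b * (ln x)\<^sup>2\<bar> \<le> K * (1 + ln x)"
    unfolding b_def using rho_sum_asymptotic by blast
  have b0: "b \<ge> 0" unfolding b_def using catalan_bounds by simp
  have "ln 4 = 2 * ln (2 :: real)" using ln_realpow[of 2 2] by simp
  then have "ln (4 :: real) \<le> 2" using ln_2_less_1 by linarith
  moreover have "0 \<le> ln (4 :: real)" by (rule ln_ge_zero) simp
  ultimately have l4: "0 \<le> ln (4 :: real)" "ln (4 :: real) \<le> 2" by blast+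
  show ?thesis
  proof (rule that[of "2 * K + 4 * b"])
    show "0 \<le> 2 * K + 4 * b" using K b0 by simp
    fix x :: real assume x: "x \<ge> 1"
    have L0: "ln x \<ge> 0" using x by simp
    have up: "rho_sum x \<le> b * (ln x)\<^sup>2 + K * (1 + ln x)" using K(2)[OF x] by linarith
    show "rho_sum x - rho_sum (x / 4) \<le> (2 * K + 4 * b) * (1 + ln x)"
    proof (cases "x \<ge> 4")
      case True
      have lx: "ln (x / 4) = ln x - ln 4" using x by (simp add: ln_div)
      have "rho_sum (x / 4) \<ge> b * (ln (x / 4))\<^sup>2 - K * (1 + ln (x / 4))" using K(2)[of "x / 4"] True by simp
      moreover have "K * (1 + ln (x / 4)) \<le> K * (1 + ln x)" unfolding lx using K l4 by (intro mult_left_mono) auto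
      moreover have "b * (ln x)\<^sup>2 - b * (ln (x / 4))\<^sup>2 \<le> 4 * b * (1 + ln x)"
      proof -
        have "(ln x)\<^sup>2 - (ln (x / 4))\<^sup>2 = ln 4 * (2 * ln x - ln 4)"
          unfolding lx by (simp add: power2_eq_square algebra_simps)
        also have "\<dots> \<le> ln 4 * (2 + 2 * ln x)" using l4 by (intro mult_left_mono; linarith)
        also have "\<dots> \<le> 2 * (2 + 2 * ln x)" using l4 L0 by (intro mult_right_mono; linarith)
        finally have "b * ((ln x)\<^sup>2 - (ln (x / 4))\<^sup>2) \<le> b * (2 * (2 + 2 * ln x))" using b0 by (rule mult_left_mono)
        then show ?thesis by (simp add: right_diff_distrib distrib_left)
      qed
      ultimately have "rho_sum x - rho_sum (x / 4) \<le> K * (1 + ln x) + K * (1 + ln x) + 4 * b * (1 + ln x)"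
        using up by linarith
      then show ?thesis by (simp add: algebra_simps)
    next
      case False
      then have "rho_sum (x / 4) = 0" by (simp add: rho_sum_def gball_empty)
      moreover have "b * (ln x)\<^sup>2 \<le> b * (4 * (1 + ln x))"
      proof (rule mult_left_mono[OF _ b0])
        have "ln x \<le> ln 4" using False x by simp
        then have "ln x * ln x \<le> 2 * ln x" using l4 L0 by (intro mult_right_mono) auto
        then show "(ln x)\<^sup>2 \<le> 4 * (1 + ln x)" using L0 by (simp add: power2_eq_square)
      qed
      moreover have "0 \<le> K * (1 + ln x)" using K L0 by simp
      ultimately have "rho_sum x - rho_sum (x / 4) \<le> K * (1 + ln x) + K * (1 + ln x) + b * (4 * (1 + ln x))"
        using up by linarith
      then show ?thesis by (simp add: algebra_simps)
    qed
  qed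
qed

text \<open>
  On \<open>x / 4 < N(c) \<le> x\<close> the summand is at most \<open>sqrt x * rho c / N(c)\<close>, so this range
  contributes \<open>O(sqrt x * (1 + ln x))\<close>; the ranges below it form a geometric series.
\<close>

lemma rho_root_sum_bound:
  obtains K where "K \<ge> 0" "\<And>x. x \<ge> 1 \<Longrightarrow> rho_root_sum x \<le> K * sqrt x * (1 + ln x)"
proof -
  obtain C where C: "C \<ge> 0" "\<And>x. x \<ge> 1 \<Longrightarrow> rho_sum x - rho_sum (x / 4) \<le> C * (1 + ln x)"
    using rho_sum_increment by blast
  have step: "rho_root_sum x \<le> rho_root_sum (x / 4) + sqrt x * (C * (1 + ln x))" if x: "x \<ge> 1" for x
  proof -
    have sub: "gball (x / 4) \<subseteq> gball x" using x by (auto simp: gball_def)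
    have "rho_root_sum x - rho_root_sum (x / 4) = (\<Sum>c\<in>gball x - gball (x / 4). real (rho c) / cmod (cpx c))"
      unfolding rho_root_sum_def using sub by (simp add: sum_diff)
    also have "\<dots> \<le> (\<Sum>c\<in>gball x - gball (x / 4). sqrt x * (real (rho c) / rnorm c))"
    proof (rule sum_mono)
      fix c assume "c \<in> gball x - gball (x / 4)"
      then have c: "c \<noteq> 0" "rnorm c \<le> x" by (auto simp: gball_def)
      have "cmod (cpx c) \<le> sqrt x" using c by (simp add: norm_cpx)
      then have "cmod (cpx c) * (real (rho c) / rnorm c) \<le> sqrt x * (real (rho c) / rnorm c)"
        by (intro mult_right_mono) auto
      moreover have "cmod (cpx c) * (real (rho c) / rnorm c) = real (rho c) / cmod (cpx c)"
        unfolding norm_cpx_sq[symmetric] using c by (simp add: power2_eq_square)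
      ultimately show "real (rho c) / cmod (cpx c) \<le> sqrt x * (real (rho c) / rnorm c)" by simp
    qed
    also have "\<dots> = sqrt x * (rho_sum x - rho_sum (x / 4))"
      unfolding rho_sum_def using sub by (simp add: sum_diff sum_distrib_left right_diff_distrib)
    also have "\<dots> \<le> sqrt x * (C * (1 + ln x))" using C(2)[OF x] x by (intro mult_left_mono) auto
    finally show ?thesis by simp
  qed
  have "rho_root_sum x \<le> 2 * C * sqrt x * (1 + ln x)" if "x \<ge> 1" "x < 4 ^ k" for x and k :: nat
    using that
  proof (induction k arbitrary: x)
    case 0 then show ?case by simp
  next
    case (Suc k)
    have L0: "ln x \<ge> 0" using Suc.prems by simp
    have "rho_root_sum (x / 4) \<le> C * sqrt x * (1 + ln x)"
    proof (cases "x / 4 \<ge> 1")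
      case True
      have "rho_root_sum (x / 4) \<le> 2 * C * sqrt (x / 4) * (1 + ln (x / 4))"
        using Suc.prems by (intro Suc.IH[OF True]) simp
      also have "2 * C * sqrt (x / 4) = C * sqrt x" by (simp add: real_sqrt_divide)
      also have "ln (x / 4) \<le> ln x" using Suc.prems by simp
      finally show ?thesis using C(1) Suc.prems by (simp add: mult_left_mono)
    next
      case False
      then have "rho_root_sum (x / 4) = 0" by (simp add: rho_root_sum_def gball_empty)
      then show ?thesis using C(1) L0 Suc.prems by simp
    qed
    then show ?case using step[OF Suc.prems(1)] by (simp add: algebra_simps)
  qed
  moreover have "\<exists>k. x < 4 ^ k" for x :: real using real_arch_pow[of 4 x] by simp
  ultimately show ?thesis using that[of "2 * C"] C(1) by (metis mult_nonneg_nonneg zero_le_numeral)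
qed

lemma gdiv_exact: "c \<noteq> 0 \<Longrightarrow> gdiv (c * e) c = e"
  using gdiv_add_mult[of c 0 e] by (simp add: gdiv_def gauss_eq_iff)

text \<open>
  The pairs \<open>(c, d)\<close> belonging to the shift \<open>k\<close>, with the upper right entry \<open>b\<close>
  eliminated: it exists if and only if \<open>c\<close> divides \<open>d\<^sup>2 - 1\<close>.
\<close>

definition trace_solutions :: "gauss \<Rightarrow> real \<Rightarrow> (gauss \<times> gauss) set"
  where "trace_solutions k T = {(c, d). c \<noteq> 0 \<and> c dvd d * d - 1 \<and>
           4 < rnorm (2 * d + c * k) \<and> rnorm (2 * d + c * k) \<le> T}"

text \<open>
  With \<open>d\<^sup>2 - c * e = 1\<close>, this is the exchange of the divisor \<open>c\<close> for the complementary
  one. For \<open>k = 0\<close> (\<open>m = 0\<close>) it swaps \<open>c\<close> and \<open>e\<close>. For \<open>k \<noteq> 0\<close> put \<open>m = 2 / k\<close>; the map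
  replaces \<open>c\<close> by the element \<open>c'\<close> with \<open>4 * c * c' = m\<^sup>2 * (t\<^sup>2 - 4)\<close>, where
  \<open>t = 2 * d + c * k\<close>, and keeps both \<open>t\<close> and \<open>e\<close>.
\<close>

definition dual_map :: "gauss \<Rightarrow> gauss \<times> gauss \<Rightarrow> gauss \<times> gauss"
  where "dual_map m = (\<lambda>(c, d). let e = gdiv (d * d - 1) c
     in if m = 0 then (e, d) else (c + 2 * m * d + m * m * e, - d - m * e))"

lemma dual_map_zero:
  assumes c: "c \<noteq> 0" "c dvd d * d - 1" and e: "(c', d') = dual_map 0 (c, d)"
  shows "c' dvd d' * d' - 1" "2 * d' = 2 * d" "4 * (c * c') = (2 * d) * (2 * d) - 4"
    "c' \<noteq> 0 \<Longrightarrow> dual_map 0 (c', d') = (c, d)"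
proof -
  obtain u where u: "d * d - 1 = c * u" using c(2) by (elim dvdE)
  have e': "c' = u" "d' = d" using e c by (simp_all add: dual_map_def Let_def u gdiv_exact)
  show "c' dvd d' * d' - 1" unfolding e' u by simp
  show "2 * d' = 2 * d" unfolding e' ..
  have "4 * (c * c') = 4 * (d * d - 1)" unfolding e' u ..
  then show "4 * (c * c') = (2 * d) * (2 * d) - 4" by (simp add: algebra_simps)
  assume "c' \<noteq> 0"
  then have "gdiv (d * d - 1) u = c" using gdiv_exact[of u c] unfolding u e' by (simp add: mult.commute)
  then show "dual_map 0 (c', d') = (c, d)" by (simp add: dual_map_def e')
qed

lemma dual_map_nonzero:
  assumes c: "c \<noteq> 0" "c dvd d * d - 1" and e: "(c', d') = dual_map m (c, d)" and m: "m * k = 2"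
  shows "c' dvd d' * d' - 1" "2 * d' + c' * k = 2 * d + c * k"
    "4 * (c * c') = m * m * ((2 * d + c * k) * (2 * d + c * k) - 4)"
    "c' \<noteq> 0 \<Longrightarrow> dual_map m (c', d') = (c, d)"
proof -
  have m0: "m \<noteq> 0" using m by (auto simp: gauss_eq_iff)
  obtain u where u: "d * d - 1 = c * u" using c(2) by (elim dvdE)
  have e': "c' = c + 2 * m * d + m * m * u" "d' = - d - m * u"
    using e c m0 by (simp_all add: dual_map_def Let_def u gdiv_exact)
  have "d' * d' - 1 = (d * d - 1) + 2 * m * d * u + m * m * u * u"
    unfolding e' by (simp add: algebra_simps)
  also have "\<dots> = c' * u" unfolding e' u by (simp add: algebra_simps)
  finally have du: "d' * d' - 1 = c' * u" .
  then show "c' dvd d' * d' - 1" by simp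
  have "2 * d' + c' * k = - 2 * d - 2 * (m * u) + c * k + 2 * (m * k) * d + (m * k) * (m * u)"
    unfolding e' by (simp add: algebra_simps)
  then show "2 * d' + c' * k = 2 * d + c * k" unfolding m by (simp add: algebra_simps)
  have "m * m * ((2 * d + c * k) * (2 * d + c * k) - 4)
      = 4 * m * m * (d * d - 1) + 4 * m * (m * k) * c * d + (m * k) * (m * k) * c * c"
    by (simp add: algebra_simps)
  also have "\<dots> = 4 * m * m * (c * u) + 4 * m * 2 * c * d + 2 * 2 * c * c" unfolding m u ..
  also have "\<dots> = 4 * (c * c')" unfolding e' by (simp add: algebra_simps)
  finally show "4 * (c * c') = m * m * ((2 * d + c * k) * (2 * d + c * k) - 4)" by simp
  assume "c' \<noteq> 0"
  then have "gdiv (d' * d' - 1) c' = u" unfolding du by (rule gdiv_exact)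
  then show "dual_map m (c', d') = (c, d)" using m0
    by (simp add: dual_map_def Let_def) (simp add: e' algebra_simps)
qed

definition shift_set :: "gauss set"
  where "shift_set = {0, 1, gI, glam}"

text \<open>
  What the hyperbola method needs of the exchange: it is an involution that preserves the
  trace \<open>t\<close>, and \<open>c * c'\<close> is comparable with \<open>t\<^sup>2 - 4\<close>.
\<close>

definition trace_duality :: "gauss \<Rightarrow> real \<Rightarrow> (gauss \<times> gauss \<Rightarrow> gauss \<times> gauss) \<Rightarrow> bool"
  where "trace_duality k q phi \<longleftrightarrow> (\<forall>c d c' d'. c \<noteq> 0 \<longrightarrow> c dvd d * d - 1 \<longrightarrow> (c', d') = phi (c, d) \<longrightarrow>
       c' dvd d' * d' - 1 \<and> 2 * d' + c' * k = 2 * d + c * k \<and>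
       16 * (rnorm c * rnorm c') = q * rnorm ((2 * d + c * k) * (2 * d + c * k) - 4) \<and>
       (c' \<noteq> 0 \<longrightarrow> phi (c', d') = (c, d)))"

text \<open>
  Each of the three nonzero shifts divides 2, which makes \<open>m = 2 / k\<close> a Gaussian integer.
\<close>

lemma trace_duality_exists:
  assumes "k \<in> shift_set"
  obtains phi q where "1 \<le> q" "q \<le> 16" "trace_duality k q phi"
proof (cases "k = 0")
  case True
  have "16 * (rnorm c * rnorm c') = rnorm ((2 * d + c * k) * (2 * d + c * k) - 4)"
    if "4 * (c * c') = (2 * d) * (2 * d) - 4" for c c' d
  proof -
    have "gnorm 4 = 16" by (simp add: gnorm_def)
    then have "16 * (rnorm c * rnorm c') = rnorm (4 * (c * c'))" by (simp add: gnorm_mult)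
    then show ?thesis unfolding that True by simp
  qed
  note * = this
  show ?thesis
  proof (rule that[of 1 "dual_map 0"], simp, simp, unfold trace_duality_def, intro allI impI)
    fix c d c' d' assume a: "c \<noteq> 0" "c dvd d * d - 1" "(c', d') = dual_map 0 (c, d)"
    note z = dual_map_zero[OF a]
    show "c' dvd d' * d' - 1 \<and> 2 * d' + c' * k = 2 * d + c * k \<and>
       16 * (rnorm c * rnorm c') = 1 * rnorm ((2 * d + c * k) * (2 * d + c * k) - 4) \<and>
       (c' \<noteq> 0 \<longrightarrow> dual_map 0 (c', d') = (c, d))"
      using z(1,2,4) *[OF z(3)] True by simp
  qed
next
  case False
  (* The values of m for the shifts 1, i and 1 + i. *)
  have "2 * 1 = (2 :: gauss)" "- 2 * gI * gI = 2" "(1 - gI) * glam = 2"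
    by (simp_all add: gauss_eq_iff)
  then obtain m where m: "m * k = 2" "m \<in> {2, - 2 * gI, 1 - gI}"
    using assms False unfolding shift_set_def by blast
  define q where "q = (rnorm m)\<^sup>2"
  have q: "1 \<le> q" "q \<le> 16" using m(2) by (auto simp: q_def gnorm_def)
  have *: "16 * (rnorm c * rnorm c') = q * rnorm ((2 * d + c * k) * (2 * d + c * k) - 4)"
    if "4 * (c * c') = m * m * ((2 * d + c * k) * (2 * d + c * k) - 4)" for c c' d
  proof -
    have "gnorm 4 = 16" by (simp add: gnorm_def)
    then have "16 * (rnorm c * rnorm c') = rnorm (4 * (c * c'))" by (simp add: gnorm_mult)
    then show ?thesis unfolding that by (simp add: gnorm_mult q_def power2_eq_square)
  qed
  show ?thesis
  proof (rule that[OF q, of "dual_map m"], unfold trace_duality_def, intro allI impI)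
    fix c d c' d' assume a: "c \<noteq> 0" "c dvd d * d - 1" "(c', d') = dual_map m (c, d)"
    note z = dual_map_nonzero[OF a m(1)]
    show "c' dvd d' * d' - 1 \<and> 2 * d' + c' * k = 2 * d + c * k \<and>
       16 * (rnorm c * rnorm c') = q * rnorm ((2 * d + c * k) * (2 * d + c * k) - 4) \<and>
       (c' \<noteq> 0 \<longrightarrow> dual_map m (c', d') = (c, d))"
      using z(1,2,4) *[OF z(3)] by blast
  qed
qed

text \<open>
  The hyperbola method: if one of \<open>a\<close> and \<open>phi a\<close> is always small, the set is covered by
  its small elements and their images, which overlap in the elements small on both sides.
\<close>

lemma involution_count:
  fixes h :: "'a \<Rightarrow> real"
  assumes fin: "finite {a \<in> A. h a \<le> Y}"
    and phi: "\<And>a. a \<in> A \<Longrightarrow> phi a \<in> A" "\<And>a. a \<in> A \<Longrightarrow> phi (phi a) = a"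
    and small: "\<And>a. a \<in> A \<Longrightarrow> h a \<le> Y \<or> h (phi a) \<le> Y"
  shows "finite A" "card A + card {a \<in> A. h a \<le> Y \<and> h (phi a) \<le> Y} = 2 * card {a \<in> A. h a \<le> Y}"
proof -
  let ?X = "{a \<in> A. h a \<le> Y}"
  let ?X' = "{a \<in> A. h (phi a) \<le> Y}"
  have im: "phi ` ?X = ?X'"
  proof (intro equalityI subsetI)
    fix a assume a: "a \<in> ?X'"
    then have "a \<in> A" by simp
    from phi(1)[OF this] a have "phi a \<in> ?X" by simp
    then show "a \<in> phi ` ?X" using phi(2)[OF \<open>a \<in> A\<close>, symmetric] by (rule rev_image_eqI)
  next
    fix b assume "b \<in> phi ` ?X"
    then obtain a where a: "b = phi a" "a \<in> A" "h a \<le> Y" by blast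
    then show "b \<in> ?X'" using phi(1)[OF a(2)] phi(2)[OF a(2)] by simp
  qed
  have "inj_on phi ?X"
  proof (rule inj_onI)
    fix a b assume ab: "a \<in> ?X" "b \<in> ?X" "phi a = phi b"
    then have "phi (phi a) = a" "phi (phi b) = b" using phi(2)[of a] phi(2)[of b] by blast+
    with ab(3) show "a = b" by metis
  qed
  then have c: "card ?X' = card ?X" using card_image[of phi ?X] im by simp
  have f': "finite ?X'" using fin unfolding im[symmetric] by (rule finite_imageI)
  have A: "?X \<union> ?X' = A" using small by blast
  have "finite (?X \<union> ?X')" using fin f' by blast
  then show "finite A" unfolding A .
  have "card (?X \<union> ?X') + card (?X \<inter> ?X') = card ?X + card ?X'"
    using card_Un_Int[OF fin f'] by simp
  moreover have "?X \<inter> ?X' = {a \<in> A. h a \<le> Y \<and> h (phi a) \<le> Y}" by blast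
  ultimately show "card A + card {a \<in> A. h a \<le> Y \<and> h (phi a) \<le> Y} = 2 * card ?X"
    unfolding A c by simp
qed

definition trace_fiber :: "gauss \<Rightarrow> gauss \<Rightarrow> real \<Rightarrow> gauss set"
  where "trace_fiber k c s = {d. c dvd d * d - 1 \<and> cmod (2 * cpx d + cpx (c * k)) \<le> s}"

lemma card_trace_fiber:
  assumes "c \<noteq> 0" "s \<ge> 0"
  shows "finite (trace_fiber k c s)"
    and "\<bar>real (card (trace_fiber k c s)) - real (rho c) * (pi * s\<^sup>2 / (4 * rnorm c))\<bar>
          \<le> real (rho c) * (16 * (s / (2 * cmod (cpx c)) + 1))"
  using card_periodic_disc[OF assms periodic_mod_square, of "cpx (c * k)"]
  unfolding trace_fiber_def rho_def by blast+

lemma rnorm_trace_le_iff: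
  assumes "x \<ge> 0"
  shows "rnorm (2 * d + c * k) \<le> x \<longleftrightarrow> cmod (2 * cpx d + cpx (c * k)) \<le> sqrt x"
proof -
  have "cmod (2 * cpx d + cpx (c * k)) = sqrt (rnorm (2 * d + c * k))"
    using norm_cpx[of "2 * d + c * k"] by simp
  then show ?thesis by simp
qed

text \<open>
  For each \<open>c\<close> the admissible \<open>d\<close> lie in \<open>rho c\<close> residue classes and in an annulus, whose
  inner disc, of bounded radius, only contributes to the error. As \<open>N(c) \<le> Y\<close>, every error
  term is at most a constant times \<open>sqrt Y * rho c / cmod (cpx c)\<close>.
\<close>

lemma small_trace_solutions:
  assumes T: "T \<ge> 4" and Y: "Y \<ge> T"
  shows "finite {p \<in> trace_solutions k T. rnorm (fst p) \<le> Y}"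
    "\<bar>real (card {p \<in> trace_solutions k T. rnorm (fst p) \<le> Y}) - pi * T / 4 * rho_sum Y\<bar>
      \<le> 60 * sqrt Y * rho_root_sum Y"
proof -
  let ?F = "\<lambda>c. trace_fiber k c (sqrt T) - trace_fiber k c 2"
  have eq: "{p \<in> trace_solutions k T. rnorm (fst p) \<le> Y} = Sigma (gball Y) ?F"
  proof -
    have "4 < rnorm (2 * d + c * k) \<longleftrightarrow> \<not> cmod (2 * cpx d + cpx (c * k)) \<le> 2" for c d
      using rnorm_trace_le_iff[of 4 d c k] by auto
    then show ?thesis using rnorm_trace_le_iff[of T] T
      by (auto simp: trace_solutions_def trace_fiber_def gball_def)
  qed
  have fin: "finite (?F c)" if "c \<in> gball Y" for c
    using that card_trace_fiber(1)[of c "sqrt T" k] T by (auto simp: gball_def)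
  show "finite {p \<in> trace_solutions k T. rnorm (fst p) \<le> Y}"
    unfolding eq using fin by (intro finite_SigmaI) auto
  have "card (Sigma (gball Y) ?F) = (\<Sum>c\<in>gball Y. card (?F c))"
    by (rule card_SigmaI) (use fin in auto)
  then have "\<bar>real (card (Sigma (gball Y) ?F)) - pi * T / 4 * rho_sum Y\<bar>
      = \<bar>\<Sum>c\<in>gball Y. (real (card (?F c)) - real (rho c) * (pi * T / (4 * rnorm c)))\<bar>"
    by (simp add: sum_subtractf rho_sum_def sum_distrib_left mult_ac)
  also have "\<dots> \<le> (\<Sum>c\<in>gball Y. 60 * sqrt Y * (real (rho c) / cmod (cpx c)))"
  proof (rule order_trans[OF sum_abs sum_mono])
    fix c assume "c \<in> gball Y"
    then have c: "c \<noteq> 0" "rnorm c \<le> Y" by (auto simp: gball_def)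
    let ?n = "cmod (cpx c)"
    have n: "1 \<le> ?n" "?n \<le> sqrt Y" using norm_cpx_pos c by (auto simp: norm_cpx)
    have sub: "trace_fiber k c 2 \<subseteq> trace_fiber k c (sqrt T)"
      using T real_le_rsqrt[of 2 T] by (auto simp: trace_fiber_def)
    have f2: "finite (trace_fiber k c 2)" "finite (trace_fiber k c (sqrt T))"
      using card_trace_fiber(1)[OF c(1)] T by auto
    have cF: "real (card (?F c)) = real (card (trace_fiber k c (sqrt T))) - real (card (trace_fiber k c 2))"
      using card_Diff_subset[OF f2(1) sub] card_mono[OF f2(2) sub] by (simp add: of_nat_diff)
    define X where "X = sqrt Y / ?n"
    have n0: "?n > 0" using n by linarith
    have X1: "1 \<le> X" unfolding X_def using n n0 by (subst le_divide_eq_1_pos) auto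
    have "sqrt T / (2 * ?n) \<le> X / 2"     proof -
      have "sqrt T / (2 * ?n) \<le> sqrt Y / (2 * ?n)" using n0 Y by (intro divide_right_mono) auto
      then show ?thesis by (simp add: X_def mult.commute)
    qed
    then have "16 * (sqrt T / (2 * ?n) + 1) \<le> 24 * X" using X1 by simp
    then have "real (rho c) * (16 * (sqrt T / (2 * ?n) + 1)) \<le> real (rho c) * (24 * X)"
      by (intro mult_left_mono) auto
    then have 1: "\<bar>real (card (trace_fiber k c (sqrt T))) - real (rho c) * (pi * T / (4 * rnorm c))\<bar> \<le> real (rho c) * (24 * X)"
      using card_trace_fiber(2)[OF c(1), of "sqrt T" k] T by simp
    have "pi * 2\<^sup>2 / (4 * rnorm c) \<le> 4 * X"
    proof -
      have "pi * 2\<^sup>2 / (4 * rnorm c) = pi / rnorm c" by simp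
      also have "\<dots> \<le> pi / 1" using rnorm_ge_1[OF c(1)] by (intro divide_left_mono) auto
      also have "\<dots> \<le> 4 * X" using pi_less_4 X1 by simp
      finally show ?thesis .
    qed
    moreover have "16 * (2 / (2 * ?n) + 1) \<le> 32 * X"
    proof -
      have "2 / (2 * ?n) \<le> 1" using n n0 by (subst divide_le_eq_1_pos) auto
      then show ?thesis using X1 by simp
    qed
    ultimately have "real (rho c) * (pi * 2\<^sup>2 / (4 * rnorm c)) + real (rho c) * (16 * (2 / (2 * ?n) + 1)) \<le> real (rho c) * (4 * X) + real (rho c) * (32 * X)"
      by (intro add_mono mult_left_mono) auto
    then have 2: "real (card (trace_fiber k c 2)) \<le> real (rho c) * (4 * X) + real (rho c) * (32 * X)"
      using card_trace_fiber(2)[OF c(1), of 2 k] by linarith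
    have "\<bar>real (card (?F c)) - real (rho c) * (pi * T / (4 * rnorm c))\<bar> \<le> real (rho c) * (24 * X) + (real (rho c) * (4 * X) + real (rho c) * (32 * X))"
      unfolding cF using 1 2 of_nat_0_le_iff[of "card (trace_fiber k c 2)", where 'a = real] by linarith
    also have "\<dots> = 60 * sqrt Y * (real (rho c) / ?n)" by (simp add: X_def algebra_simps)
    finally show "\<bar>real (card (?F c)) - real (rho c) * (pi * T / (4 * rnorm c))\<bar> \<le> 60 * sqrt Y * (real (rho c) / ?n)" .
  qed
  finally show "\<bar>real (card {p \<in> trace_solutions k T. rnorm (fst p) \<le> Y}) - pi * T / 4 * rho_sum Y\<bar>
      \<le> 60 * sqrt Y * rho_root_sum Y"
    unfolding eq by (simp add: rho_root_sum_def sum_distrib_left)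
qed

text \<open>
  If \<open>c\<close> and its dual are both small, the trace is \<open>O(cmod (cpx c) * sqrt Y)\<close> in norm,
  which confines \<open>d\<close> to a disc of area \<open>O(cmod (cpx c) * sqrt Y)\<close> and leaves only
  \<open>O(rho c * sqrt Y / cmod (cpx c))\<close> possibilities.
\<close>

lemma balanced_trace_solutions:
  assumes Y: "Y \<ge> 1" and S: "S \<subseteq> {(c, d). c \<in> gball Y \<and> c dvd d * d - 1 \<and>
      rnorm (2 * d + c * k) \<le> 4 * cmod (cpx c) * sqrt Y + 4}"
  shows "real (card S) \<le> 88 * sqrt Y * rho_root_sum Y"
proof -
  let ?s = "\<lambda>c. sqrt (4 * cmod (cpx c) * sqrt Y + 4)"
  have sub: "S \<subseteq> Sigma (gball Y) (\<lambda>c. trace_fiber k c (?s c))"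
  proof
    fix p assume "p \<in> S"
    then obtain c d where p: "p = (c, d)" "c \<in> gball Y" "c dvd d * d - 1"
      "rnorm (2 * d + c * k) \<le> 4 * cmod (cpx c) * sqrt Y + 4" using S by auto
    then have "cmod (2 * cpx d + cpx (c * k)) \<le> ?s c"
      using Y by (subst rnorm_trace_le_iff[symmetric]) auto
    then show "p \<in> Sigma (gball Y) (\<lambda>c. trace_fiber k c (?s c))" using p by (simp add: trace_fiber_def)
  qed
  have fin: "finite (trace_fiber k c (?s c))" if "c \<in> gball Y" for c
    using that Y by (intro card_trace_fiber(1)) (auto simp: gball_def)
  have "card S \<le> card (Sigma (gball Y) (\<lambda>c. trace_fiber k c (?s c)))"
    by (rule card_mono[OF _ sub]) (use fin in auto)
  also have "\<dots> = (\<Sum>c\<in>gball Y. card (trace_fiber k c (?s c)))"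
    by (rule card_SigmaI) (use fin in auto)
  finally have "real (card S) \<le> real (\<Sum>c\<in>gball Y. card (trace_fiber k c (?s c)))"
    by (simp only: of_nat_le_iff)
  also have "\<dots> = (\<Sum>c\<in>gball Y. real (card (trace_fiber k c (?s c))))"
    by (simp only: of_nat_sum)
  also have "\<dots> \<le> (\<Sum>c\<in>gball Y. 88 * sqrt Y * (real (rho c) / cmod (cpx c)))"
  proof (rule sum_mono)
    fix c assume "c \<in> gball Y"
    then have c: "c \<noteq> 0" "rnorm c \<le> Y" by (auto simp: gball_def)
    let ?n = "cmod (cpx c)"
    have n: "1 \<le> ?n" "?n \<le> sqrt Y" using norm_cpx_pos c by (auto simp: norm_cpx)
    define X where "X = sqrt Y / ?n"
    have n0: "?n > 0" using n by linarith
    have X1: "1 \<le> X" unfolding X_def using n n0 by (subst le_divide_eq_1_pos) auto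
    have nX: "?n * X = sqrt Y" using n0 by (simp add: X_def)
    have sY: "1 \<le> sqrt Y" using Y by simp
    have "1 * 1 \<le> ?n * sqrt Y" using n sY by (intro mult_mono) auto
    then have "4 * ?n * sqrt Y + 4 \<le> 8 * (?n * sqrt Y)" by (simp only: mult.assoc)
    also have "?n * sqrt Y = ?n * ?n * X" using nX by (simp add: mult.assoc)
    finally have s2: "(?s c)\<^sup>2 \<le> 8 * X * ?n\<^sup>2" using Y by (simp add: power2_eq_square mult_ac)
    have n2: "rnorm c = ?n\<^sup>2" by (simp add: norm_cpx_sq)
    have sq: "(?s c)\<^sup>2 / ?n\<^sup>2 \<le> 8 * X" using s2 n0 by (subst pos_divide_le_eq) auto
    have "pi * ((?s c)\<^sup>2 / ?n\<^sup>2) / 4 \<le> 4 * (8 * X) / 4"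
      using sq pi_less_4 X1 by (intro divide_right_mono mult_mono) auto
    then have 1: "pi * (?s c)\<^sup>2 / (4 * rnorm c) \<le> 8 * X" unfolding n2 by (simp add: mult.commute)
    (* A nonnegative y with y^2 <= 8 * X satisfies y <= 8 * X, because 8 * X >= 1. *)
    have "?s c / ?n \<le> 8 * X"
    proof (rule power2_le_imp_le)
      have "(?s c / ?n)\<^sup>2 \<le> 8 * X" unfolding power_divide by (rule sq)
      also have "\<dots> = 1 * (8 * X)" by simp
      also have "\<dots> \<le> (8 * X) * (8 * X)" using X1 by (intro mult_right_mono) auto
      finally show "(?s c / ?n)\<^sup>2 \<le> (8 * X)\<^sup>2" by (simp only: power2_eq_square)
    qed (use X1 in auto)
    moreover have "?s c / (2 * ?n) = (?s c / ?n) / 2" by simp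
    ultimately have "16 * (?s c / (2 * ?n) + 1) \<le> 80 * X" using X1 by simp
    then have "real (rho c) * (pi * (?s c)\<^sup>2 / (4 * rnorm c)) + real (rho c) * (16 * (?s c / (2 * ?n) + 1))
        \<le> real (rho c) * (8 * X) + real (rho c) * (80 * X)"
      using 1 by (intro add_mono mult_left_mono) auto
    moreover have "0 \<le> ?s c" using Y by simp
    ultimately have "real (card (trace_fiber k c (?s c))) \<le> real (rho c) * (8 * X) + real (rho c) * (80 * X)"
      using card_trace_fiber(2)[OF c(1), of "?s c" k] by linarith
    then show "real (card (trace_fiber k c (?s c))) \<le> 88 * sqrt Y * (real (rho c) / ?n)"
      by (simp add: X_def algebra_simps)
  qed
  finally show ?thesis by (simp add: rho_root_sum_def sum_distrib_left)
qed

text \<open>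
  The threshold \<open>T + 4\<close> bounds the absolute value of \<open>t\<^sup>2 - 4\<close>, hence that of \<open>c * c'\<close>,
  so that \<open>c\<close> or \<open>c'\<close> has norm at most \<open>T + 4\<close>.
\<close>

lemma card_trace_solutions:
  assumes k: "k \<in> shift_set" and T: "T \<ge> 4"
  shows "finite (trace_solutions k T)"
    "\<bar>real (card (trace_solutions k T)) - pi * T / 2 * rho_sum (T + 4)\<bar> \<le> 208 * sqrt (T + 4) * rho_root_sum (T + 4)"
proof -
  define Y where "Y = T + 4"
  let ?A = "trace_solutions k T"
  obtain q phi where q: "1 \<le> q" "q \<le> 16" and phi: "trace_duality k q phi"
    using trace_duality_exists[OF k] by blast
  (* The product of the norms of c and its dual is at most Y^2, which makes one of them at most Y;
     the last bound confines the trace when both are. *)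
  have key: "phi (c, d) \<in> ?A \<and> phi (phi (c, d)) = (c, d) \<and>
      rnorm c * rnorm (fst (phi (c, d))) \<le> Y\<^sup>2 \<and>
      rnorm (2 * d + c * k) - 4 \<le> 4 * sqrt (rnorm c * rnorm (fst (phi (c, d))))"
    if cd: "(c, d) \<in> ?A" for c d
  proof -
    obtain c' d' where p: "phi (c, d) = (c', d')" by (cases "phi (c, d)")
    have c: "c \<noteq> 0" "c dvd d * d - 1" using cd by (auto simp: trace_solutions_def)
    define t where "t = 2 * d + c * k"
    have t: "4 < rnorm t" "rnorm t \<le> T" using cd by (auto simp: trace_solutions_def t_def)
    have ph: "c' dvd d' * d' - 1" "2 * d' + c' * k = t" "16 * (rnorm c * rnorm c') = q * rnorm (t * t - 4)"
      "c' \<noteq> 0 \<Longrightarrow> phi (c', d') = (c, d)"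
      using phi c p[symmetric] unfolding trace_duality_def t_def by blast+
    have tt: "cmod (cpx (t * t - 4)) = cmod ((cpx t)\<^sup>2 - 4)" by (simp add: power2_eq_square)
    have up: "cmod (cpx (t * t - 4)) \<le> rnorm t + 4"
      using norm_triangle_ineq4[of "(cpx t)\<^sup>2" 4] unfolding tt by (simp add: norm_power norm_cpx_sq)
    have lo: "rnorm t - 4 \<le> cmod (cpx (t * t - 4))"
      using norm_triangle_ineq2[of "(cpx t)\<^sup>2" 4] unfolding tt by (simp add: norm_power norm_cpx_sq)
    have nn: "rnorm (t * t - 4) = (cmod (cpx (t * t - 4)))\<^sup>2" by (simp only: norm_cpx_sq)
    have "cmod (cpx (t * t - 4)) > 0" using lo t by linarith
    then have "rnorm (t * t - 4) > 0" unfolding nn by simp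
    then have "16 * (rnorm c * rnorm c') > 0" unfolding ph(3) using q by (intro mult_pos_pos) auto
    then have c'0: "c' \<noteq> 0" by auto
    have in_A: "(c', d') \<in> ?A" using ph c'0 t by (simp add: trace_solutions_def)
    have "16 * (rnorm c * rnorm c') \<le> 16 * rnorm (t * t - 4)" unfolding ph(3)
      using q by (intro mult_right_mono) auto
    also have "rnorm (t * t - 4) \<le> Y\<^sup>2" unfolding nn using up t by (intro power_mono) (auto simp: Y_def)
    finally have 1: "rnorm c * rnorm c' \<le> Y\<^sup>2" by simp
    (* The lower bound q >= 1 controls the traces for which both c and its dual are small. *)
    have "1 * rnorm (t * t - 4) \<le> 16 * (rnorm c * rnorm c')" unfolding ph(3)
      using q by (intro mult_right_mono) auto
    then have "sqrt (rnorm (t * t - 4)) \<le> sqrt (16 * (rnorm c * rnorm c'))" by simp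
    then have "cmod (cpx (t * t - 4)) \<le> 4 * sqrt (rnorm c * rnorm c')"
      unfolding norm_cpx by (simp only: real_sqrt_mult) simp
    then have 2: "rnorm t - 4 \<le> 4 * sqrt (rnorm c * rnorm c')" using lo by linarith
    show ?thesis using in_A ph(4)[OF c'0] 1 2 unfolding p t_def by simp
  qed
  have Y: "Y \<ge> T" "Y \<ge> 1" using T by (auto simp: Y_def)
  have inv: "finite ?A" "card ?A + card {a \<in> ?A. rnorm (fst a) \<le> Y \<and> rnorm (fst (phi a)) \<le> Y} = 2 * card {a \<in> ?A. rnorm (fst a) \<le> Y}"
  proof -
    have small: "rnorm (fst a) \<le> Y \<or> rnorm (fst (phi a)) \<le> Y" if "a \<in> ?A" for a
    proof (rule ccontr)
      assume "\<not> (rnorm (fst a) \<le> Y \<or> rnorm (fst (phi a)) \<le> Y)"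
      then have "Y * Y < rnorm (fst a) * rnorm (fst (phi a))" using Y by (intro mult_strict_mono) auto
      moreover obtain c d where "a = (c, d)" by (cases a)
      ultimately have "Y * Y < rnorm c * rnorm (fst (phi (c, d)))" "(c, d) \<in> ?A" using that by simp_all
      then show False using key[of c d] unfolding power2_eq_square by linarith
    qed
    have a: "phi a \<in> ?A" "phi (phi a) = a" if "a \<in> ?A" for a
    proof -
      obtain c d where e: "a = (c, d)" by (cases a)
      show "phi a \<in> ?A" "phi (phi a) = a" using key[of c d] that unfolding e by blast+
    qed
    note I = involution_count[of ?A "\<lambda>a. rnorm (fst a)" Y phi, OF small_trace_solutions(1)[OF T Y(1)] a small]
    show "finite ?A" by (rule I(1))
    show "card ?A + card {a \<in> ?A. rnorm (fst a) \<le> Y \<and> rnorm (fst (phi a)) \<le> Y} = 2 * card {a \<in> ?A. rnorm (fst a) \<le> Y}"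
      by (rule I(2))
  qed
  show "finite ?A" by (rule inv(1))
  let ?S = "{a \<in> ?A. rnorm (fst a) \<le> Y \<and> rnorm (fst (phi a)) \<le> Y}"
  have "real (card ?S) \<le> 88 * sqrt Y * rho_root_sum Y"
  proof (rule balanced_trace_solutions[OF Y(2)])
    show "?S \<subseteq> {(c, d). c \<in> gball Y \<and> c dvd d * d - 1 \<and> rnorm (2 * d + c * k) \<le> 4 * cmod (cpx c) * sqrt Y + 4}"
    proof
      fix p assume p: "p \<in> ?S"
      obtain c d where cd: "p = (c, d)" by (cases p)
      have b: "(c, d) \<in> ?A" "rnorm c \<le> Y" "rnorm (fst (phi (c, d))) \<le> Y" using p cd by auto
      have "rnorm (2 * d + c * k) - 4 \<le> 4 * sqrt (rnorm c * rnorm (fst (phi (c, d))))" using key[OF b(1)] by blast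
      also have "\<dots> \<le> 4 * sqrt (rnorm c * Y)" using b by (simp add: mult_left_mono)
      also have "\<dots> = 4 * cmod (cpx c) * sqrt Y" by (simp add: real_sqrt_mult norm_cpx)
      finally show "p \<in> {(c, d). c \<in> gball Y \<and> c dvd d * d - 1 \<and> rnorm (2 * d + c * k) \<le> 4 * cmod (cpx c) * sqrt Y + 4}"
        using b cd by (auto simp: trace_solutions_def gball_def)
    qed
  qed
  note both = this
  have small: "\<bar>real (card {a \<in> ?A. rnorm (fst a) \<le> Y}) - pi * T / 4 * rho_sum Y\<bar> \<le> 60 * sqrt Y * rho_root_sum Y"
    by (rule small_trace_solutions(2)[OF T Y(1)])
  have total: "real (card ?A) + real (card ?S) = 2 * real (card {a \<in> ?A. rnorm (fst a) \<le> Y})"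
    using arg_cong[OF inv(2), of real] by (simp only: of_nat_add of_nat_mult of_nat_numeral)
  have half: "pi * T / 2 * rho_sum Y = 2 * (pi * T / 4 * rho_sum Y)" by simp
  have arith: "\<bar>n1 - 2 * m\<bar> \<le> 208 * s * r"
    if "n1 + n2 = 2 * n3" "0 \<le> n2" "n2 \<le> 88 * s * r" "\<bar>n3 - m\<bar> \<le> 60 * s * r" for n1 n2 n3 m s r :: real
    using that unfolding mult.assoc by linarith
  show "\<bar>real (card ?A) - pi * T / 2 * rho_sum (T + 4)\<bar> \<le> 208 * sqrt (T + 4) * rho_root_sum (T + 4)"
    unfolding Y_def[symmetric] half by (rule arith[OF total of_nat_0_le_iff both small])
qed

section \<open>The Dedekind zeta function of the Gaussian field\<close>

lemma cpx_sum: "cpx (sum f A) = (\<Sum>x\<in>A. cpx (f x))"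
  by (induction A rule: infinite_finite_induct) simp_all

text \<open>
  Write an algebraic integer as a reduced fraction \<open>w / m\<close> of Gaussian integers. The
  monic equation shows that \<open>m\<close> divides a power of \<open>w\<close>, and as \<open>m\<close> is comaximal to it, \<open>m\<close>
  is a unit.
\<close>

lemma gauss_ring_of_integers_carrier:
  "carrier (ring_of_integers rationals_adjoin_i) = range cpx"
proof (intro equalityI subsetI)
  fix x assume "x \<in> range cpx"
  then obtain z where z: "x = cpx z" by blast
  have "x = of_rat (of_int (gre z)) + of_rat (of_int (gim z)) * \<i>"
    unfolding z cpx_def by (simp add: complex_eq_iff)
  then have "x \<in> rationals_adjoin_i" unfolding rationals_adjoin_i_def by blast
  moreover have "algebraic_int x"
  proof (rule algebraic_int.intros)
    define p where "p = [: complex_of_int (gnorm z), - 2 * complex_of_int (gre z), 1 :]"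
    show "poly.coeff p (Polynomial.degree p) = 1" by (simp add: p_def)
    show "\<forall>i. poly.coeff p i \<in> \<int>" by (auto simp: p_def coeff_pCons split: nat.splits)
    show "poly p x = 0"
      by (simp add: p_def z cpx_def complex_eq_iff gnorm_def power2_eq_square algebra_simps)
  qed
  ultimately show "x \<in> carrier (ring_of_integers rationals_adjoin_i)"
    by (simp add: ring_of_integers_def)
next
  fix x assume "x \<in> carrier (ring_of_integers rationals_adjoin_i)"
  then have x: "x \<in> rationals_adjoin_i" "algebraic_int x" by (simp_all add: ring_of_integers_def)
  obtain a b where ab: "x = of_rat a + of_rat b * \<i>" using x(1) by (auto simp: rationals_adjoin_i_def)
  obtain a1 a2 where "quotient_of a = (a1, a2)" by (cases "quotient_of a")
  then have a: "a = of_int a1 / of_int a2" "a2 > 0" by (auto dest: quotient_of_div quotient_of_denom_pos)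
  obtain b1 b2 where "quotient_of b = (b1, b2)" by (cases "quotient_of b")
  then have b: "b = of_int b1 / of_int b2" "b2 > 0" by (auto dest: quotient_of_div quotient_of_denom_pos)
  have den: "cpx (of_int (a2 * b2)) * x = cpx (Gauss (a1 * b2) (b1 * a2))"
    unfolding ab a b using a b by (simp add: cpx_def complex_eq_iff of_rat_divide)
  define D where "D = (of_int (a2 * b2) :: gauss)"
  define W where "W = Gauss (a1 * b2) (b1 * a2)"
  have D0: "D \<noteq> 0" using a b by (simp add: D_def gauss_eq_iff)
  obtain g u v where g: "g dvd D" "g dvd W" "g = u * D + v * W" by (rule gauss_bezout)
  obtain m where m: "D = g * m" using g(1) by (elim dvdE)
  obtain w where w: "W = g * w" using g(2) by (elim dvdE)
  have g0: "g \<noteq> 0" "m \<noteq> 0" using D0 m by auto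
  have "g * 1 = g * (u * m + v * w)" using g(3) m w by (simp add: algebra_simps)
  then have "u * m + v * w = 1" using g0 by (simp only: mult_cancel_left) auto
  then have cop: "comax m w" unfolding comax_def by blast
  have "cpx g * (cpx m * x) = cpx g * cpx w" using den unfolding D_def[symmetric] W_def[symmetric] m w by (simp add: mult.assoc)
  then have mx: "cpx m * x = cpx w" using g0 by simp
  obtain p where p: "poly.coeff p (Polynomial.degree p) = 1" "\<And>i. poly.coeff p i \<in> \<int>" "poly p x = 0"
    using x(2) by (auto elim: algebraic_int.cases)
  define n where "n = Polynomial.degree p"
  define c where "c = (\<lambda>i. \<lfloor>Re (poly.coeff p i)\<rfloor>)"
  have c: "poly.coeff p i = cpx (of_int (c i))" for i
    using p(2)[of i] by (auto simp: c_def cpx_def complex_eq_iff elim!: Ints_cases)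
  (* Multiplying the equation by the n-th power of the denominator clears all fractions. *)
  have "0 = cpx m ^ n * (\<Sum>i\<le>n. poly.coeff p i * x ^ i)" using p(3) by (simp add: poly_altdef n_def)
  also have "\<dots> = (\<Sum>i\<le>n. cpx (of_int (c i) * w ^ i * m ^ (n - i)))"
    unfolding sum_distrib_left
  proof (rule sum.cong[OF refl])
    fix i assume "i \<in> {..n}"
    then have "cpx m ^ n = cpx m ^ (n - i) * cpx m ^ i" by (simp flip: power_add)
    then have "cpx m ^ n * (poly.coeff p i * x ^ i) = poly.coeff p i * (cpx m * x) ^ i * cpx m ^ (n - i)"
      by (simp add: power_mult_distrib mult_ac)
    then show "cpx m ^ n * (poly.coeff p i * x ^ i) = cpx (of_int (c i) * w ^ i * m ^ (n - i))"
      unfolding mx c by simp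
  qed
  also have "\<dots> = cpx (\<Sum>i\<le>n. of_int (c i) * w ^ i * m ^ (n - i))"
    by (simp only: cpx_sum)
  finally have z: "(\<Sum>i\<le>n. of_int (c i) * w ^ i * m ^ (n - i)) = 0"
    by (metis cpx_eq_0_iff)
  have cn: "c n = 1" using p(1) by (simp add: c_def n_def)
  have "(\<Sum>i\<le>n. of_int (c i) * w ^ i * m ^ (n - i)) = w ^ n + (\<Sum>i<n. of_int (c i) * w ^ i * m ^ (n - i))"
    by (simp add: cn flip: lessThan_Suc_atMost)
  then have "w ^ n = - (\<Sum>i<n. of_int (c i) * w ^ i * m ^ (n - i))" using z by (simp add: eq_neg_iff_add_eq_0)
  moreover have "m dvd (\<Sum>i<n. of_int (c i) * w ^ i * m ^ (n - i))"
    by (intro dvd_sum dvd_mult) (simp add: dvd_power)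
  ultimately have dv: "m dvd w ^ n" by simp
  have "comax m (w ^ k)" for k
  proof (induction k)
    case 0
    have "0 * m + 1 * 1 = (1 :: gauss)" by simp
    then show ?case unfolding comax_def power_0 by blast
  qed (use cop comax_mult_right in auto)
  then have "m dvd 1" by (rule comax_unit_dvd[OF _ dvd_refl dv])
  then have m1: "m * gcnj m = 1" using gauss_unit_iff mult_gcnj[of m] by simp
  have "cpx (m * gcnj m) * x = cpx (gcnj m) * (cpx m * x)" by (simp only: cpx_simps mult_ac)
  then have "x = cpx (gcnj m * w)" unfolding m1 mx by simp
  then show "x \<in> range cpx" by (rule range_eqI)
qed

lemma ring_of_integers_simps [simp]:
  "monoid.mult (ring_of_integers K) = (*)" "monoid.one (ring_of_integers K) = 1"
  "ring.add (ring_of_integers K) = (+)" "ring.zero (ring_of_integers K) = 0"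
  by (simp_all add: ring_of_integers_def)

abbreviation ZI :: "complex ring" where "ZI \<equiv> ring_of_integers rationals_adjoin_i"

lemma cpx_range_closed:
  "x \<in> range cpx \<Longrightarrow> y \<in> range cpx \<Longrightarrow> x + y \<in> range cpx"
  "x \<in> range cpx \<Longrightarrow> y \<in> range cpx \<Longrightarrow> x * y \<in> range cpx"
  "x \<in> range cpx \<Longrightarrow> - x \<in> range cpx" "0 \<in> range cpx" "1 \<in> range cpx"
  by (auto simp flip: cpx_simps)

lemma ZI_cring: "cring ZI"
proof (rule cringI)
  show "abelian_group ZI"
  proof (rule abelian_groupI)
    fix x assume "x \<in> carrier ZI"
    then have "- x \<in> carrier ZI" "- x + x = 0"
      by (simp_all add: gauss_ring_of_integers_carrier cpx_range_closed)
    then show "\<exists>y\<in>carrier ZI. y \<oplus>\<^bsub>ZI\<^esub> x = \<zero>\<^bsub>ZI\<^esub>" by (intro bexI[of _ "- x"]) simp_all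
  qed (auto simp: gauss_ring_of_integers_carrier cpx_range_closed algebra_simps simp del: cpx_simps)
  show "comm_monoid ZI"
    by (rule comm_monoidI)
       (auto simp: gauss_ring_of_integers_carrier cpx_range_closed algebra_simps simp del: cpx_simps)
qed (auto simp: algebra_simps)

definition gauss_ideal :: "gauss \<Rightarrow> complex set"
  where "gauss_ideal z = {cpx (z * w) | w. True}"

lemma gauss_ideal_is_ideal: "ideal (gauss_ideal z) ZI"
proof -
  interpret cring ZI by (rule ZI_cring)
  have "gauss_ideal z = PIdl\<^bsub>ZI\<^esub> (cpx z)"
    unfolding cgenideal_def gauss_ideal_def by (auto simp: gauss_ring_of_integers_carrier mult.commute)
  then show ?thesis using cgenideal_ideal[of "cpx z"] by (simp add: gauss_ring_of_integers_carrier)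
qed

lemma gauss_ideal_eq_iff: "gauss_ideal z = gauss_ideal w \<longleftrightarrow> z dvd w \<and> w dvd z"
proof -
  have mem: "cpx a \<in> gauss_ideal b \<longleftrightarrow> b dvd a" for a b
    by (auto simp: gauss_ideal_def dvd_def simp del: cpx_simps)
  show ?thesis
  proof
    assume "gauss_ideal z = gauss_ideal w"
    then show "z dvd w \<and> w dvd z" using mem[of w z] mem[of z w] mem[of z z] mem[of w w] by simp
  next
    assume zw: "z dvd w \<and> w dvd z"
    have "gauss_ideal a \<subseteq> gauss_ideal b" if "b dvd a" for a b
    proof
      fix x assume "x \<in> gauss_ideal a"
      then obtain v where "x = cpx (a * v)" by (auto simp: gauss_ideal_def)
      then show "x \<in> gauss_ideal b" using mem[of "a * v" b] that by (simp del: cpx_simps)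
    qed
    then show "gauss_ideal z = gauss_ideal w" using zw by blast
  qed
qed

text \<open>
  An element of least norm generates the ideal, by division with remainder.
\<close>

lemma gauss_ideal_principal:
  assumes "ideal I ZI" "I \<noteq> {0}" obtains z where "z \<noteq> 0" "I = gauss_ideal z"
proof -
  interpret ideal I ZI by fact
  have sub: "I \<subseteq> range cpx" using a_subset by (simp add: gauss_ring_of_integers_carrier)
  have as: "additive_subgroup I ZI" by (rule ideal.axioms(1)[OF assms(1)])
  have z0: "0 \<in> I" using additive_subgroup.zero_closed[OF as] by simp
  then obtain x where "x \<in> I" "x \<noteq> 0" using assms(2) by blast
  then obtain y where "cpx y \<in> I" "y \<noteq> 0" using sub by fastforce
  then obtain z where z: "cpx z \<in> I \<and> z \<noteq> 0" and min: "\<And>y. cpx y \<in> I \<and> y \<noteq> 0 \<Longrightarrow> nat (gnorm z) \<le> nat (gnorm y)"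
    using ex_has_least_nat[of "\<lambda>y. cpx y \<in> I \<and> y \<noteq> 0" y "\<lambda>y. nat (gnorm y)"] by blast
  have mul: "cpx (z * w) \<in> I" for w
    using I_r_closed[of "cpx z" "cpx w"] z by (simp add: gauss_ring_of_integers_carrier)
  have "z dvd y" if y: "cpx y \<in> I" for y
  proof -
    have "cpx y + cpx (z * (- gdiv y z)) \<in> I"       using additive_subgroup.a_closed[OF as y mul[of "- gdiv y z"]] by simp
    moreover have "cpx y + cpx (z * (- gdiv y z)) = cpx (gmod y z)"
      unfolding gmod_def by simp
    ultimately have r: "cpx (gmod y z) \<in> I" by simp
    have "gmod y z = 0"
    proof (rule ccontr)
      assume "gmod y z \<noteq> 0"
      then have "nat (gnorm z) \<le> nat (gnorm (gmod y z))" using r min by blast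
      moreover have "2 * gnorm (gmod y z) \<le> gnorm z" using z by (intro gnorm_gmod) auto
      moreover have "gnorm z > 0" using z by simp
      ultimately show False by linarith
    qed
    then show ?thesis using dvd_minus_gmod[of z y] by simp
  qed
  then have "I = gauss_ideal z"
    using sub mul by (auto simp: gauss_ideal_def dvd_def simp del: cpx_simps)
  then show ?thesis using z that by blast
qed

text \<open>
  The cosets correspond to the canonical residues.
\<close>

lemma gauss_ideal_norm:
  assumes z: "z \<noteq> 0" shows "ideal_norm ZI (gauss_ideal z) = nat (gnorm z)"
proof -
  let ?C = "\<lambda>r. {cpx (r + z * w) | w. True}"
  have coset: "gauss_ideal z +>\<^bsub>ZI\<^esub> cpx a = ?C a" for a
    by (auto simp: a_r_coset_def' gauss_ideal_def add.commute)
  have C_eq: "?C a = ?C b \<longleftrightarrow> z dvd a - b" for a b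
  proof
    assume "?C a = ?C b"
    moreover have "cpx (a + z * 0) \<in> ?C a" by blast
    ultimately obtain w where "cpx (a + z * 0) = cpx (b + z * w)" by blast
    then have "a - b = z * w" by (simp add: algebra_simps del: cpx_simps)
    then show "z dvd a - b" by simp
  next
    have *: "?C a \<subseteq> ?C b" if d: "z dvd a - b" for a b
    proof
      fix x assume "x \<in> ?C a"
      then obtain w where x: "x = cpx (a + z * w)" by blast
      obtain v where "a - b = z * v" using d by (elim dvdE)
      then have "a + z * w = b + z * (v + w)" by (simp add: algebra_simps)
      then have "x = cpx (b + z * (v + w))" using x by simp
      then show "x \<in> ?C b" by blast
    qed
    assume "z dvd a - b"
    moreover from this have "z dvd b - a" by (metis dvd_minus_iff minus_diff_eq)
    ultimately show "?C a = ?C b" using * by blast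
  qed
  have "carrier (ZI Quot gauss_ideal z) = (\<lambda>r. gauss_ideal z +>\<^bsub>ZI\<^esub> cpx r) ` UNIV"
    by (auto simp: FactRing_def A_RCOSETS_def' gauss_ring_of_integers_carrier)
  also have "\<dots> = range ?C" unfolding coset ..
  also have "\<dots> = ?C ` residues z"
  proof (intro equalityI subsetI)
    fix X assume "X \<in> range ?C"
    then obtain a where "X = ?C a" by blast
    then have "X = ?C (gmod a z)" using C_eq[of a "gmod a z"] dvd_minus_gmod[of z a] by blast
    then show "X \<in> ?C ` residues z" using gmod_in_residues[OF z] by blast
  qed blast
  finally have "ideal_norm ZI (gauss_ideal z) = card (?C ` residues z)" by (simp add: ideal_norm_def)
  also have "\<dots> = card (residues z)"
    by (rule card_image, rule inj_onI) (use C_eq residues_dvd_imp_eq[OF z] in blast)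
  finally show ?thesis using card_residues[OF z] by simp
qed

text \<open>
  Every nonzero ideal has exactly four generators, so that its zeta function is a quarter
  of the lattice sum.
\<close>

lemma dedekind_zeta_gauss_2: "dedekind_zeta rationals_adjoin_i 2 = pi\<^sup>2 / 6 * catalan"
proof -
  define Ids where "Ids = {I. ideal I ZI \<and> I \<noteq> {0}}"
  define f where "f = (\<lambda>I. real (ideal_norm ZI I) powr (-2))"
  have gi0: "gauss_ideal z \<noteq> {0}" if "z \<noteq> 0" for z
  proof -
    have "cpx (z * 1) \<in> gauss_ideal z" unfolding gauss_ideal_def by blast
    moreover have "cpx (z * 1) \<noteq> 0" using that by simp
    ultimately show ?thesis by blast
  qed
  have fz: "f (gauss_ideal z) = 1 / (rnorm z)\<^sup>2" if "z \<noteq> 0" for z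
  proof -
    have "real (ideal_norm ZI (gauss_ideal z)) = rnorm z" using gauss_ideal_norm[OF that] by simp
    moreover have "rnorm z powr (-2) = 1 / (rnorm z)\<^sup>2"
      by (rule powr_neg_numeral) (use rnorm_ge_1[OF that] in linarith)
    ultimately show ?thesis by (simp only: f_def)
  qed
  have Z: "((\<lambda>z. 1 / (rnorm z)\<^sup>2) has_sum (2 * pi\<^sup>2 / 3 * catalan)) (- {0})" by (rule zeta_lattice_has_sum)
  define B where "B = (\<lambda>I. {z. z \<noteq> 0 \<and> gauss_ideal z = I})"
  define F where "F = (\<lambda>p :: complex set \<times> gauss. f (fst p))"
  have "bij_betw (\<lambda>z. (gauss_ideal z, z)) (- {0}) (Sigma Ids B)"
  proof (rule bij_betwI[where g = snd])
    show "(\<lambda>z. (gauss_ideal z, z)) \<in> - {0} \<rightarrow> Sigma Ids B"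
      using gauss_ideal_is_ideal gi0 by (intro Pi_I) (simp add: Ids_def B_def)
    show "snd \<in> Sigma Ids B \<rightarrow> - {0}" by (intro Pi_I) (auto simp: B_def)
    show "(gauss_ideal (snd p), snd p) = p" if "p \<in> Sigma Ids B" for p
      using that by (auto simp: B_def)
  qed simp
  then have "((\<lambda>z. F (gauss_ideal z, z)) has_sum (2 * pi\<^sup>2 / 3 * catalan)) (- {0}) \<longleftrightarrow>
      (F has_sum (2 * pi\<^sup>2 / 3 * catalan)) (Sigma Ids B)"
    by (rule has_sum_reindex_bij_betw)
  moreover have "((\<lambda>z. F (gauss_ideal z, z)) has_sum (2 * pi\<^sup>2 / 3 * catalan)) (- {0}) \<longleftrightarrow>
      ((\<lambda>z. 1 / (rnorm z)\<^sup>2) has_sum (2 * pi\<^sup>2 / 3 * catalan)) (- {0})"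
    by (rule has_sum_cong) (simp add: fz F_def)
  ultimately have sF: "(F has_sum (2 * pi\<^sup>2 / 3 * catalan)) (Sigma Ids B)" using Z by blast
  have "((\<lambda>I. 4 * f I) has_sum (2 * pi\<^sup>2 / 3 * catalan)) Ids"
  proof (rule has_sum_SigmaD[where f = F and B = B and A = Ids, OF sF])
    fix I assume "I \<in> Ids"
    then have "ideal I ZI" "I \<noteq> {0}" by (simp_all add: Ids_def)
    then obtain z where z: "z \<noteq> 0" "I = gauss_ideal z" by (rule gauss_ideal_principal)
    have "{y. y \<noteq> 0 \<and> gauss_ideal y = I} = (*) z ` {e. gnorm e = 1}"
    proof (intro equalityI subsetI)
      fix y assume "y \<in> {y. y \<noteq> 0 \<and> gauss_ideal y = I}"
      then have "gauss_ideal y = gauss_ideal z" unfolding z(2) by blast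
      then have y: "z dvd y" "y dvd z" unfolding gauss_ideal_eq_iff by blast+
      obtain e where e: "y = z * e" using y(1) by (elim dvdE)
      obtain e' where e': "z = y * e'" using y(2) by (elim dvdE)
      have "z * (e * e') = (z * e) * e'" by (simp only: mult.assoc)
      also have "\<dots> = z" by (simp only: e[symmetric] e'[symmetric])
      finally have "z * 1 = z * (e * e')" by simp
      then have "1 = e * e'" using z by (simp only: mult_cancel_left) auto
      then have "e dvd 1" by (rule dvdI)
      then show "y \<in> (*) z ` {e. gnorm e = 1}" using e unfolding gauss_unit_iff by blast
    next
      fix y assume "y \<in> (*) z ` {e. gnorm e = 1}"
      then obtain e where e: "y = z * e" "gnorm e = 1" by blast
      have "z = y * gcnj e" unfolding e(1) mult.assoc gauss_unit_mult_gcnj(1)[OF e(2)] by simp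
      then have "y dvd z" by (rule dvdI)
      moreover have "z dvd y" using e by simp
      ultimately have "gauss_ideal y = I" unfolding z(2) gauss_ideal_eq_iff by blast
      moreover have "y \<noteq> 0" using e z by auto
      ultimately show "y \<in> {y. y \<noteq> 0 \<and> gauss_ideal y = I}" by blast
    qed
    moreover have "card ((*) z ` {e. gnorm e = 1}) = 4"
      using card_units_gauss z by (subst card_image) (auto simp: inj_on_def)
    ultimately have "card {y. y \<noteq> 0 \<and> gauss_ideal y = I} = 4" by simp
    moreover from this have "finite {y. y \<noteq> 0 \<and> gauss_ideal y = I}" by (intro card_ge_0_finite) simp
    ultimately show "((\<lambda>y. F (I, y)) has_sum 4 * f I) (B I)"
      unfolding B_def F_def by (intro has_sum_finiteI) simp_all
  qed
  then have "((\<lambda>I. 1 / 4 * (4 * f I)) has_sum 1 / 4 * (2 * pi\<^sup>2 / 3 * catalan)) Ids" by (rule has_sum_cmult_right)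
  moreover have "1 / 4 * (2 * pi\<^sup>2 / 3 * catalan) = pi\<^sup>2 / 6 * catalan" "1 / 4 * (4 * f I) = f I" for I
    by simp_all
  ultimately have "(f has_sum pi\<^sup>2 / 6 * catalan) Ids" by (simp only:)
  then show ?thesis unfolding dedekind_zeta_def f_def Ids_def by (rule infsumI)
qed

section \<open>The asymptotic formula\<close>

text \<open>
  For \<open>c = 0\<close> the determinant forces \<open>d\<^sup>2 = 1\<close> and the trace has squared modulus 4, which
  is excluded.
\<close>

lemma B_set_eq_trace_solutions:
  "B_set T = (\<Union>k\<in>shift_set. (\<lambda>(c, d). (cpx c, cpx d, cpx k)) ` trace_solutions k T)"
proof -
  have shifts: "cpx ` shift_set = {0, 1, \<i>, 1 + \<i>}"
    by (auto simp: shift_set_def cpx_def complex_eq_iff image_iff)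
  have det: "det (M_mat (cpx c) (cpx d) (cpx k) (cpx b)) = 1 \<longleftrightarrow> d * d - 1 = c * (b - k * d)" for b c d k
  proof -
    have "det (M_mat (cpx c) (cpx d) (cpx k) (cpx b)) = cpx ((d + c * k) * d - b * c)"
      by (simp add: det_M_mat)
    also have "\<dots> = 1 \<longleftrightarrow> (d + c * k) * d - b * c = 1" by (metis cpx_eq_iff cpx_simps(2))
    also have "\<dots> \<longleftrightarrow> d * d - 1 = c * (b - k * d)" by (auto simp: algebra_simps)
    finally show ?thesis .
  qed
  have tr: "(cmod (trace (M_mat (cpx c) (cpx d) (cpx k) b)))\<^sup>2 = rnorm (2 * d + c * k)" for b c d k
    using norm_cpx_sq[of "2 * d + c * k"] by (simp add: trace_M_mat)
  have mem: "(cpx c, cpx d, cpx k) \<in> B_set T \<longleftrightarrow> k \<in> shift_set \<and> (c, d) \<in> trace_solutions k T" for c d k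
  proof -
    have k: "cpx k \<in> {0, 1, \<i>, 1 + \<i>} \<longleftrightarrow> k \<in> shift_set"
      unfolding shifts[symmetric] by (simp add: inj_image_mem_iff inj_cpx)
    have "(\<exists>b\<in>gaussian_integers. det (M_mat (cpx c) (cpx d) (cpx k) b) = 1 \<and>
        4 < (cmod (trace (M_mat (cpx c) (cpx d) (cpx k) b)))\<^sup>2 \<and> (cmod (trace (M_mat (cpx c) (cpx d) (cpx k) b)))\<^sup>2 \<le> T)
      \<longleftrightarrow> (\<exists>b. d * d - 1 = c * (b - k * d)) \<and> 4 < rnorm (2 * d + c * k) \<and> rnorm (2 * d + c * k) \<le> T"
      unfolding range_cpx[symmetric] tr by (auto simp: det)
    also have "(\<exists>b. d * d - 1 = c * (b - k * d)) \<longleftrightarrow> c dvd d * d - 1"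
    proof
      assume "c dvd d * d - 1"
      then obtain u where "d * d - 1 = c * u" by (elim dvdE)
      then have "d * d - 1 = c * ((u + k * d) - k * d)" by simp
      then show "\<exists>b. d * d - 1 = c * (b - k * d)" by blast
    qed auto
    finally have ex: "(\<exists>b\<in>gaussian_integers. det (M_mat (cpx c) (cpx d) (cpx k) b) = 1 \<and>
        4 < (cmod (trace (M_mat (cpx c) (cpx d) (cpx k) b)))\<^sup>2 \<and> (cmod (trace (M_mat (cpx c) (cpx d) (cpx k) b)))\<^sup>2 \<le> T)
      \<longleftrightarrow> c dvd d * d - 1 \<and> 4 < rnorm (2 * d + c * k) \<and> rnorm (2 * d + c * k) \<le> T" .
    have c0: "c \<noteq> 0" if "c dvd d * d - 1" "4 < rnorm (2 * d + c * k)"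
    proof
      assume "c = 0"
      then have "d * d = 1" using that by simp
      then have "d dvd 1" by (intro dvdI) (rule sym)
      then have "gnorm d = 1" unfolding gauss_unit_iff .
      moreover have "gnorm 2 = 4" by (simp add: gnorm_def)
      ultimately show False using that(2) \<open>c = 0\<close> by (simp add: gnorm_mult)
    qed
    have "cpx c \<in> gaussian_integers" "cpx d \<in> gaussian_integers" using range_cpx by blast+
    then have "(cpx c, cpx d, cpx k) \<in> B_set T \<longleftrightarrow> k \<in> shift_set \<and>
        (c dvd d * d - 1 \<and> 4 < rnorm (2 * d + c * k) \<and> rnorm (2 * d + c * k) \<le> T)"
      unfolding B_set_def ex[symmetric] k[symmetric] mem_Collect_eq prod.case by (simp only: simp_thms)
    then show ?thesis using c0 unfolding trace_solutions_def by blast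
  qed
  show ?thesis
  proof (intro equalityI subsetI)
    fix x assume x: "x \<in> B_set T"
    obtain c d k where "x = (cpx c, cpx d, cpx k)"
    proof -
      obtain c d k where e: "x = (c, d, k)" by (metis surj_pair)
      have "c \<in> range cpx" "d \<in> range cpx" "k \<in> cpx ` shift_set"
        using x unfolding e B_set_def shifts range_cpx by simp_all
      then obtain c' d' k' where "c = cpx c'" "d = cpx d'" "k = cpx k'" by blast
      then have "x = (cpx c', cpx d', cpx k')" using e by simp
      then show ?thesis by (rule that)
    qed
    note e = this
    have kx: "k \<in> shift_set" "(c, d) \<in> trace_solutions k T" using x mem[of c d k] unfolding e by blast+
    have "x = (\<lambda>(c, d). (cpx c, cpx d, cpx k)) (c, d)" using e by simp
    then have "x \<in> (\<lambda>(c, d). (cpx c, cpx d, cpx k)) ` trace_solutions k T" using kx(2) by (rule image_eqI)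
    then show "x \<in> (\<Union>k\<in>shift_set. (\<lambda>(c, d). (cpx c, cpx d, cpx k)) ` trace_solutions k T)"
      using kx(1) by blast
  next
    fix x assume "x \<in> (\<Union>k\<in>shift_set. (\<lambda>(c, d). (cpx c, cpx d, cpx k)) ` trace_solutions k T)"
    then obtain k c d where "k \<in> shift_set" "(c, d) \<in> trace_solutions k T" "x = (cpx c, cpx d, cpx k)" by auto
    then show "x \<in> B_set T" using mem[of c d k] by simp
  qed
qed

lemma card_B_set:
  assumes "T \<ge> 4"
  shows "card (B_set T) = (\<Sum>k\<in>shift_set. card (trace_solutions k T))"
proof -
  let ?f = "\<lambda>k (c, d). (cpx c, cpx d, cpx k)"
  have "card (B_set T) = (\<Sum>k\<in>shift_set. card (?f k ` trace_solutions k T))"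
    unfolding B_set_eq_trace_solutions
  proof (rule card_UN_disjoint)
    show "finite shift_set" by (simp add: shift_set_def)
    show "\<forall>k\<in>shift_set. finite (?f k ` trace_solutions k T)"
      using card_trace_solutions(1)[OF _ assms] by blast
    show "\<forall>k\<in>shift_set. \<forall>l\<in>shift_set. k \<noteq> l \<longrightarrow> ?f k ` trace_solutions k T \<inter> ?f l ` trace_solutions l T = {}"
      by auto
  qed
  also have "\<dots> = (\<Sum>k\<in>shift_set. card (trace_solutions k T))"
    by (intro sum.cong refl card_image) (auto simp: inj_on_def)
  finally show ?thesis .
qed

lemma card_shift_set: "card shift_set = 4" "finite shift_set"
  by (simp_all add: shift_set_def gauss_eq_iff)

text \<open>
  Summing over the four shifts, \<open>B_set T\<close> has \<open>2 * pi * T * rho_sum (T + 4)\<close> elements up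
  to \<open>O(T * ln T)\<close>, and passing from \<open>ln (T + 4)\<close> to \<open>ln T\<close> changes this by no more than
  the error.
\<close>

lemma card_B_set_bound:
  obtains C where "\<And>T. T \<ge> 4 \<Longrightarrow>
    \<bar>real (card (B_set T)) - 3 * pi / (2 * catalan) * T * (ln T)\<^sup>2\<bar> \<le> C * (T * ln T)"
proof -
  define b where "b = 3 / (4 * catalan)"
  obtain K where K: "K \<ge> 0" "\<And>x. x \<ge> 1 \<Longrightarrow> \<bar>rho_sum x - b * (ln x)\<^sup>2\<bar> \<le> K * (1 + ln x)"
    unfolding b_def using rho_sum_asymptotic by blast
  obtain R where R: "R \<ge> 0" "\<And>x. x \<ge> 1 \<Longrightarrow> rho_root_sum x \<le> R * sqrt x * (1 + ln x)"
    using rho_root_sum_bound by blast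
  have b0: "b \<ge> 0" unfolding b_def using catalan_bounds by simp
  show ?thesis
  proof (rule that[of "832 * R * 6 + 8 * (K * 3 + 6 * b)"])
    fix T :: real assume T: "T \<ge> 4"
    define Y where "Y = T + 4"
    define L where "L = ln T"
    have Y: "Y \<ge> 1" "Y \<le> 2 * T" using T by (auto simp: Y_def)
    have L1: "L \<ge> 1"
    proof -
      have "exp 1 \<le> T" using exp_le T by linarith
      then show ?thesis unfolding L_def using T by (subst ln_ge_iff) auto
    qed
    have diff: "0 \<le> ln Y - L" "ln Y - L \<le> 1"
    proof -
      have e: "ln Y - L = ln (Y / T)" using T Y by (simp add: L_def ln_div)
      have "1 \<le> Y / T" "Y / T \<le> 2" using T by (auto simp: Y_def field_simps)
      then show "0 \<le> ln Y - L" "ln Y - L \<le> 1"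
        unfolding e using ln_le_minus_one[of "Y / T"] by auto
    qed
    have lY: "1 + ln Y \<le> 3 * L" using diff L1 by linarith
    have main: "\<bar>rho_sum Y - b * L\<^sup>2\<bar> \<le> (K * 3 + 6 * b) * L"
    proof -
      have "K * (1 + ln Y) \<le> K * (3 * L)" using lY K by (intro mult_left_mono)
      then have 1: "\<bar>rho_sum Y - b * (ln Y)\<^sup>2\<bar> \<le> K * (3 * L)" using K(2)[OF Y(1)] by linarith
      have "(ln Y)\<^sup>2 - L\<^sup>2 = (ln Y - L) * (ln Y + L)" by (simp add: power2_eq_square algebra_simps)
      moreover have "\<dots> \<le> 1 * (6 * L)" using diff lY L1 by (intro mult_mono; linarith)
      moreover have "0 \<le> (ln Y - L) * (ln Y + L)" using diff L1 by (intro mult_nonneg_nonneg; linarith)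
      ultimately have "\<bar>(ln Y)\<^sup>2 - L\<^sup>2\<bar> \<le> 6 * L" by linarith
      then have "b * \<bar>(ln Y)\<^sup>2 - L\<^sup>2\<bar> \<le> b * (6 * L)" using b0 by (intro mult_left_mono)
      then have 2: "\<bar>b * (ln Y)\<^sup>2 - b * L\<^sup>2\<bar> \<le> b * (6 * L)" using b0
        by (simp add: abs_mult flip: right_diff_distrib)
      have "(K * 3 + 6 * b) * L = K * (3 * L) + b * (6 * L)" by (simp add: algebra_simps)
      then show ?thesis using 1 2 by linarith
    qed
    have "\<bar>real (card (B_set T)) - 4 * (pi * T / 2 * rho_sum Y)\<bar>
        = \<bar>\<Sum>k\<in>shift_set. (real (card (trace_solutions k T)) - pi * T / 2 * rho_sum Y)\<bar>"
      unfolding card_B_set[OF T] by (simp add: sum_subtractf card_shift_set)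
    also have "\<dots> \<le> (\<Sum>k\<in>shift_set. 208 * sqrt Y * rho_root_sum Y)"
      by (rule order_trans[OF sum_abs sum_mono]) (use card_trace_solutions(2) T in \<open>auto simp: Y_def\<close>)
    also have "\<dots> = 832 * sqrt Y * rho_root_sum Y" by (simp add: card_shift_set)
    also have "\<dots> \<le> 832 * sqrt Y * (R * sqrt Y * (1 + ln Y))"
      using R(2)[OF Y(1)] Y by (intro mult_left_mono) auto
    also have "\<dots> = 832 * R * (Y * (1 + ln Y))" using Y by simp
    also have "\<dots> \<le> 832 * R * ((2 * T) * (3 * L))"
      using R(1) Y lY diff L1 by (intro mult_left_mono mult_mono; simp)
    finally have A: "\<bar>real (card (B_set T)) - 4 * (pi * T / 2 * rho_sum Y)\<bar> \<le> 832 * R * ((2 * T) * (3 * L))" .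
    have "\<bar>2 * pi * T * (rho_sum Y - b * L\<^sup>2)\<bar> \<le> 2 * 4 * T * ((K * 3 + 6 * b) * L)"
      unfolding abs_mult using main T pi_less_4 by (intro mult_mono) auto
    then have B: "\<bar>4 * (pi * T / 2 * rho_sum Y) - 2 * pi * T * b * L\<^sup>2\<bar> \<le> 8 * T * ((K * 3 + 6 * b) * L)"
      by (simp add: algebra_simps)
    have c: "3 * pi / (2 * catalan) * T * (ln T)\<^sup>2 = 2 * pi * T * b * L\<^sup>2"
      unfolding b_def L_def using catalan_bounds by (simp add: field_simps)
    have "(832 * R * 6 + 8 * (K * 3 + 6 * b)) * (T * ln T)
        = 832 * R * ((2 * T) * (3 * L)) + 8 * T * ((K * 3 + 6 * b) * L)"
      unfolding L_def by (simp add: algebra_simps)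
    then show "\<bar>real (card (B_set T)) - 3 * pi / (2 * catalan) * T * (ln T)\<^sup>2\<bar>
        \<le> (832 * R * 6 + 8 * (K * 3 + 6 * b)) * (T * ln T)"
      unfolding c using A B by linarith
  qed
qed

theorem theorem6p7:
  shows "(\<lambda>T. real (card (B_set T))
            - pi ^ 3 / (4 * dedekind_zeta rationals_adjoin_i 2) * T * (ln T)\<^sup>2)
           \<in> O[at_top](\<lambda>T. T * ln T * (ln (ln T))\<^sup>2)
       \<and> (\<lambda>T. real (card (B_set T)) - 3 * pi / (2 * catalan) * T * (ln T)\<^sup>2)
           \<in> O[at_top](\<lambda>T. T * ln T * (ln (ln T))\<^sup>2)"
proof -
  obtain C where C: "\<And>T. T \<ge> 4 \<Longrightarrow>
    \<bar>real (card (B_set T)) - 3 * pi / (2 * catalan) * T * (ln T)\<^sup>2\<bar> \<le> C * (T * ln T)"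
    using card_B_set_bound by blast
  have "(\<lambda>T. real (card (B_set T)) - 3 * pi / (2 * catalan) * T * (ln T)\<^sup>2) \<in> O[at_top](\<lambda>T. T * ln T)"
  proof (rule bigoI[where c = C])
    show "\<forall>\<^sub>F T in at_top. norm (real (card (B_set T)) - 3 * pi / (2 * catalan) * T * (ln T)\<^sup>2) \<le> C * norm (T * ln T)"
      using eventually_ge_at_top[of 4] by eventually_elim (use C in auto)
  qed
  also have "(\<lambda>T :: real. T * ln T) \<in> O[at_top](\<lambda>T. T * ln T * (ln (ln T))\<^sup>2)"
    by real_asymp
  finally have main: "(\<lambda>T. real (card (B_set T)) - 3 * pi / (2 * catalan) * T * (ln T)\<^sup>2)
     \<in> O[at_top](\<lambda>T. T * ln T * (ln (ln T))\<^sup>2)" .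
  have "pi ^ 3 / (4 * dedekind_zeta rationals_adjoin_i 2) = 3 * pi / (2 * catalan)"
    unfolding dedekind_zeta_gauss_2 using catalan_bounds by (simp add: field_simps power2_eq_square power3_eq_cube)
  then show ?thesis using main by (simp only: simp_thms)
qed

end
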